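(* Suppose $V$ is $\alpha$-strongly convex and $\beta$-smooth ($0<\alpha\le\beta$), let $\hat\pi$ be the minimizer of $\mathcal F$ over $\mathsf{BW}(\mathbb R^d)$, and let $0<\eta\le1/\beta$. Then the iterates of (deterministic) FB--GVI satisfy, for all $N\ge0$, $$W_2^2(p_N,\hat\pi)\le \exp(-\alpha N\eta)\,W_2^2(p_0,\hat\pi).$$ Consequently, if $\eta=1/\beta$, $\varepsilon>0$ and $N\ge \frac{\beta}{\alpha}\max\{1,\log\frac{\alpha W_2^2(p_0,\hat\pi)}{\varepsilon^2}\}$, then $\alpha W_2^2(p_N,\hat\pi)\le\varepsilon^2$ and $\mathcal F(p_{2N})-\mathcal F(\hat\pi)\le\varepsilon^2$.
   Context: $\mathsf{BW}(\mathbb R^d)$ is the set of Gaussian distributions $\mathcal N(m,\Sigma)$ on $\mathbb R^d$ with $m\in\mathbb R^d$ and $\Sigma$ symmetric positive definite, endowed with the 2-Wasserstein distance $W_2$. $V:\mathbb R^d\to\mathbb R$ is twice continuously differentiable; it is $\beta$-smooth if $-\beta I\preceq\nabla^2V(x)\preceq\beta I$ for all $x$, and $\alpha$-strongly convex ($\alpha>0$) if $\alpha I\preceq\nabla^2V(x)$ for all $x$. For $\mu\in\mathsf{BW}(\mathbb R^d)$: potential $\mathcal V(\mu)=\int V\,d\mu$, entropy $\mathcal H(\mu)=\int\log\mu(x)\,d\mu(x)$ (identifying $\mu$ with its Lebesgue density), and $\mathcal F=\mathcal V+\mathcal H$. FB--GVI with step size $\eta>0$ and initialization $p_0=\mathcal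 N(m_0,\Sigma_0)\in\mathsf{BW}(\mathbb R^d)$: given $p_k=\mathcal N(m_k,\Sigma_k)$, set $b_k=\mathbb E_{p_k}\nabla V$, $S_k=\mathbb E_{p_k}\nabla^2V$, $m_{k+1}=m_k-\eta b_k$, $\Sigma_{k+1/2}=(I-\eta S_k)\Sigma_k(I-\eta S_k)$, $\Sigma_{k+1}=\tfrac12\big(\Sigma_{k+1/2}+2\eta I+[\Sigma_{k+1/2}(\Sigma_{k+1/2}+4\eta I)]^{1/2}\big)$ (principal PSD square root; the two factors commute), and $p_{k+1}=\mathcal N(m_{k+1},\Sigma_{k+1})$. *)

theory Defs
  imports "HOL-Probability.Probability"
begin

definition loewner_le :: "real^'n^'n \<Rightarrow> real^'n^'n \<Rightarrow> bool" where
  "loewner_le A B \<longleftrightarrow> (\<forall>v. v \<bullet> (A *v v) \<le> v \<bullet> (B *v v))"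

definition psd_mat :: "real^'n^'n \<Rightarrow> bool" where
  "psd_mat A \<longleftrightarrow> transpose A = A \<and> (\<forall>v. 0 \<le> v \<bullet> (A *v v))"

definition spd_mat :: "real^'n^'n \<Rightarrow> bool" where
  "spd_mat A \<longleftrightarrow> transpose A = A \<and> (\<forall>v. v \<noteq> 0 \<longrightarrow> 0 < v \<bullet> (A *v v))"

definition mat_sqrt :: "real^'n^'n \<Rightarrow> real^'n^'n" where
  "mat_sqrt A = (THE S. psd_mat S \<and> S ** S = A)"

definition gauss_dens :: "real^'n \<Rightarrow> real^'n^'n \<Rightarrow> real^'n \<Rightarrow> real" where
  "gauss_dens m \<Sigma> x =
     exp (- ((x - m) \<bullet> (matrix_inv \<Sigma> *v (x - m))) / 2)
     / sqrt ((2 * pi) ^ CARD('n) * det \<Sigma>)"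

definition gauss :: "real^'n \<Rightarrow> real^'n^'n \<Rightarrow> (real^'n) measure" where
  "gauss m \<Sigma> = density lborel (\<lambda>x. ennreal (gauss_dens m \<Sigma> x))"

definition gauss_exp :: "real^'n \<Rightarrow> real^'n^'n \<Rightarrow> (real^'n \<Rightarrow> 'b::{banach,second_countable_topology}) \<Rightarrow> 'b" where
  "gauss_exp m \<Sigma> f = (LINT x|lborel. gauss_dens m \<Sigma> x *\<^sub>R f x)"

definition couplings :: "'a::euclidean_space measure \<Rightarrow> 'a measure \<Rightarrow> ('a \<times> 'a) measure set" where
  "couplings \<mu> \<nu> = {\<gamma>. prob_space \<gamma> \<and> sets \<gamma> = sets (borel \<Otimes>\<^sub>M borel)
      \<and> distr \<gamma> borel fst = \<mu> \<and> distr \<gamma> borel snd = \<nu>}"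

definition W2sq :: "'a::euclidean_space measure \<Rightarrow> 'a measure \<Rightarrow> ennreal" where
  "W2sq \<mu> \<nu> = (INF \<gamma>\<in>couplings \<mu> \<nu>. \<integral>\<^sup>+ z. ennreal ((norm (fst z - snd z))\<^sup>2) \<partial>\<gamma>)"

definition potential_en :: "(real^'n \<Rightarrow> real) \<Rightarrow> real^'n \<Rightarrow> real^'n^'n \<Rightarrow> real" where
  "potential_en V m \<Sigma> = (LINT x|lborel. gauss_dens m \<Sigma> x * V x)"

definition entropy_gauss :: "real^'n \<Rightarrow> real^'n^'n \<Rightarrow> real" where
  "entropy_gauss m \<Sigma> = (LINT x|lborel. gauss_dens m \<Sigma> x * ln (gauss_dens m \<Sigma> x))"

definition free_en :: "(real^'n \<Rightarrow> real) \<Rightarrow> real^'n \<Rightarrow> real^'n^'n \<Rightarrow> real" where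
  "free_en V m \<Sigma> = potential_en V m \<Sigma> + entropy_gauss m \<Sigma>"

definition fb_step ::
  "(real^'n \<Rightarrow> real^'n) \<Rightarrow> (real^'n \<Rightarrow> real^'n^'n) \<Rightarrow> real
   \<Rightarrow> (real^'n) \<times> (real^'n^'n) \<Rightarrow> (real^'n) \<times> (real^'n^'n)" where
  "fb_step gV HV \<eta> p =
     (let m = fst p; \<Sigma> = snd p;
          b = gauss_exp m \<Sigma> gV;
          S = gauss_exp m \<Sigma> HV;
          A = mat 1 - \<eta> *\<^sub>R S;
          \<Sigma>h = A ** \<Sigma> ** A
      in (m - \<eta> *\<^sub>R b,
          (1/2) *\<^sub>R (\<Sigma>h + (2 * \<eta>) *\<^sub>R mat 1 + mat_sqrt (\<Sigma>h ** (\<Sigma>h + (4 * \<eta>) *\<^sub>R mat 1)))))"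

primrec fb_iter ::
  "(real^'n \<Rightarrow> real^'n) \<Rightarrow> (real^'n \<Rightarrow> real^'n^'n) \<Rightarrow> real
   \<Rightarrow> real^'n \<Rightarrow> real^'n^'n \<Rightarrow> nat \<Rightarrow> (real^'n) \<times> (real^'n^'n)" where
  "fb_iter gV HV \<eta> m0 \<Sigma>0 0 = (m0, \<Sigma>0)"
| "fb_iter gV HV \<eta> m0 \<Sigma>0 (Suc k) = fb_step gV HV \<eta> (fb_iter gV HV \<eta> m0 \<Sigma>0 k)"

end

theory Submission
  imports Defs
begin

text \<open>
  One step of the algorithm is a proximal gradient step in Wasserstein space: a forward step for the
  potential, \<open>x \<mapsto> x - \<eta> (b + S (x - m))\<close>, followed by the proximal map of the entropy. A Gaussian
  \<open>\<N>(m, K K\<^sup>T)\<close> is represented as the law of \<open>m + K Z\<close> with \<open>Z\<close> standard normal, so that couplings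
  become pairs of matrices and the covariance part of \<open>W\<^sub>2\<^sup>2\<close> becomes a Frobenius distance. Stein's
  identity turns \<open>\<bbbE> \<langle>\<nabla>V(m + M Z), D Z\<rangle>\<close> into \<open>\<langle>S M, D\<rangle>\<close>, hence strong convexity and smoothness of
  \<open>V\<close> pass to the potential energy along linear couplings. Convexity of the entropy is the inequality
  \<open>ln det \<le> tr - d\<close> for products of two positive definite matrices. Adding up the usual proximal
  gradient estimates yields, for every Gaussian \<open>\<nu>\<close>,
  \<open>W\<^sub>2\<^sup>2(p\<^sub>k\<^sub>+\<^sub>1, \<nu>) + 2 \<eta> (\<F>(p\<^sub>k\<^sub>+\<^sub>1) - \<F>(\<nu>)) \<le> (1 - \<alpha> \<eta>) W\<^sub>2\<^sup>2(p\<^sub>k, \<nu>)\<close>.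
  Taking for \<open>\<nu>\<close> the minimizer gives the rate, \<open>\<nu> = p\<^sub>k\<close> gives descent of \<open>\<F>\<close>, and telescoping over
  the steps \<open>N, \<dots>, 2 N\<close> gives the bound on \<open>\<F>\<close>.
\<close>

section \<open>Symmetric matrices\<close>

text \<open>The obstacle is the half step: for \<open>\<eta> = 1 / \<beta>\<close> the matrix
  \<open>A = I - \<eta> S\<close> can be singular, and then the law after the forward step has no
  density and no invertible factor. It is therefore never treated as a \<open>gauss\<close>; it
  occurs only through two factors of its covariance, \<open>A ** M\<close> seen from
  \<open>\<Sigma> = M M\<close> and \<open>B ** M'\<close> seen from
  \<open>\<Sigma>' = M' M'\<close>. These have the same Gram matrix but need not coincide. The
  potential is expanded at \<open>M\<close>, the entropy at \<open>M'\<close>, and the two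
  computations are joined by comparing inner products with a factor \<open>K\<close> of
  \<open>\<Sigma>'\<close> nearly optimally aligned with \<open>A ** M\<close>, and a factor
  \<open>J\<close> of \<open>\<Omega>\<close> nearly optimally aligned with \<open>B ** M'\<close>.
  Only the alignment of \<open>M\<close> and \<open>N\<close> for the pair \<open>\<Sigma>\<close>,
  \<open>\<Omega>\<close> is exactly optimal, since it has to produce the distance on the right-hand
  side; on the left any coupling gives an upper bound. This is why the expansions are stated along
  arbitrary linear couplings and not only along geodesics.\<close>

lemma inner_matrix_vector_transpose:
  fixes A :: "real^'n^'m"
  shows "(A *v x) \<bullet> y = x \<bullet> (transpose A *v y)"
  by (metis dot_lmul_matrix inner_commute transpose_transpose vector_transpose_matrix)

lemma inner_symmetric_matrix:
  fixes A :: "real^'n^'n"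
  assumes "transpose A = A"
  shows "(A *v x) \<bullet> y = x \<bullet> (A *v y)"
  using inner_matrix_vector_transpose[of A x y] assms by simp

section \<open>Adjoint rules for the Frobenius inner product\<close>

lemma matrix_inner_sum: "(A::real^'n^'m) \<bullet> B = (\<Sum>i\<in>UNIV. \<Sum>j\<in>UNIV. A$i$j * B$i$j)"
  by (simp add: inner_vec_def)

lemma matrix_inner_mult_left:
  fixes A :: "real^'k^'m" and B :: "real^'n^'k"
  shows "(A ** B) \<bullet> C = B \<bullet> (transpose A ** C)"
proof -
  have "(A ** B) \<bullet> C = (\<Sum>i\<in>UNIV. \<Sum>j\<in>UNIV. \<Sum>k\<in>UNIV. A$i$k * B$k$j * C$i$j)"
    by (simp add: matrix_inner_sum matrix_matrix_mult_def sum_distrib_right)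
  also have "\<dots> = (\<Sum>i\<in>UNIV. \<Sum>k\<in>UNIV. \<Sum>j\<in>UNIV. A$i$k * B$k$j * C$i$j)"
    by (intro sum.cong refl sum.swap)
  also have "\<dots> = (\<Sum>k\<in>UNIV. \<Sum>i\<in>UNIV. \<Sum>j\<in>UNIV. A$i$k * B$k$j * C$i$j)"
    by (rule sum.swap)
  also have "\<dots> = (\<Sum>k\<in>UNIV. \<Sum>j\<in>UNIV. \<Sum>i\<in>UNIV. A$i$k * B$k$j * C$i$j)"
    by (intro sum.cong refl sum.swap)
  also have "\<dots> = B \<bullet> (transpose A ** C)"
    by (simp add: matrix_inner_sum matrix_matrix_mult_def sum_distrib_left transpose_def mult_ac)
  finally show ?thesis .
qed

lemma matrix_inner_transpose:
  fixes A :: "real^'n^'m"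
  shows "transpose A \<bullet> transpose B = A \<bullet> B"
  unfolding matrix_inner_sum transpose_def by (simp, rule sum.swap)

lemma matrix_inner_mult_right:
  fixes A :: "real^'k^'m" and B :: "real^'n^'k"
  shows "(A ** B) \<bullet> C = A \<bullet> (C ** transpose B)"
proof -
  have "(A ** B) \<bullet> C = (transpose B ** transpose A) \<bullet> transpose C"
    using matrix_inner_transpose[of "A ** B" C] by (simp only: matrix_transpose_mul)
  also have "\<dots> = transpose A \<bullet> (B ** transpose C)"
    by (simp only: matrix_inner_mult_left transpose_transpose)
  also have "\<dots> = A \<bullet> (C ** transpose B)"
    using matrix_inner_transpose[of A "C ** transpose B"] by (simp only: matrix_transpose_mul transpose_transpose)
  finally show ?thesis .
qed

lemma matrix_inner_one: "(mat 1 :: real^'n^'n) \<bullet> A = trace A"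
  by (simp add: matrix_inner_sum mat_def trace_def if_distrib[of "\<lambda>x. x * _"] cong: if_cong)

lemma matrix_inner_eq_trace: "(A :: real^'n^'n) \<bullet> B = trace (transpose A ** B)"
  by (metis matrix_inner_mult_left matrix_inner_one matrix_mul_rid)

lemma matrix_mult_add_left: "((A::real^'k^'m) + B) ** (C::real^'n^'k) = A ** C + B ** C"
  and matrix_mult_add_right: "(D::real^'k^'m) ** (E + F) = D ** E + D ** (F::real^'n^'k)"
  and matrix_mult_diff_left: "(A - B) ** C = A ** C - B ** C"
  and matrix_mult_diff_right: "D ** (E - F) = D ** E - D ** F"
  and matrix_mult_scaleR_left: "(r *\<^sub>R A) ** C = r *\<^sub>R (A ** C)"
  and matrix_mult_scaleR_right: "D ** (r *\<^sub>R E) = r *\<^sub>R (D ** E)"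
  by (simp_all add: matrix_matrix_mult_def vec_eq_iff algebra_simps sum.distrib sum_subtractf sum_distrib_left)

lemma transpose_add: "transpose ((A::real^'n^'m) + B) = transpose A + transpose B"
  and transpose_diff: "transpose (A - B) = transpose A - transpose B"
  by (simp_all add: transpose_def vec_eq_iff)

lemmas matrix_algebra = matrix_mult_add_left matrix_mult_add_right matrix_mult_diff_left
  matrix_mult_diff_right matrix_mult_scaleR_left matrix_mult_scaleR_right

text \<open>A maximiser of the quadratic form on the unit sphere of \<open>W\<close> is an
  eigenvector, because the first variation vanishes there; the vectors of \<open>W\<close>
  orthogonal to it form an invariant subspace of smaller dimension. Stating the spectral theorem for
  invariant subspaces lets the induction descend to that complement.\<close>

lemma symmetric_eigenbasis:
  fixes A :: "real^'n^'n"
  assumes sym: "transpose A = A"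
  shows "subspace W \<Longrightarrow> (\<And>w. w \<in> W \<Longrightarrow> A *v w \<in> W) \<Longrightarrow>
    \<exists>B. B \<subseteq> W \<and> pairwise orthogonal B \<and> (\<forall>b\<in>B. norm b = 1 \<and> (\<exists>c. A *v b = c *\<^sub>R b)) \<and> span B = W"
proof (induction "dim W" arbitrary: W rule: less_induct)
  case less
  show ?case
  proof (cases "W = {0}")
    case True
    then show ?thesis by (intro exI[of _ "{}"]) auto
  next
    case False
    define S where "S = sphere 0 1 \<inter> W"
    have "compact S" unfolding S_def
      using closed_subspace[OF less.prems(1)] by (simp add: compact_Int_closed)
    moreover have "S \<noteq> {}"
    proof -
      obtain w where "w \<in> W" "w \<noteq> 0" using False subspace_0[OF less.prems(1)] by blast
      then have "(1 / norm w) *\<^sub>R w \<in> S"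
        unfolding S_def using subspace_scale[OF less.prems(1)] by simp
      then show ?thesis by blast
    qed
    moreover have "continuous_on S (\<lambda>v. v \<bullet> (A *v v))"
      by (intro continuous_intros linear_continuous_on linear_conv_bounded_linear[THEN iffD1] matrix_vector_mul_linear)
    ultimately obtain v where v: "v \<in> S" and mx: "\<And>w. w \<in> S \<Longrightarrow> w \<bullet> (A *v w) \<le> v \<bullet> (A *v v)"
      using continuous_attains_sup[of S "\<lambda>v. v \<bullet> (A *v v)"] by blast
    define l where "l = v \<bullet> (A *v v)"
    have vW: "v \<in> W" and nv: "norm v = 1" using v by (auto simp: S_def)
    have vv: "v \<bullet> v = 1" using nv by (simp add: norm_eq_1)
    have bnd: "w \<bullet> (A *v w) \<le> l * (w \<bullet> w)" if "w \<in> W" for w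
    proof (cases "w = 0")
      case False
      let ?u = "(1 / norm w) *\<^sub>R w"
      have "?u \<in> S" unfolding S_def using subspace_scale[OF less.prems(1) that] False by simp
      then have "?u \<bullet> (A *v ?u) \<le> l" unfolding l_def by (rule mx)
      then have "(w \<bullet> (A *v w)) / (norm w)\<^sup>2 \<le> l"
        by (simp add: matrix_vector_mult_scaleR power2_eq_square)
      then show ?thesis using False by (simp add: divide_le_eq power2_norm_eq_inner)
    qed simp
    \<comment> \<open>\<open>r\<close> is the residual of the eigenvalue equation and also the
      direction of the test perturbation \<open>v + t *\<^sub>R r\<close>: the gain is linear in
      \<open>t\<close>, the cost \<open>t\<^sup>2 * c\<close> is quadratic, so a small
      \<open>t\<close> rules out a nonzero \<open>r\<close>.\<close>
    define r where "r = A *v v - l *\<^sub>R v"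
    have rW: "r \<in> W" unfolding r_def
      using less.prems vW by (intro subspace_diff subspace_scale) auto
    define c where "c = l * (r \<bullet> r) - r \<bullet> (A *v r)"
    have c0: "0 \<le> c" using bnd[OF rW] by (simp add: c_def)
    have *: "2 * t * (r \<bullet> r) \<le> t\<^sup>2 * c" for t
    proof -
      have "v + t *\<^sub>R r \<in> W"
        using less.prems(1) vW rW by (intro subspace_add subspace_scale)
      from bnd[OF this]
      have "l + 2 * t * (r \<bullet> (A *v v)) + t\<^sup>2 * (r \<bullet> (A *v r)) \<le> l * (1 + 2 * t * (r \<bullet> v) + t\<^sup>2 * (r \<bullet> r))"
        using inner_symmetric_matrix[OF sym, of v r]
        by (simp add: matrix_vector_right_distrib matrix_vector_mult_scaleR inner_add_left inner_add_right
            inner_commute power2_eq_square vv flip: l_def) (simp add: algebra_simps inner_commute)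
      moreover have E: "r \<bullet> r = r \<bullet> (A *v v) - l * (r \<bullet> v)"
        by (subst (2) r_def) (simp add: inner_diff_right)
      have "2 * t * (r \<bullet> r) = 2 * t * (r \<bullet> (A *v v)) - 2 * t * (l * (r \<bullet> v))"
        by (metis E right_diff_distrib)
      moreover have "t\<^sup>2 * c = t\<^sup>2 * (l * (r \<bullet> r)) - t\<^sup>2 * (r \<bullet> (A *v r))"
        by (simp add: c_def right_diff_distrib)
      moreover have "l * (1 + 2 * t * (r \<bullet> v) + t\<^sup>2 * (r \<bullet> r)) = l + 2 * t * (l * (r \<bullet> v)) + t\<^sup>2 * (l * (r \<bullet> r))"
        by (simp add: distrib_left mult_ac)
      ultimately show ?thesis by linarith
    qed
    have "r \<bullet> r = 0"
    proof (rule ccontr)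
      assume "r \<bullet> r \<noteq> 0"
      then have p: "0 < r \<bullet> r" using inner_ge_zero[of r] by linarith
      \<comment> \<open>With \<open>c + 1\<close> in place of \<open>c\<close> the quotient makes
        sense even for \<open>c = 0\<close>, and \<open>t * c < r \<bullet> r\<close> still
        contradicts the inequality above.\<close>
      define t where "t = (r \<bullet> r) / (c + 1)"
      have t: "0 < t" "t * (c + 1) = r \<bullet> r" using p c0 by (auto simp: t_def)
      have "2 * (r \<bullet> r) \<le> t * c" using *[of t] t(1)
        by (simp add: power2_eq_square)
      then show False using t p c0 by (simp add: algebra_simps)
    qed
    then have eig: "A *v v = l *\<^sub>R v" by (simp add: r_def)
    define W' where "W' = {w \<in> W. v \<bullet> w = 0}"
    have sW': "subspace W'" using less.prems(1)
      by (auto simp: W'_def subspace_def inner_add_right)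
    have "v \<notin> W'" using vv by (simp add: W'_def)
    moreover have "W' \<subseteq> W" by (auto simp: W'_def)
    ultimately have "W' \<subset> W" using vW by blast
    then have "dim W' < dim W"
      using dim_psubset[of W' W] sW' less.prems(1) span_eq_iff by metis
    moreover have "A *v w \<in> W'" if "w \<in> W'" for w
      using that less.prems(2) inner_symmetric_matrix[OF sym, of v w] eig by (auto simp: W'_def)
    ultimately obtain B where B: "B \<subseteq> W'" "pairwise orthogonal B"
      "\<forall>b\<in>B. norm b = 1 \<and> (\<exists>c. A *v b = c *\<^sub>R b)" "span B = W'"
      using less.hyps[of W'] sW' by blast
    have "span (insert v B) = W"
    proof
      show "span (insert v B) \<subseteq> W"
        using B(1) vW less.prems(1) by (intro span_minimal) (auto simp: W'_def)
      show "W \<subseteq> span (insert v B)"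
      proof
        fix w assume w: "w \<in> W"
        have "w - (v \<bullet> w) *\<^sub>R v \<in> W'"
          unfolding W'_def using w vW less.prems(1) vv
          by (auto simp: inner_diff_right intro!: subspace_diff subspace_scale)
        then have "w - (v \<bullet> w) *\<^sub>R v \<in> span B" using B(4) by simp
        then show "w \<in> span (insert v B)" unfolding span_insert by auto
      qed
    qed
    moreover have "pairwise orthogonal (insert v B)"
      using B(1,2) by (auto simp: pairwise_insert W'_def orthogonal_def inner_commute)
    ultimately show ?thesis
      using B nv eig vW by (intro exI[of _ "insert v B"]) (auto simp: W'_def)
  qed
qed

section \<open>Functional calculus of symmetric matrices\<close>

definition diag_mat :: "('n \<Rightarrow> real) \<Rightarrow> real^'n^'n" where
  "diag_mat d = (\<chi> i j. if i = j then d i else 0)"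

text \<open>For orthogonal \<open>P\<close>, the matrix with eigenvalues \<open>d\<close> in the
  orthonormal basis of the columns of \<open>P\<close>. With \<open>P\<close> fixed, sums, products,
  inverses and square roots act on \<open>d\<close> alone, so matrix identities become scalar
  identities for each eigenvalue.\<close>

definition spec :: "real^'n^'n \<Rightarrow> ('n \<Rightarrow> real) \<Rightarrow> real^'n^'n" where
  "spec P d = P ** diag_mat d ** transpose P"

theorem symmetric_matrix_diagonalization:
  fixes A :: "real^'n^'n"
  assumes sym: "transpose A = A"
  obtains P d where "orthogonal_matrix P" "A = spec P d"
proof -
  obtain B where B: "pairwise orthogonal B" "\<forall>b\<in>B. norm b = 1 \<and> (\<exists>c. A *v b = c *\<^sub>R b)" "span B = UNIV"
    using symmetric_eigenbasis[OF sym, of UNIV] by auto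
  have "0 \<notin> B" using B(2) by force
  then have ind: "independent B" using B(1) pairwise_orthogonal_independent by blast
  then have "finite B" by (simp add: independent_imp_finite)
  have "card B = CARD('n)"
  proof -
    have "dim B = card B" using ind by (rule dim_eq_card_independent)
    moreover have "dim B = dim (UNIV :: (real^'n) set)" using B(3) dim_span[of B] by simp
    ultimately show ?thesis by simp
  qed
  then obtain f where f: "bij_betw f (UNIV :: 'n set) B"
    using \<open>finite B\<close> finite_same_card_bij[of "UNIV :: 'n set" B] by auto
  have fB: "f i \<in> B" for i using bij_betwE[OF f] by blast
  then have "\<forall>i. \<exists>c. A *v f i = c *\<^sub>R f i" using B(2) by blast
  from choice[OF this] obtain d where d: "\<And>i. A *v f i = d i *\<^sub>R f i" by blast
  define P :: "real^'n^'n" where "P = (\<chi> i j. f j $ i)"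
  have col: "column j P = f j" for j by (simp add: column_def P_def vec_eq_iff)
  have orth: "orthogonal_matrix P"
    unfolding orthogonal_matrix_orthonormal_columns col
  proof (intro conjI allI impI)
    fix i j :: 'n
    show "norm (f i) = 1" using fB B(2) by blast
    assume "i \<noteq> j"
    then have "f i \<noteq> f j" using f by (auto simp: bij_betw_def inj_on_def)
    then show "orthogonal (f i) (f j)" using B(1) fB by (auto simp: pairwise_def)
  qed
  have "A ** P = P ** diag_mat d"
  proof -
    have "(A ** P) $ i $ j = (P ** diag_mat d) $ i $ j" for i j
    proof -
      have "(A ** P) $ i $ j = (A *v f j) $ i"
        by (simp add: matrix_matrix_mult_def matrix_vector_mult_def P_def)
      also have "\<dots> = f j $ i * d j" by (simp add: d)
      also have "\<dots> = (P ** diag_mat d) $ i $ j"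
        by (simp add: matrix_matrix_mult_def diag_mat_def P_def if_distrib[of "\<lambda>x. _ * x"] cong: if_cong)
      finally show ?thesis .
    qed
    then show ?thesis by (simp add: vec_eq_iff)
  qed
  then have "A = spec P d"
    unfolding spec_def using orth
    by (metis matrix_mul_assoc matrix_mul_rid orthogonal_matrix_def)
  then show ?thesis using that orth by blast
qed

lemma diag_mat_mult: "diag_mat d ** diag_mat e = diag_mat (\<lambda>i. d i * e i)"
  by (auto simp: diag_mat_def matrix_matrix_mult_def vec_eq_iff if_distrib[of "\<lambda>x. x * _"] cong: if_cong)

lemma transpose_diag_mat [simp]: "transpose (diag_mat d) = diag_mat d"
  by (auto simp: diag_mat_def transpose_def vec_eq_iff)

lemma spec_mult:
  assumes "orthogonal_matrix P"
  shows "spec P d ** spec P e = spec P (\<lambda>i. d i * e i)"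
proof -
  have "spec P d ** spec P e = P ** diag_mat d ** (transpose P ** P) ** diag_mat e ** transpose P"
    by (simp add: spec_def matrix_mul_assoc)
  also have "\<dots> = P ** (diag_mat d ** diag_mat e) ** transpose P"
    using assms by (simp add: orthogonal_matrix_def matrix_mul_assoc)
  finally show ?thesis by (simp add: spec_def diag_mat_mult)
qed

lemma spec_one:
  fixes P :: "real^'n^'n"
  shows "orthogonal_matrix P \<Longrightarrow> spec P (\<lambda>_. 1) = mat 1"
proof -
  assume "orthogonal_matrix P"
  moreover have "diag_mat (\<lambda>_. 1) = (mat 1 :: real^'n^'n)" by (simp add: diag_mat_def mat_def)
  ultimately show ?thesis by (simp add: spec_def orthogonal_matrix_def)
qed

lemma spec_add: "spec P d + spec P e = spec P (\<lambda>i. d i + e i)"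
proof -
  have "diag_mat (\<lambda>i. d i + e i) = diag_mat d + diag_mat e" by (auto simp: diag_mat_def vec_eq_iff)
  then show ?thesis by (simp add: spec_def matrix_algebra)
qed

lemma spec_scaleR: "r *\<^sub>R spec P d = spec P (\<lambda>i. r * d i)"
proof -
  have "diag_mat (\<lambda>i. r * d i) = r *\<^sub>R diag_mat d" by (auto simp: diag_mat_def vec_eq_iff)
  then show ?thesis by (simp add: spec_def matrix_algebra)
qed

lemma transpose_spec [simp]: "transpose (spec P d) = spec P d"
  by (simp add: spec_def matrix_transpose_mul matrix_mul_assoc)

lemma trace_spec: "orthogonal_matrix P \<Longrightarrow> trace (spec P d) = (\<Sum>i\<in>UNIV. d i)"
proof -
  assume P: "orthogonal_matrix P"
  have "trace (spec P d) = trace (transpose P ** P ** diag_mat d)"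
    unfolding spec_def by (metis matrix_mul_assoc trace_mul_sym)
  then show ?thesis using P by (simp add: orthogonal_matrix_def trace_def diag_mat_def)
qed

lemma det_spec: "orthogonal_matrix P \<Longrightarrow> det (spec P d) = (\<Prod>i\<in>UNIV. d i)"
proof -
  assume "orthogonal_matrix P"
  then have "det P * det P = 1" using det_orthogonal_matrix[of P] by auto
  moreover have "det (diag_mat d) = (\<Prod>i\<in>UNIV. d i)" by (subst det_diagonal) (auto simp: diag_mat_def)
  ultimately show ?thesis by (simp add: spec_def det_mul)
qed

lemma inner_spec: "v \<bullet> (spec P d *v v) = (\<Sum>i\<in>UNIV. d i * ((transpose P *v v)$i)\<^sup>2)"
proof -
  have "v \<bullet> (spec P d *v v) = (transpose P *v v) \<bullet> (diag_mat d *v (transpose P *v v))"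
    by (metis inner_matrix_vector_transpose matrix_vector_mul_assoc spec_def transpose_transpose)
  also have "\<dots> = (\<Sum>i\<in>UNIV. d i * ((transpose P *v v)$i)\<^sup>2)"
    by (simp add: inner_vec_def diag_mat_def matrix_vector_mult_def power2_eq_square mult_ac
        if_distrib[of "\<lambda>x. x * _"] if_distrib[of "\<lambda>x. _ * x"] cong: if_cong del: transpose_matrix_vector)
  finally show ?thesis .
qed

lemma inner_spec_column:
  assumes "orthogonal_matrix P"
  shows "(P *v axis i 1) \<bullet> (spec P d *v (P *v axis i 1)) = d i" "P *v axis i 1 \<noteq> 0"
proof -
  have *: "transpose P *v (P *v axis i 1) = axis i 1"
    using assms by (metis matrix_vector_mul_assoc matrix_vector_mul_lid orthogonal_matrix_def)
  show "(P *v axis i 1) \<bullet> (spec P d *v (P *v axis i 1)) = d i"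
    unfolding inner_spec * by (simp add: axis_def if_distrib[of "\<lambda>x. x\<^sup>2"] if_distrib[of "\<lambda>x. _ * x"] cong: if_cong)
  show "P *v axis i 1 \<noteq> 0"
  proof
    assume "P *v axis i 1 = 0"
    then have "axis i (1::real) = 0" using * by (metis matrix_vector_mult_0_right)
    then show False by (simp add: axis_eq_0_iff)
  qed
qed

lemma psd_spec_iff:
  assumes "orthogonal_matrix P"
  shows "psd_mat (spec P d) \<longleftrightarrow> (\<forall>i. 0 \<le> d i)"
proof
  show "psd_mat (spec P d) \<Longrightarrow> \<forall>i. 0 \<le> d i"
    using inner_spec_column[OF assms] unfolding psd_mat_def by metis
  show "\<forall>i. 0 \<le> d i \<Longrightarrow> psd_mat (spec P d)"
    by (auto simp: psd_mat_def inner_spec intro!: sum_nonneg)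
qed

lemma spd_spec_iff:
  assumes "orthogonal_matrix P"
  shows "spd_mat (spec P d) \<longleftrightarrow> (\<forall>i. 0 < d i)"
proof
  show "spd_mat (spec P d) \<Longrightarrow> \<forall>i. 0 < d i"
    using inner_spec_column[OF assms] unfolding spd_mat_def by metis
  assume d: "\<forall>i. 0 < d i"
  have "0 < v \<bullet> (spec P d *v v)" if "v \<noteq> 0" for v
  proof -
    have "transpose P *v v \<noteq> 0"
    proof
      assume "transpose P *v v = 0"
      then have "P *v (transpose P *v v) = 0" by (metis matrix_vector_mult_0_right)
      moreover have "P *v (transpose P *v v) = v"
        using assms by (metis matrix_vector_mul_assoc matrix_vector_mul_lid orthogonal_matrix_def)
      ultimately show False using that by simp
    qed
    then obtain j where j: "(transpose P *v v) $ j \<noteq> 0" by (metis vec_eq_iff zero_index)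
    show ?thesis unfolding inner_spec
      by (rule sum_pos2[of _ j]) (use d j in \<open>auto simp: less_imp_le simp del: transpose_matrix_vector\<close>)
  qed
  then show "spd_mat (spec P d)" by (auto simp: spd_mat_def)
qed

section \<open>Square roots, inverses and congruences of positive matrices\<close>

lemma spd_imp_psd: "spd_mat A \<Longrightarrow> psd_mat A"
  unfolding spd_mat_def psd_mat_def by (metis inner_zero_left less_eq_real_def)

lemma spd_diagonalization:
  assumes "spd_mat A"
  obtains P d where "orthogonal_matrix P" "A = spec P d" "\<And>i. 0 < d i"
  by (metis assms spd_mat_def spd_spec_iff symmetric_matrix_diagonalization)

lemma psd_diagonalization:
  assumes "psd_mat A"
  obtains P d where "orthogonal_matrix P" "A = spec P d" "\<And>i. 0 \<le> d i"
  by (metis assms psd_mat_def psd_spec_iff symmetric_matrix_diagonalization)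

lemma spd_sqrt_exists:
  assumes "spd_mat A"
  obtains M where "spd_mat M" "M ** M = A"
proof -
  obtain P d where P: "orthogonal_matrix P" "A = spec P d" "\<And>i. 0 < d i"
    using spd_diagonalization[OF assms] by blast
  show ?thesis
  proof
    show "spd_mat (spec P (\<lambda>i. sqrt (d i)))" using P by (simp add: spd_spec_iff)
    show "spec P (\<lambda>i. sqrt (d i)) ** spec P (\<lambda>i. sqrt (d i)) = A"
      using P less_imp_le[OF P(3)] by (simp add: spec_mult)
  qed
qed

lemma psd_sqrt_exists:
  assumes "psd_mat A"
  obtains M where "psd_mat M" "M ** M = A"
proof -
  obtain P d where P: "orthogonal_matrix P" "A = spec P d" "\<And>i. 0 \<le> d i"
    using psd_diagonalization[OF assms] by blast
  show ?thesis
  proof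
    show "psd_mat (spec P (\<lambda>i. sqrt (d i)))" using P by (simp add: psd_spec_iff)
    show "spec P (\<lambda>i. sqrt (d i)) ** spec P (\<lambda>i. sqrt (d i)) = A"
      using P by (simp add: spec_mult)
  qed
qed

lemma spd_inverse:
  assumes "spd_mat A"
  obtains B where "spd_mat B" "A ** B = mat 1" "B ** A = mat 1"
proof -
  obtain P d where P: "orthogonal_matrix P" "A = spec P d" "\<And>i. 0 < d i"
    using spd_diagonalization[OF assms] by blast
  have nz: "d i \<noteq> 0" for i using P(3)[of i] by simp
  show ?thesis
  proof
    show "spd_mat (spec P (\<lambda>i. inverse (d i)))" using P by (simp add: spd_spec_iff)
    show "A ** spec P (\<lambda>i. inverse (d i)) = mat 1" "spec P (\<lambda>i. inverse (d i)) ** A = mat 1"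
      using P nz by (simp_all add: spec_mult spec_one)
  qed
qed

lemma psd_inner_nonneg:
  fixes X :: "real^'n^'n"
  assumes "psd_mat Q"
  shows "0 \<le> X \<bullet> (Q ** X)"
proof -
  obtain M where M: "psd_mat M" "M ** M = Q" using psd_sqrt_exists[OF assms] by blast
  have "X \<bullet> (Q ** X) = (M ** X) \<bullet> (M ** X)"
    using M by (simp add: matrix_inner_mult_left psd_mat_def matrix_mul_assoc)
  then show ?thesis by simp
qed

lemma psd_inner_eq_0:
  fixes X :: "real^'n^'n"
  assumes "psd_mat Q" "X \<bullet> (Q ** X) = 0"
  shows "Q ** X = 0"
proof -
  obtain M where M: "psd_mat M" "M ** M = Q" using psd_sqrt_exists[OF assms(1)] by blast
  have "X \<bullet> (Q ** X) = (M ** X) \<bullet> (M ** X)"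
    using M by (simp add: matrix_inner_mult_left psd_mat_def matrix_mul_assoc)
  then have "M ** X = 0" using assms(2) by simp
  then show ?thesis using M(2)
    by (metis (no_types, lifting) matrix_mul_assoc matrix_mult_diff_right diff_self)
qed

text \<open>For \<open>D = S - R\<close> the hypothesis reads \<open>S ** D + D ** R = 0\<close>.
  Pairing with \<open>D\<close> gives two nonnegative terms with sum zero, so both
  \<open>S ** D\<close> and \<open>R ** D\<close> vanish, and their difference is
  \<open>D ** D\<close>. Uniqueness is what gives the description in \<open>mat_sqrt\<close> its
  meaning.\<close>

lemma psd_sqrt_unique:
  fixes R S :: "real^'n^'n"
  assumes "psd_mat R" "psd_mat S" "R ** R = S ** S"
  shows "R = S"
proof -
  define D where "D = S - R"
  have tD: "transpose D = D" using assms by (simp add: D_def transpose_diff psd_mat_def)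
  have "S ** D + D ** R = 0" using assms(3) by (simp add: D_def matrix_algebra)
  then have "D \<bullet> (S ** D) + D \<bullet> (D ** R) = 0" by (metis inner_add_right inner_zero_right)
  moreover have "D \<bullet> (D ** R) = D \<bullet> (R ** D)"
    using tD assms(1) matrix_inner_transpose[of D "D ** R"] by (simp add: matrix_transpose_mul psd_mat_def)
  ultimately have "S ** D = 0" "R ** D = 0"
    using psd_inner_nonneg[OF assms(1), of D] psd_inner_nonneg[OF assms(2), of D]
      psd_inner_eq_0[OF assms(1), of D] psd_inner_eq_0[OF assms(2), of D] by linarith+
  then have "D ** D = 0" by (subst D_def) (simp add: matrix_algebra)
  then have "D \<bullet> D = 0"
    using tD by (metis inner_commute matrix_inner_eq_trace matrix_inner_one inner_zero_right)
  then show ?thesis by (simp add: D_def)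
qed

lemma mat_sqrt_eqI:
  assumes "psd_mat S" "S ** S = A"
  shows "mat_sqrt A = S"
  unfolding mat_sqrt_def
proof (rule the_equality)
  show "psd_mat S \<and> S ** S = A" using assms by blast
  show "\<And>R. psd_mat R \<and> R ** R = A \<Longrightarrow> R = S" using assms psd_sqrt_unique by metis
qed

lemma psd_congruence: "psd_mat A \<Longrightarrow> psd_mat (transpose C ** A ** C)"
  unfolding psd_mat_def
  by (metis inner_matrix_vector_transpose matrix_mul_assoc matrix_transpose_mul matrix_vector_mul_assoc transpose_transpose)

lemma spd_congruence:
  fixes A C :: "real^'n^'n"
  assumes "spd_mat A" "invertible C"
  shows "spd_mat (transpose C ** A ** C)"
proof -
  have "transpose (transpose C ** A ** C) = transpose C ** A ** C"
    using assms(1) by (simp add: matrix_transpose_mul spd_mat_def matrix_mul_assoc)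
  moreover have "0 < v \<bullet> ((transpose C ** A ** C) *v v)" if "v \<noteq> 0" for v
  proof -
    have "C *v v \<noteq> 0" using that assms(2)
      by (metis invertible_left_inverse matrix_left_invertible_ker)
    then have "0 < (C *v v) \<bullet> (A *v (C *v v))" using assms(1) by (simp add: spd_mat_def)
    also have "\<dots> = v \<bullet> ((transpose C ** A ** C) *v v)"
      by (metis inner_matrix_vector_transpose matrix_mul_assoc matrix_vector_mul_assoc)
    finally show ?thesis .
  qed
  ultimately show ?thesis by (simp add: spd_mat_def)
qed

lemma spd_invertible: "spd_mat A \<Longrightarrow> invertible A"
  using spd_inverse invertible_right_inverse by metis

lemma spd_det_pos: "spd_mat A \<Longrightarrow> 0 < det A"
  by (metis spd_diagonalization det_spec prod_pos)

lemma spd_gram: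
  fixes K :: "real^'n^'n"
  assumes "invertible K"
  shows "spd_mat (K ** transpose K)"
proof -
  have "spd_mat (mat 1 :: real^'n^'n)" by (simp add: spd_mat_def)
  from spd_congruence[OF this transpose_invertible[OF assms]] show ?thesis by simp
qed

text \<open>The linear optimal transport map
  \<open>Sg^(-1/2) (Sg^(1/2) Om Sg^(1/2))^(1/2) Sg^(-1/2)\<close>, also known as the geometric mean
  of \<open>Om\<close> and the inverse of \<open>Sg\<close>.\<close>

lemma spd_transport_exists:
  fixes Sg Om :: "real^'n^'n"
  assumes "spd_mat Sg" "spd_mat Om"
  obtains T where "spd_mat T" "T ** Sg ** T = Om"
proof -
  obtain M where M: "spd_mat M" "M ** M = Sg" using spd_sqrt_exists[OF assms(1)] .
  obtain L where L: "spd_mat L" "M ** L = mat 1" "L ** M = mat 1" using spd_inverse[OF M(1)] .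
  have tM: "transpose M = M" and tL: "transpose L = L" using M L by (auto simp: spd_mat_def)
  have "spd_mat (M ** Om ** M)"
    using spd_congruence[OF assms(2) spd_invertible[OF M(1)]] tM by simp
  then obtain R where R: "spd_mat R" "R ** R = M ** Om ** M" using spd_sqrt_exists by blast
  show ?thesis
  proof
    show "spd_mat (L ** R ** L)" using spd_congruence[OF R(1) spd_invertible[OF L(1)]] tL by simp
    have "L ** R ** L ** Sg ** (L ** R ** L) = L ** R ** (L ** M) ** (M ** L) ** R ** L"
      unfolding M(2)[symmetric] by (simp add: matrix_mul_assoc)
    also have "\<dots> = L ** (R ** R) ** L" by (simp add: L matrix_mul_assoc)
    also have "\<dots> = (L ** M) ** Om ** (M ** L)" unfolding R(2) by (simp add: matrix_mul_assoc)
    finally show "L ** R ** L ** Sg ** (L ** R ** L) = Om" by (simp add: L)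
  qed
qed

text \<open>\<open>Q ** B\<close> need not be symmetric, but with \<open>C\<close> the square root
  of \<open>B\<close> it has the determinant and trace of the positive definite matrix
  \<open>C ** Q ** C\<close>; there \<open>ln d \<le> d - 1\<close> applies to each
  eigenvalue.\<close>

lemma ln_det_le_trace:
  fixes Q B :: "real^'n^'n"
  assumes "spd_mat Q" "spd_mat B"
  shows "ln (det (Q ** B)) \<le> trace (Q ** B) - CARD('n)"
proof -
  obtain C where C: "spd_mat C" "C ** C = B" using spd_sqrt_exists[OF assms(2)] .
  have "spd_mat (C ** Q ** C)"
    using spd_congruence[OF assms(1) spd_invertible[OF C(1)]] C(1) by (simp add: spd_mat_def)
  then obtain P d where P: "orthogonal_matrix P" "C ** Q ** C = spec P d" "\<And>i. 0 < d i"
    using spd_diagonalization by blast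
  have "det (Q ** B) = det (spec P d)" "trace (Q ** B) = trace (spec P d)"
    unfolding C(2)[symmetric] P(2)[symmetric]
    by (simp_all add: det_mul matrix_mul_assoc) (metis matrix_mul_assoc trace_mul_sym)
  moreover have "ln (\<Prod>i\<in>UNIV. d i) = (\<Sum>i\<in>UNIV. ln (d i))"
    using P(3) by (intro ln_prod) (auto simp: less_imp_neq[THEN not_sym])
  moreover have "(\<Sum>i\<in>UNIV. ln (d i)) \<le> (\<Sum>i\<in>UNIV. d i - 1)"
    using P(3) by (intro sum_mono ln_le_minus_one)
  ultimately show ?thesis using P(1) by (simp add: det_spec trace_spec sum_subtractf)
qed

section \<open>Transport matrices and the backward step\<close>

text \<open>Expand the nonnegative square of \<open>X - R ** Y\<close> in the form given by
  \<open>Q\<close>. The inequality serves as a dual certificate of optimality: both terms on the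
  right depend on \<open>X\<close> and \<open>Y\<close> only through their Gram matrices, that is,
  through the covariances.\<close>

lemma young_matrix_inner:
  fixes X Y Q R :: "real^'n^'n"
  assumes "spd_mat Q" "Q ** R = mat 1" "R ** Q = mat 1"
  shows "2 * (X \<bullet> Y) \<le> X \<bullet> (Q ** X) + Y \<bullet> (R ** Y)"
proof -
  have tQ: "transpose Q = Q" using assms(1) by (simp add: spd_mat_def)
  have QR: "Q ** (R ** Z) = Z" for Z :: "real^'n^'n" by (simp add: matrix_mul_assoc assms)
  have "0 \<le> (X - R ** Y) \<bullet> (Q ** (X - R ** Y))"
    using psd_inner_nonneg[OF spd_imp_psd[OF assms(1)]] .
  also have "\<dots> = X \<bullet> (Q ** X) - X \<bullet> Y - (R ** Y) \<bullet> (Q ** X) + (R ** Y) \<bullet> Y"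
    by (simp add: matrix_algebra QR inner_diff_left inner_diff_right)
  also have "(R ** Y) \<bullet> (Q ** X) = X \<bullet> Y"
    by (metis QR inner_commute matrix_inner_mult_left tQ)
  finally show ?thesis by (simp add: inner_commute)
qed

lemma spd_add_scaleR_mat:
  assumes "psd_mat (A :: real^'n^'n)" "0 < \<delta>"
  shows "spd_mat (A + \<delta> *\<^sub>R mat 1)"
proof -
  have "0 < v \<bullet> ((A + \<delta> *\<^sub>R mat 1) *v v)" if "v \<noteq> 0" for v
  proof -
    have "(A + \<delta> *\<^sub>R mat 1) *v v = A *v v + \<delta> *\<^sub>R v"
      by (simp add: matrix_vector_mult_add_rdistrib scaleR_matrix_vector_assoc[symmetric])
    then show ?thesis using assms that
      by (simp add: psd_mat_def inner_add_right add_nonneg_pos)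
  qed
  then show ?thesis using assms
    by (simp add: spd_mat_def psd_mat_def transpose_add transpose_scalar)
qed

text \<open>If \<open>A\<close> were invertible, the map carrying the covariance \<open>A M M A\<close> to \<open>\<Omega>\<close> optimally would be
  linear. For singular \<open>A\<close> (step size \<open>1 / \<beta>\<close>) the map of the regularised matrix \<open>A + \<delta> I\<close> is
  optimal up to an error of order \<open>\<delta>\<close>.\<close>

lemma near_optimal_transport:
  fixes A M Om :: "real^'n^'n"
  assumes "psd_mat A" "spd_mat M" "spd_mat Om"
  shows "\<exists>C. \<forall>\<delta>>0.
    \<exists>Q K. spd_mat Q \<and> K = Q ** (A + \<delta> *\<^sub>R mat 1) ** M \<and> K ** transpose K = Om
      \<and> (\<forall>X Y :: real^'n^'n. X ** transpose X = A ** M ** M ** A \<longrightarrow> Y ** transpose Y = Om \<longrightarrow>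
            X \<bullet> Y \<le> (A ** M) \<bullet> K + C * \<delta>)"
proof -
  obtain L where L: "M ** L = mat 1" "L ** M = mat 1" using spd_inverse[OF assms(2)] by metis
  have tM: "transpose M = M" and tA: "transpose A = A"
    using assms by (auto simp: spd_mat_def psd_mat_def)
  have "linear (\<lambda>X :: real^'n^'n. X ** L)"
    by (rule linearI) (simp_all add: matrix_algebra)
  then obtain c where c: "0 < c" "\<And>X :: real^'n^'n. norm (X ** L) \<le> c * norm X"
    using linear_bounded_pos[of "\<lambda>X :: real^'n^'n. X ** L"] by blast
  \<comment> \<open>The constant is the bound for \<open>\<delta> * (M \<bullet> (Q ** M))\<close>
    derived below: \<open>c\<close> bounds right multiplication by the inverse \<open>L\<close> of
    \<open>M\<close>, and \<open>sqrt (trace Om)\<close> is the norm of every factor of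
    \<open>Om\<close>. Nothing here depends on \<delta>.\<close>
  define C where "C = c * sqrt (trace Om) * norm (M ** M)"
  have trOm: "0 \<le> trace Om"
  proof -
    obtain P d where "orthogonal_matrix P" "Om = spec P d" "\<And>i. 0 < d i"
      using spd_diagonalization[OF assms(3)] by blast
    then show ?thesis by (simp add: trace_spec sum_nonneg less_imp_le)
  qed
  have "0 \<le> C" using c trOm by (simp add: C_def)
  show ?thesis
  proof (rule exI[of _ C], intro allI impI)
    fix \<delta> :: real assume \<delta>: "0 < \<delta>"
    define D where "D = A + \<delta> *\<^sub>R mat 1"
    have D: "spd_mat D" unfolding D_def using spd_add_scaleR_mat assms \<delta> by blast
    then have tD: "transpose D = D" by (simp add: spd_mat_def)
    have "spd_mat (D ** (M ** transpose M) ** D)"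
      using spd_congruence[OF spd_gram spd_invertible, of M D] D assms(2) tD spd_invertible by metis
    then obtain Q where Q: "spd_mat Q" "Q ** (D ** M ** M ** D) ** Q = Om"
      using spd_transport_exists[OF _ assms(3)] tM by (metis matrix_mul_assoc)
    obtain R where R: "Q ** R = mat 1" "R ** Q = mat 1" using spd_inverse[OF Q(1)] by metis
    have tQ: "transpose Q = Q" using Q by (simp add: spd_mat_def)
    define K where "K = Q ** D ** M"
    have K: "K ** transpose K = Om"
      unfolding Q(2)[symmetric] by (simp add: K_def matrix_transpose_mul tM tD tQ matrix_mul_assoc)
    have nK: "norm K = sqrt (trace Om)"
      unfolding norm_eq_sqrt_inner K[symmetric]
      by (metis inner_commute matrix_inner_eq_trace matrix_inner_transpose transpose_transpose)
    have QD: "Q ** D = K ** L" by (metis K_def L(1) matrix_mul_assoc matrix_mul_rid)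
    \<comment> \<open>\<open>Q\<close> may blow up as \<delta> tends to 0, but not faster than
      1/\<delta>: in the square of \<open>Q ** A + \<delta> *\<^sub>R Q\<close> the cross term is
      nonnegative because \<open>A\<close> is positive semidefinite.\<close>
    have "\<delta> * norm Q \<le> norm (Q ** D)"
    proof -
      have "(Q ** D) \<bullet> (Q ** D) = (Q ** A) \<bullet> (Q ** A) + 2 * \<delta> * (Q \<bullet> (Q ** A)) + \<delta>\<^sup>2 * (Q \<bullet> Q)"
        by (simp add: D_def matrix_algebra inner_add_left inner_add_right inner_commute power2_eq_square
            algebra_simps)
      moreover have "0 \<le> Q \<bullet> (Q ** A)"
        using psd_inner_nonneg[OF assms(1), of Q] matrix_inner_transpose[of Q "Q ** A"]
        by (simp add: matrix_transpose_mul tQ tA)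
      ultimately have "\<delta>\<^sup>2 * (Q \<bullet> Q) \<le> (Q ** D) \<bullet> (Q ** D)"
        using \<delta> by (smt (verit) inner_ge_zero mult_nonneg_nonneg)
      then have "(\<delta> * norm Q)\<^sup>2 \<le> (norm (Q ** D))\<^sup>2"
        by (simp add: power_mult_distrib power2_norm_eq_inner)
      then show ?thesis by (rule power2_le_imp_le) simp
    qed
    also have "\<dots> \<le> c * sqrt (trace Om)" unfolding QD using c(2)[of K] nK by simp
    finally have nQ: "\<delta> * norm Q \<le> c * sqrt (trace Om)" .
    have MQM: "\<delta> * (M \<bullet> (Q ** M)) \<le> C"
    proof -
      have "M \<bullet> (Q ** M) = Q \<bullet> (M ** M)"
        by (metis inner_commute matrix_inner_mult_right tM)
      also have "\<dots> \<le> norm Q * norm (M ** M)" by (rule norm_cauchy_schwarz)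
      finally have "\<delta> * (M \<bullet> (Q ** M)) \<le> (\<delta> * norm Q) * norm (M ** M)"
        using \<delta> by simp
      also have "\<dots> \<le> C" unfolding C_def using nQ by (intro mult_right_mono) auto
      finally show ?thesis .
    qed
    have "X \<bullet> Y \<le> (A ** M) \<bullet> K + C * \<delta>"
      if X: "X ** transpose X = A ** M ** M ** A" and Y: "Y ** transpose Y = Om" for X Y :: "real^'n^'n"
    proof -
      have flip: "Z \<bullet> (W ** Z) = W \<bullet> (Z ** transpose Z)" for Z W :: "real^'n^'n"
        by (metis inner_commute matrix_inner_mult_right)
      have KD: "K = Q ** (A ** M) + \<delta> *\<^sub>R (Q ** M)"
        by (simp add: K_def D_def matrix_algebra matrix_mul_assoc)
      have 1: "X \<bullet> (Q ** X) = (A ** M) \<bullet> (Q ** (A ** M))"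
        unfolding flip[of X Q] flip[of "A ** M" Q] X by (simp add: matrix_transpose_mul tA tM matrix_mul_assoc)
      have 2: "Y \<bullet> (R ** Y) = K \<bullet> (R ** K)" unfolding flip[of Y R] flip[of K R] Y K ..
      have 3: "R ** K = A ** M + \<delta> *\<^sub>R M"
        unfolding KD by (simp add: matrix_algebra matrix_mul_assoc R)
      \<comment> \<open>\<open>Q\<close> belongs to the factor \<open>(A + \<delta> I) M\<close> and
        not to \<open>A M\<close>. After substituting \<open>K\<close>, the terms of first order in
        \<delta> cancel; what remains is \<open>\<delta>\<^sup>2\<close> times
        \<open>M \<bullet> (Q ** M)\<close>, which is of order \<delta> by
        \<open>MQM\<close>.\<close>
      have "2 * (X \<bullet> Y) \<le> (A ** M) \<bullet> (Q ** (A ** M)) + K \<bullet> (A ** M + \<delta> *\<^sub>R M)"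
        using young_matrix_inner[OF Q(1) R, of X Y] unfolding 1 2 3 .
      also have "(A ** M) \<bullet> (Q ** (A ** M)) = (A ** M) \<bullet> K - \<delta> * (M \<bullet> (Q ** (A ** M)))"
        unfolding KD by (simp add: inner_add_right) (metis inner_commute matrix_inner_mult_left tQ)
      also have "M \<bullet> (Q ** (A ** M)) = M \<bullet> K - \<delta> * (M \<bullet> (Q ** M))"
        unfolding KD by (simp add: inner_add_right)
      finally have "2 * (X \<bullet> Y) \<le> 2 * ((A ** M) \<bullet> K) + \<delta> * (\<delta> * (M \<bullet> (Q ** M)))"
        by (simp add: inner_add_right inner_commute algebra_simps)
      also have "\<delta> * (\<delta> * (M \<bullet> (Q ** M))) \<le> \<delta> * C" using MQM \<delta> by simp
      also have "\<dots> \<le> 2 * (C * \<delta>)" using \<delta> \<open>0 \<le> C\<close> by simp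
      finally show ?thesis by simp
    qed
    then show "\<exists>Q K. spd_mat Q \<and> K = Q ** (A + \<delta> *\<^sub>R mat 1) ** M \<and> K ** transpose K = Om
      \<and> (\<forall>X Y :: real^'n^'n. X ** transpose X = A ** M ** M ** A \<longrightarrow> Y ** transpose Y = Om \<longrightarrow>
            X \<bullet> Y \<le> (A ** M) \<bullet> K + C * \<delta>)"
      using Q(1) K K_def D_def by blast
  qed
qed

text \<open>The backward step is the entropic proximal map: its optimality condition reads
  \<open>(I - \<eta> \<Sigma>\<^sup>-\<^sup>1) \<Sigma> (I - \<eta> \<Sigma>\<^sup>-\<^sup>1) = \<Sigma>h\<close>.\<close>

lemma backward_step_covariance:
  fixes Sh Sp :: "real^'n^'n"
  assumes "psd_mat Sh" "0 < \<eta>"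
    and Sp: "Sp = (1/2) *\<^sub>R (Sh + (2 * \<eta>) *\<^sub>R mat 1 + mat_sqrt (Sh ** (Sh + (4 * \<eta>) *\<^sub>R mat 1)))"
  shows "spd_mat Sp"
    and "\<exists>B L. spd_mat L \<and> Sp ** L = mat 1 \<and> L ** Sp = mat 1 \<and> B = mat 1 - \<eta> *\<^sub>R L \<and> psd_mat B \<and> B ** Sp ** B = Sh"
proof -
  obtain P d where P: "orthogonal_matrix P" "Sh = spec P d" "\<And>i. 0 \<le> d i"
    using psd_diagonalization[OF assms(1)] by blast
  note one = spec_one[OF P(1), symmetric]
  \<comment> \<open>The larger root of
    \<open>s\<^sup>2 - (d + 2 \<eta>) s + \<eta>\<^sup>2 = 0\<close>, the scalar form of the
    optimality condition \<open>(1 - \<eta>/s) s (1 - \<eta>/s) = d\<close>. The two roots multiply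
    to \<open>\<eta>\<^sup>2\<close>, so the larger one is at least \<eta>, which makes
    \<open>B\<close> positive semidefinite.\<close>
  define s where "s i = (d i + 2 * \<eta> + sqrt (d i * (d i + 4 * \<eta>))) / 2" for i
  have arg: "0 \<le> d i * (d i + 4 * \<eta>)" for i using P(3)[of i] assms(2) by simp
  have "Sh ** (Sh + (4 * \<eta>) *\<^sub>R mat 1) = spec P (\<lambda>i. d i * (d i + 4 * \<eta>))"
    unfolding P(2) one by (simp add: spec_scaleR spec_add spec_mult[OF P(1)])
  then have "mat_sqrt (Sh ** (Sh + (4 * \<eta>) *\<^sub>R mat 1)) = spec P (\<lambda>i. sqrt (d i * (d i + 4 * \<eta>)))"
    using arg by (intro mat_sqrt_eqI) (simp_all add: psd_spec_iff[OF P(1)] spec_mult[OF P(1)])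
  then have Sps: "Sp = spec P s"
    unfolding Sp P(2) one by (simp add: spec_scaleR spec_add s_def[abs_def])
  have s\<eta>: "\<eta> \<le> s i" for i
    using P(3)[of i] real_sqrt_ge_zero[OF arg[of i]] by (simp add: s_def)
  have s0: "0 < s i" for i using s\<eta>[of i] assms(2) by simp
  show "spd_mat Sp" unfolding Sps spd_spec_iff[OF P(1)] using s0 by blast
  define L where "L = spec P (\<lambda>i. inverse (s i))"
  define B where "B = mat 1 - \<eta> *\<^sub>R L"
  have nz: "s i \<noteq> 0" for i using s0[of i] by simp
  have "B = spec P (\<lambda>_. 1) + (- \<eta>) *\<^sub>R L" unfolding B_def one by simp
  then have Bs: "B = spec P (\<lambda>i. 1 - \<eta> * inverse (s i))"
    unfolding L_def by (simp add: spec_scaleR spec_add)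
  have key: "(1 - \<eta> * inverse (s i)) * s i * (1 - \<eta> * inverse (s i)) = d i" for i
  proof -
    have "2 * s i - (d i + 2 * \<eta>) = sqrt (d i * (d i + 4 * \<eta>))"
      by (simp add: s_def add_divide_distrib)
    then have "(2 * s i - (d i + 2 * \<eta>))\<^sup>2 = d i * (d i + 4 * \<eta>)"
      using arg[of i] by simp
    then have "s i * s i - 2 * \<eta> * s i + \<eta> * \<eta> = d i * s i"
      by (simp add: power2_eq_square algebra_simps)
    moreover have "(1 - \<eta> * inverse (s i)) * s i * (1 - \<eta> * inverse (s i))
        = (s i * s i - 2 * \<eta> * s i + \<eta> * \<eta>) / s i"
      using nz[of i] by (simp add: field_simps)
    ultimately show ?thesis using nz[of i] by simp
  qed
  show "\<exists>B L. spd_mat L \<and> Sp ** L = mat 1 \<and> L ** Sp = mat 1 \<and> B = mat 1 - \<eta> *\<^sub>R L \<and> psd_mat B \<and> B ** Sp ** B = Sh"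
  proof (intro exI conjI)
    show "spd_mat L" unfolding L_def spd_spec_iff[OF P(1)] using s0 by simp
    show "Sp ** L = mat 1" "L ** Sp = mat 1"
      unfolding Sps L_def one using nz by (simp_all add: spec_mult[OF P(1)])
    show "B = mat 1 - \<eta> *\<^sub>R L" by (rule B_def)
    show "psd_mat B" unfolding Bs psd_spec_iff[OF P(1)] using s\<eta> s0 by (simp add: field_simps)
    show "B ** Sp ** B = Sh" unfolding Bs Sps P(2) spec_mult[OF P(1)] key ..
  qed
qed

section \<open>The standard Gaussian and Stein's identity\<close>

text \<open>The density is a product of one-dimensional normal densities. A general
  \<open>\<sigma>\<close> serves two purposes: \<open>\<sigma> = 1\<close> normalises
  \<open>std_gauss\<close>, and the other values give the integrability of
  \<open>exp (- c |z|\<^sup>2)\<close> for every \<open>c > 0\<close>.\<close>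

lemma nn_integral_gaussian:
  assumes "0 < \<sigma>"
  shows "(\<integral>\<^sup>+z. ennreal (exp (- ((z::real^'n) \<bullet> z) / (2 * \<sigma>\<^sup>2)) / sqrt (2 * pi * \<sigma>\<^sup>2) ^ CARD('n)) \<partial>lborel) = 1"
proof -
  have "exp (- (z \<bullet> z) / (2 * \<sigma>\<^sup>2)) / sqrt (2 * pi * \<sigma>\<^sup>2) ^ CARD('n) =
      (\<Prod>b\<in>Basis. normal_density 0 \<sigma> (z \<bullet> b))" for z :: "real^'n"
  proof -
    have "z \<bullet> z = (\<Sum>b\<in>Basis. (z \<bullet> b)\<^sup>2)"
      by (subst euclidean_inner) (simp add: power2_eq_square)
    then have "exp (- (z \<bullet> z) / (2 * \<sigma>\<^sup>2)) = (\<Prod>b\<in>Basis. exp (- (z \<bullet> b)\<^sup>2 / (2 * \<sigma>\<^sup>2)))"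
      by (subst exp_sum[symmetric]) (simp_all add: sum_divide_distrib sum_negf)
    then show ?thesis
      by (simp add: normal_density_def prod_dividef power_divide)
  qed
  then have "(\<integral>\<^sup>+z. ennreal (exp (- ((z::real^'n) \<bullet> z) / (2 * \<sigma>\<^sup>2)) / sqrt (2 * pi * \<sigma>\<^sup>2) ^ CARD('n)) \<partial>lborel)
     = (\<integral>\<^sup>+z. (\<Prod>b\<in>Basis. ennreal (normal_density 0 \<sigma> ((z::real^'n) \<bullet> b))) \<partial>lborel)"
    by (simp add: prod_ennreal)
  also have "\<dots> = (\<Prod>b\<in>(Basis::(real^'n) set). \<integral>\<^sup>+x. ennreal (normal_density 0 \<sigma> x) \<partial>lborel)"
    by (rule nn_integral_lborel_prod) auto
  also have "(\<integral>\<^sup>+x. ennreal (normal_density 0 \<sigma> x) \<partial>lborel) = 1"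
    using assms by (subst nn_integral_eq_integral) auto
  finally show ?thesis by simp
qed

lemma integrable_exp_neg_square:
  assumes "0 < c"
  shows "integrable lborel (\<lambda>z::real^'n. exp (- (c * (z \<bullet> z))))"
proof -
  define \<sigma> where "\<sigma> = 1 / sqrt (2 * c)"
  have \<sigma>: "0 < \<sigma>" "2 * \<sigma>\<^sup>2 = 1 / c" using assms by (simp_all add: \<sigma>_def power_divide)
  define k where "k = sqrt (2 * pi * \<sigma>\<^sup>2) ^ CARD('n)"
  have k: "0 < k" using \<sigma>(1) by (simp add: k_def)
  have "integrable lborel (\<lambda>z::real^'n. exp (- (z \<bullet> z) / (2 * \<sigma>\<^sup>2)) / k)"
    using nn_integral_gaussian[OF \<sigma>(1), where 'n='n] k unfolding k_def[symmetric]
    by (intro integrableI_bounded) simp_all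
  then have "integrable lborel (\<lambda>z::real^'n. k * (exp (- (z \<bullet> z) / (2 * \<sigma>\<^sup>2)) / k))"
    by (rule integrable_mult_right)
  then show ?thesis using k unfolding \<sigma>(2) by (simp add: mult.commute)
qed

lemma matrix_inv_eqI:
  fixes A B :: "real^'n^'n"
  assumes "A ** B = mat 1"
  shows "matrix_inv A = B"
proof -
  have "B ** A = mat 1" using assms matrix_left_right_inverse by blast
  then have "\<exists>A'. A ** A' = mat 1 \<and> A' ** A = mat 1" using assms by blast
  from someI_ex[OF this] have "matrix_inv A ** A = mat 1" by (simp add: matrix_inv_def)
  then show ?thesis using assms by (metis matrix_mul_assoc matrix_mul_lid matrix_mul_rid)
qed

abbreviation std_gauss :: "(real^'n) measure" where
  "std_gauss \<equiv> gauss 0 (mat 1)"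

lemma std_gauss_dens: "gauss_dens 0 (mat 1) (z::real^'n) = exp (- (z \<bullet> z) / 2) / sqrt (2 * pi) ^ CARD('n)"
  by (simp add: gauss_dens_def matrix_inv_eqI[of "mat 1" "mat 1"] real_sqrt_power real_sqrt_mult power_mult_distrib)

lemma gauss_dens_nonneg [simp]: "spd_mat \<Sigma> \<Longrightarrow> 0 \<le> gauss_dens m \<Sigma> x"
  using spd_det_pos[of \<Sigma>] by (simp add: gauss_dens_def)

lemma continuous_on_matrix_vector [continuous_intros]:
  fixes A :: "real^'n^'m"
  shows "continuous_on S f \<Longrightarrow> continuous_on S (\<lambda>x. A *v f x)"
  by (rule continuous_on_compose2[OF matrix_vector_mult_linear_continuous_on[of UNIV]]) auto

lemma gauss_dens_measurable [measurable]: "gauss_dens m \<Sigma> \<in> borel_measurable borel"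
  unfolding gauss_dens_def divide_inverse by (intro borel_measurable_continuous_onI continuous_intros)

lemma spd_mat_one [simp]: "spd_mat (mat 1 :: real^'n^'n)"
  by (simp add: spd_mat_def)

lemma sets_gauss [measurable_cong, simp]: "sets (gauss m \<Sigma>) = sets borel"
  by (simp add: gauss_def)

lemma space_gauss [simp]: "space (gauss m \<Sigma>) = UNIV"
  by (simp add: gauss_def)

lemma prob_space_std_gauss: "prob_space (std_gauss :: (real^'n) measure)"
proof
  show "emeasure std_gauss (space (std_gauss :: (real^'n) measure)) = 1"
    using nn_integral_gaussian[of 1, where 'n='n]
    by (simp add: gauss_def emeasure_density std_gauss_dens)
qed

lemma integral_std_gauss:
  fixes f :: "real^'n \<Rightarrow> 'b::{banach,second_countable_topology}"
  assumes [measurable]: "f \<in> borel_measurable borel"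
  shows "(LINT z|std_gauss. f z) = (LINT z|lborel. (exp (- (z \<bullet> z) / 2) / sqrt (2 * pi) ^ CARD('n)) *\<^sub>R f z)"
  unfolding gauss_def by (subst integral_density) (auto simp: std_gauss_dens)

text \<open>Half of the exponent is given up to absorb a factor of quadratic growth; the estimate is
  \<open>1 + t/4 \<le> exp (t/4)\<close>. It supplies the integrable majorants for functions of
  quadratic growth.\<close>

lemma exp_quadratic_bound:
  assumes "0 \<le> (t::real)"
  shows "(1 + t) * exp (- t / 2) \<le> 4 * exp (- t / 4)"
proof -
  have "1 + t \<le> 4 * exp (t / 4)" using exp_ge_add_one_self[of "t / 4"] by linarith
  then have "(1 + t) * exp (- t / 2) \<le> 4 * exp (t / 4) * exp (- t / 2)" by (simp add: mult_right_mono)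
  also have "\<dots> = 4 * exp (- t / 4)" by (simp flip: exp_add)
  finally show ?thesis .
qed

lemma integrable_std_gauss:
  fixes f :: "real^'n \<Rightarrow> 'b::{banach,second_countable_topology}"
  assumes [measurable]: "f \<in> borel_measurable borel"
    and bnd: "\<And>z. norm (f z) \<le> C * (1 + z \<bullet> z)"
  shows "integrable std_gauss f"
proof -
  define k where "k = sqrt (2 * pi) ^ CARD('n)"
  have k: "0 < k" by (simp add: k_def)
  have C: "0 \<le> C" using order_trans[OF norm_ge_zero bnd[of 0]] by simp
  have "integrable lborel (\<lambda>z::real^'n. (exp (- (z \<bullet> z) / 2) / k) *\<^sub>R f z)"
  proof (rule Bochner_Integration.integrable_bound)
    show "integrable lborel (\<lambda>z::real^'n. (4 * C / k) * exp (- (1/4 * (z \<bullet> z))))"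
      by (intro integrable_mult_right integrable_exp_neg_square) simp
    show "AE z in lborel. norm ((exp (- (z \<bullet> z) / 2) / k) *\<^sub>R f z) \<le> norm ((4 * C / k) * exp (- (1/4 * (z \<bullet> z))))"
    proof (rule AE_I2)
      fix z :: "real^'n"
      have "norm ((exp (- (z \<bullet> z) / 2) / k) *\<^sub>R f z) \<le> (exp (- (z \<bullet> z) / 2) / k) * (C * (1 + z \<bullet> z))"
        using bnd[of z] k by (simp add: divide_right_mono)
      also have "\<dots> = C / k * ((1 + z \<bullet> z) * exp (- (z \<bullet> z) / 2))" by simp
      also have "\<dots> \<le> C / k * (4 * exp (- (z \<bullet> z) / 4))"
        using C k by (intro mult_left_mono exp_quadratic_bound) auto
      finally show "norm ((exp (- (z \<bullet> z) / 2) / k) *\<^sub>R f z) \<le> norm ((4 * C / k) * exp (- (1/4 * (z \<bullet> z))))"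
        using C k by (simp add: mult_ac)
    qed
  qed measurable
  then show ?thesis unfolding gauss_def
    by (subst integrable_density) (auto simp: std_gauss_dens k_def)
qed

lemma integral_lborel_translate:
  fixes f :: "'a::euclidean_space \<Rightarrow> real"
  assumes [measurable]: "f \<in> borel_measurable borel"
  shows "(LINT z|lborel. f (c + z)) = (LINT z|lborel. f z)"
    and "integrable lborel (\<lambda>z. f (c + z)) \<longleftrightarrow> integrable lborel f"
proof -
  have "(LINT z|lborel. f (c + z)) = (LINT z|distr lborel borel ((+) c). f z)"
    by (subst integral_distr) auto
  then show "(LINT z|lborel. f (c + z)) = (LINT z|lborel. f z)" by (simp add: lborel_distr_plus)
  have "integrable lborel (\<lambda>z. f (c + z)) \<longleftrightarrow> integrable (distr lborel borel ((+) c)) f"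
    by (subst integrable_distr_eq) auto
  then show "integrable lborel (\<lambda>z. f (c + z)) \<longleftrightarrow> integrable lborel f" by (simp add: lborel_distr_plus)
qed

lemma has_derivative_along_line:
  fixes f :: "'a::real_normed_vector \<Rightarrow> real"
  assumes "\<And>x. (f has_derivative D x) (at x)"
  shows "((\<lambda>s. f (a + s *\<^sub>R u)) has_real_derivative D (a + s *\<^sub>R u) u) (at s)"
proof -
  have "((\<lambda>t. a + t *\<^sub>R u) has_derivative (\<lambda>t. t *\<^sub>R u)) (at s)"
    by (auto intro!: derivative_eq_intros)
  from has_derivative_compose[OF this assms[of "a + s *\<^sub>R u"]]
  have "((\<lambda>t. f (a + t *\<^sub>R u)) has_derivative (\<lambda>t. D (a + s *\<^sub>R u) (t *\<^sub>R u))) (at s)" .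
  moreover have "D (a + s *\<^sub>R u) (t *\<^sub>R u) = D (a + s *\<^sub>R u) u * t" for t
    using linear_scale[OF has_derivative_linear[OF assms[of "a + s *\<^sub>R u"]], of t u] by simp
  ultimately show ?thesis by (simp add: has_field_derivative_def)
qed

text \<open>Differentiating the translation invariant integral of
  \<open>f z = g z exp (- |z|\<^sup>2 / 2)\<close> in direction \<open>e\<close> gives \<open>0\<close>.\<close>

lemma stein_identity:
  fixes g :: "real^'n \<Rightarrow> real" and g' :: "real^'n \<Rightarrow> real^'n \<Rightarrow> real"
  assumes der: "\<And>z. (g has_derivative g' z) (at z)"
    and bg: "\<And>z. \<bar>g z\<bar> \<le> C * (1 + z \<bullet> z)"
    and bg': "\<And>z. \<bar>g' z e\<bar> \<le> C * (1 + z \<bullet> z)"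
    and bge: "\<And>z. \<bar>g z * (z \<bullet> e)\<bar> \<le> C * (1 + z \<bullet> z)"
  shows "(LINT z|std_gauss. g z * (z \<bullet> e)) = (LINT z|std_gauss. g' z e)"
proof -
  define \<phi> where "\<phi> z = exp (- (z \<bullet> z) / 2)" for z :: "real^'n"
  define f where "f z = g z * \<phi> z" for z
  define f' where "f' z = g' z e * \<phi> z - g z * (z \<bullet> e) * \<phi> z" for z
  have contg: "continuous_on UNIV g"
    by (intro continuous_at_imp_continuous_on ballI has_derivative_continuous[OF der])
  have [measurable]: "g \<in> borel_measurable borel" by (rule borel_measurable_continuous_onI[OF contg])
  have [measurable]: "\<phi> \<in> borel_measurable borel" unfolding \<phi>_def by measurable
  have [measurable]: "f \<in> borel_measurable borel" unfolding f_def by measurable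
  have C: "0 \<le> C" using order_trans[OF abs_ge_zero bg[of 0]] by simp
  have \<phi>_der: "((\<lambda>t. \<phi> (z + t *\<^sub>R e)) has_real_derivative - ((z + s *\<^sub>R e) \<bullet> e) * \<phi> (z + s *\<^sub>R e)) (at s)" for z s
  proof -
    have *: "\<phi> (z + t *\<^sub>R e) = exp (- (z \<bullet> z + 2 * t * (z \<bullet> e) + t * t * (e \<bullet> e)) / 2)" for t
      by (simp add: \<phi>_def inner_add_left inner_add_right inner_commute algebra_simps)
    have "((\<lambda>t. exp (- (z \<bullet> z + 2 * t * (z \<bullet> e) + t * t * (e \<bullet> e)) / 2)) has_real_derivative
        - (z \<bullet> e + s * (e \<bullet> e)) * exp (- (z \<bullet> z + 2 * s * (z \<bullet> e) + s * s * (e \<bullet> e)) / 2)) (at s)"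
      by (rule DERIV_cong[OF DERIV_fun_exp]) (auto intro!: derivative_eq_intros)
    then show ?thesis unfolding * by (simp only: inner_add_left inner_scaleR_left)
  qed
  have f_der: "((\<lambda>t. f (z + t *\<^sub>R e)) has_real_derivative f' (z + s *\<^sub>R e)) (at s)" for z s
    unfolding f_def f'_def
    by (rule DERIV_cong[OF DERIV_mult[OF has_derivative_along_line[OF der] \<phi>_der]]) (simp add: algebra_simps)
  have f'_bound: "\<bar>f' z\<bar> \<le> 8 * C * exp (- (z \<bullet> z) / 4)" for z
  proof -
    have "\<bar>f' z\<bar> \<le> \<bar>g' z e\<bar> * \<phi> z + \<bar>g z * (z \<bullet> e)\<bar> * \<phi> z"
      unfolding f'_def using abs_triangle_ineq4[of "g' z e * \<phi> z" "g z * (z \<bullet> e) * \<phi> z"]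
      by (simp add: abs_mult \<phi>_def)
    also have "\<dots> \<le> C * (1 + z \<bullet> z) * \<phi> z + C * (1 + z \<bullet> z) * \<phi> z"
      using bg'[of z] bge[of z] by (intro add_mono mult_right_mono) (auto simp: \<phi>_def)
    also have "\<dots> = 2 * C * ((1 + z \<bullet> z) * exp (- (z \<bullet> z) / 2))" by (simp add: \<phi>_def)
    also have "\<dots> \<le> 2 * C * (4 * exp (- (z \<bullet> z) / 4))"
      using C by (intro mult_left_mono exp_quadratic_bound) auto
    finally show ?thesis by simp
  qed
  \<comment> \<open>Dominated convergence runs along a sequence; steps of length at most 1 keep the
    intermediate points of the mean value theorem within \<open>norm e\<close> of \<open>z\<close>,
    so that one majorant serves all \<open>n\<close>.\<close>
  define t where "t n = 1 / real (Suc n)" for n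
  have t: "0 < t n" "t n \<le> 1" for n by (auto simp: t_def)
  have t0: "t \<longlonglongrightarrow> 0" unfolding t_def using LIMSEQ_inverse_real_of_nat by (simp add: inverse_eq_divide)
  have t_lim: "filterlim t (at 0) sequentially"
    using t0 t(1) by (auto simp: filterlim_at less_imp_neq[THEN not_sym])
  define s where "s n z = (f (t n *\<^sub>R e + z) - f z) / t n" for n z
  have s_lim: "(\<lambda>n. s n z) \<longlonglongrightarrow> f' z" for z
  proof -
    have "((\<lambda>h. (f (z + h *\<^sub>R e) - f z) / h) \<longlongrightarrow> f' z) (at 0)"
      using f_der[of z 0] by (simp add: has_field_derivative_iff)
    from filterlim_compose[OF this t_lim] show ?thesis by (simp add: s_def add.commute)
  qed
  define K where "K = 8 * C * exp ((e \<bullet> e) / 4)"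
  have s_bound: "norm (s n z) \<le> K * exp (- (1/8 * (z \<bullet> z)))" for n z
  proof -
    obtain x where x: "0 < x" "x < t n" "f (z + t n *\<^sub>R e) - f (z + 0 *\<^sub>R e) = (t n - 0) * f' (z + x *\<^sub>R e)"
      using MVT2[OF t(1)[of n], of "\<lambda>t. f (z + t *\<^sub>R e)" "\<lambda>s. f' (z + s *\<^sub>R e)"] f_der by blast
    have "s n z = f' (z + x *\<^sub>R e)" using x(3) t(1)[of n] by (simp add: s_def add.commute)
    moreover have "\<bar>f' (z + x *\<^sub>R e)\<bar> \<le> 8 * C * exp (- ((z + x *\<^sub>R e) \<bullet> (z + x *\<^sub>R e)) / 4)" by (rule f'_bound)
    \<comment> \<open>From \<open>|z + 2 x e|\<^sup>2 \<ge> 0\<close> follows \<open>|z|\<^sup>2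
      \<le> 2 |z + x e|\<^sup>2 + 2 x\<^sup>2 |e|\<^sup>2\<close>: moving the centre halves the
      exponent once more, from 1/4 to 1/8, and costs the factor
      \<open>exp ((e \<bullet> e) / 4)\<close> in \<open>K\<close>.\<close>
    moreover have "- ((z + x *\<^sub>R e) \<bullet> (z + x *\<^sub>R e)) / 4 \<le> (e \<bullet> e) / 4 + - (1/8 * (z \<bullet> z))"
    proof -
      have "0 \<le> (z + (2 * x) *\<^sub>R e) \<bullet> (z + (2 * x) *\<^sub>R e)" by (rule inner_ge_zero)
      moreover have "x * x * (e \<bullet> e) \<le> 1 * (e \<bullet> e)"
        using x t(2)[of n] by (intro mult_right_mono mult_le_one) auto
      ultimately have "z \<bullet> z - 2 * (e \<bullet> e) \<le> 2 * ((z + x *\<^sub>R e) \<bullet> (z + x *\<^sub>R e))"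
        by (simp add: inner_add_left inner_add_right inner_commute algebra_simps)
      then show ?thesis by simp
    qed
    then have "8 * C * exp (- ((z + x *\<^sub>R e) \<bullet> (z + x *\<^sub>R e)) / 4) \<le> 8 * C * exp ((e \<bullet> e) / 4 + - (1/8 * (z \<bullet> z)))"
      using C by (intro mult_left_mono) auto
    ultimately show ?thesis unfolding K_def exp_add by (simp only: real_norm_def mult.assoc)
  qed
  have s_meas [measurable]: "s n \<in> borel_measurable borel" for n unfolding s_def by measurable
  \<comment> \<open>Measurability of the directional derivative is deduced: \<open>f'\<close> is a
    pointwise limit of measurable difference quotients, and its definition can be solved for
    \<open>g' z e\<close>.\<close>
  have f'_meas [measurable]: "f' \<in> borel_measurable borel"
    by (rule borel_measurable_LIMSEQ_real[OF s_lim]) auto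
  have "(\<lambda>z. (f' z + g z * (z \<bullet> e) * \<phi> z) / \<phi> z) \<in> borel_measurable borel" by measurable
  moreover have "(f' z + g z * (z \<bullet> e) * \<phi> z) / \<phi> z = g' z e" for z
    by (simp add: f'_def \<phi>_def)
  ultimately have [measurable]: "(\<lambda>z. g' z e) \<in> borel_measurable borel" by simp
  have int_K: "integrable lborel (\<lambda>z::real^'n. K * exp (- (1/8 * (z \<bullet> z))))"
    by (intro integrable_mult_right integrable_exp_neg_square) simp
  have f_int: "integrable lborel f"
  proof (rule Bochner_Integration.integrable_bound)
    show "integrable lborel (\<lambda>z::real^'n. (4 * C) * exp (- (1/4 * (z \<bullet> z))))"
      by (intro integrable_mult_right integrable_exp_neg_square) simp
    show "AE z in lborel. norm (f z) \<le> norm ((4 * C) * exp (- (1/4 * (z \<bullet> z))))"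
    proof (rule AE_I2)
      fix z
      have "norm (f z) \<le> C * (1 + z \<bullet> z) * \<phi> z"
        unfolding f_def using bg[of z] by (simp add: abs_mult \<phi>_def)
      also have "\<dots> = C * ((1 + z \<bullet> z) * exp (- (z \<bullet> z) / 2))" by (simp add: \<phi>_def)
      also have "\<dots> \<le> C * (4 * exp (- (z \<bullet> z) / 4))"
        using C by (intro mult_left_mono exp_quadratic_bound) auto
      finally show "norm (f z) \<le> norm ((4 * C) * exp (- (1/4 * (z \<bullet> z))))" using C by simp
    qed
  qed measurable
  have s_zero: "(LINT z|lborel. s n z) = 0" for n
  proof -
    have "integrable lborel (\<lambda>z. f (t n *\<^sub>R e + z))" using f_int by (subst integral_lborel_translate) auto
    then show ?thesis unfolding s_def using f_int integral_lborel_translate(1)[of f "t n *\<^sub>R e"] by simp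
  qed
  have "(\<lambda>n. LINT z|lborel. s n z) \<longlonglongrightarrow> (LINT z|lborel. f' z)"
    by (rule integral_dominated_convergence[OF _ _ int_K]) (use s_lim s_bound in auto)
  then have f'0: "(LINT z|lborel. f' z) = 0" unfolding s_zero using LIMSEQ_unique tendsto_const by blast
  have i1: "integrable std_gauss (\<lambda>z. g' z e)" and i2: "integrable std_gauss (\<lambda>z. g z * (z \<bullet> e))"
    by (rule integrable_std_gauss[where C=C], use bg' bge in auto)+
  have "(LINT z|std_gauss. g' z e) - (LINT z|std_gauss. g z * (z \<bullet> e)) = (LINT z|std_gauss. g' z e - g z * (z \<bullet> e))"
    using i1 i2 by simp
  also have "\<dots> = (LINT z|lborel. f' z / sqrt (2 * pi) ^ CARD('n))"
    by (subst integral_std_gauss) (auto simp: f'_def \<phi>_def algebra_simps diff_divide_distrib intro!: Bochner_Integration.integral_cong)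
  also have "\<dots> = 0" using f'0 by simp
  finally show "(LINT z|std_gauss. g z * (z \<bullet> e)) = (LINT z|std_gauss. g' z e)" by simp
qed

section \<open>Moments and affine images\<close>

lemma norm_le_one_plus_square: "norm (z::'a::real_inner) \<le> 1 + z \<bullet> z"
proof -
  have "0 \<le> (norm z - 1)\<^sup>2" by simp
  then have "2 * norm z \<le> 1 + (norm z)\<^sup>2" by (simp add: power2_eq_square algebra_simps)
  then show ?thesis using norm_ge_zero[of z] unfolding power2_norm_eq_inner by linarith
qed

lemma one_plus_norm_le: "1 + norm (z::'a::real_inner) \<le> 2 * (1 + z \<bullet> z)"
  using norm_le_one_plus_square[of z] inner_ge_zero[of z] by (simp only: distrib_left)

lemma inner_le_quadratic:
  fixes z e :: "'a::real_inner"
  shows "\<bar>z \<bullet> e\<bar> \<le> norm e * (1 + z \<bullet> z)"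
proof -
  have "\<bar>z \<bullet> e\<bar> \<le> norm z * norm e" by (rule Cauchy_Schwarz_ineq2)
  also have "\<dots> \<le> (1 + z \<bullet> z) * norm e" using norm_le_one_plus_square by (rule mult_right_mono) simp
  finally show ?thesis by (simp add: mult.commute)
qed

lemma inner_mult_inner_le_quadratic:
  fixes z e :: "'a::real_inner"
  shows "\<bar>(z \<bullet> a) * (z \<bullet> e)\<bar> \<le> norm a * norm e * (1 + z \<bullet> z)"
proof -
  have "\<bar>(z \<bullet> a) * (z \<bullet> e)\<bar> \<le> (norm z * norm a) * (norm z * norm e)"
    unfolding abs_mult by (intro mult_mono Cauchy_Schwarz_ineq2) auto
  also have "\<dots> = norm a * norm e * (z \<bullet> z)" by (simp add: power2_eq_square flip: power2_norm_eq_inner)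
  also have "\<dots> \<le> norm a * norm e * (1 + z \<bullet> z)" by (intro mult_left_mono) auto
  finally show ?thesis .
qed

lemma integrable_std_gauss_inner: "integrable std_gauss (\<lambda>z::real^'n. z \<bullet> e)"
  by (rule integrable_std_gauss[where C="norm e"]) (auto simp: inner_le_quadratic)

lemma integrable_std_gauss_inner_inner: "integrable std_gauss (\<lambda>z::real^'n. (z \<bullet> a) * (z \<bullet> e))"
  by (rule integrable_std_gauss[where C="norm a * norm e"])
    (use inner_mult_inner_le_quadratic in \<open>auto simp del: abs_mult simp: real_norm_def\<close>)

text \<open>Stein's identity for the constant function 1.\<close>

lemma std_gauss_mean: "(LINT z|std_gauss. (z::real^'n) \<bullet> e) = 0"
proof -
  have "(LINT z|std_gauss. 1 * ((z::real^'n) \<bullet> e)) = (LINT z|(std_gauss :: (real^'n) measure). 0)"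
  proof (rule stein_identity[where C="1 + norm e"])
    fix z :: "real^'n"
    have "1 * 1 \<le> (1 + norm e) * (1 + z \<bullet> z)" by (intro mult_mono) auto
    then show "\<bar>1\<bar> \<le> (1 + norm e) * (1 + z \<bullet> z)" by simp
    then show "\<bar>0\<bar> \<le> (1 + norm e) * (1 + z \<bullet> z)" by simp
    have "\<bar>z \<bullet> e\<bar> \<le> norm e * (1 + z \<bullet> z)" by (rule inner_le_quadratic)
    also have "\<dots> \<le> (1 + norm e) * (1 + z \<bullet> z)" by (intro mult_right_mono) auto
    finally show "\<bar>1 * (z \<bullet> e)\<bar> \<le> (1 + norm e) * (1 + z \<bullet> z)" by simp
  qed (rule has_derivative_const)
  then show ?thesis by simp
qed

text \<open>Stein's identity for the linear function \<open>\<lambda>z. z \<bullet> a\<close>, whose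
  derivative in direction \<open>e\<close> is the constant \<open>e \<bullet> a\<close>.\<close>

lemma std_gauss_covariance: "(LINT z|std_gauss. ((z::real^'n) \<bullet> a) * (z \<bullet> e)) = a \<bullet> e"
proof -
  interpret prob_space "std_gauss :: (real^'n) measure" by (rule prob_space_std_gauss)
  define C where "C = norm a + norm a * norm e"
  have C: "norm a \<le> C" "norm a * norm e \<le> C" by (auto simp: C_def)
  have "(LINT z|std_gauss. ((z::real^'n) \<bullet> a) * (z \<bullet> e)) = (LINT z|(std_gauss :: (real^'n) measure). e \<bullet> a)"
  proof (rule stein_identity[where C=C and g'="\<lambda>_ h. h \<bullet> a"])
    fix z :: "real^'n"
    show "((\<lambda>z. z \<bullet> a) has_derivative (\<lambda>h. h \<bullet> a)) (at z)" by (auto intro!: derivative_eq_intros)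
    show "\<bar>z \<bullet> a\<bar> \<le> C * (1 + z \<bullet> z)"
      by (rule order_trans[OF inner_le_quadratic]) (use C in \<open>auto intro: mult_right_mono\<close>)
    show "\<bar>(z \<bullet> a) * (z \<bullet> e)\<bar> \<le> C * (1 + z \<bullet> z)"
      by (rule order_trans[OF inner_mult_inner_le_quadratic]) (use C in \<open>auto intro: mult_right_mono\<close>)
    have "\<bar>e \<bullet> a\<bar> \<le> norm a * norm e" using Cauchy_Schwarz_ineq2[of e a] by (simp add: mult.commute)
    also have "\<dots> \<le> C * 1" using C by simp
    also have "\<dots> \<le> C * (1 + z \<bullet> z)" by (rule mult_left_mono) (auto simp: C_def)
    finally show "\<bar>e \<bullet> a\<bar> \<le> C * (1 + z \<bullet> z)" .
  qed
  then show ?thesis using prob_space by (simp add: inner_commute)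
qed

text \<open>Mean zero and identity covariance split the expected inner product into one of the means
  and a Frobenius product of the linear parts. Wasserstein costs and quadratic error terms are
  evaluated by this formula.\<close>

lemma std_gauss_affine_inner:
  fixes D E :: "real^'n^'m"
  shows "integrable std_gauss (\<lambda>z. (c + D *v z) \<bullet> (c' + E *v z))"
    and "(LINT z|std_gauss. (c + D *v z) \<bullet> (c' + E *v z)) = c \<bullet> c' + D \<bullet> E"
proof -
  interpret prob_space "std_gauss :: (real^'n) measure" by (rule prob_space_std_gauss)
  have 1: "(\<lambda>z. (c + D *v z) \<bullet> (c' + E *v z)) =
    (\<lambda>z. c \<bullet> c' + (z \<bullet> (transpose E *v c) + (z \<bullet> (transpose D *v c') + (\<Sum>i\<in>UNIV. (z \<bullet> D$i) * (z \<bullet> E$i)))))"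
  proof
    fix z
    have "(D *v z) \<bullet> (E *v z) = (\<Sum>i\<in>UNIV. (z \<bullet> D$i) * (z \<bullet> E$i))"
      by (simp add: inner_vec_def[of "D *v z"] matrix_vector_mul_component inner_commute)
    moreover have "c \<bullet> (E *v z) = z \<bullet> (transpose E *v c)"
      by (metis inner_commute inner_matrix_vector_transpose)
    moreover have "(D *v z) \<bullet> c' = z \<bullet> (transpose D *v c')"
      by (rule inner_matrix_vector_transpose)
    ultimately show "(c + D *v z) \<bullet> (c' + E *v z) = c \<bullet> c' + (z \<bullet> (transpose E *v c) + (z \<bullet> (transpose D *v c') + (\<Sum>i\<in>UNIV. (z \<bullet> D$i) * (z \<bullet> E$i))))"
      by (simp add: inner_add_left inner_add_right del: transpose_matrix_vector)
  qed
  note int = integrable_std_gauss_inner integrable_std_gauss_inner_inner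
  show "integrable std_gauss (\<lambda>z. (c + D *v z) \<bullet> (c' + E *v z))"
    unfolding 1 by (intro Bochner_Integration.integrable_add Bochner_Integration.integrable_sum int) simp
  show "(LINT z|std_gauss. (c + D *v z) \<bullet> (c' + E *v z)) = c \<bullet> c' + D \<bullet> E"
    unfolding 1 using prob_space
    by (simp add: int Bochner_Integration.integrable_sum std_gauss_mean std_gauss_covariance
        inner_vec_def[of D] del: transpose_matrix_vector)
qed

section \<open>Affine change of variables for Lebesgue measure\<close>

lemma affine_borel_measurable [measurable]:
  fixes K :: "real^'n^'m"
  shows "(\<lambda>z. m + K *v z) \<in> borel_measurable borel"
  by (intro borel_measurable_continuous_onI continuous_intros)

text \<open>Lebesgue measure is determined by its values on boxes. The preimage of a box is the
  image of a translated box under the inverse matrix \<open>L\<close>, so its volume carries the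
  factor \<open>|det L|\<close>, which the weight \<open>|det K|\<close> cancels.\<close>

lemma lborel_affine_matrix_wellorder:
  fixes K :: "real^'n::{finite,wellorder}^'n::{finite,wellorder}"
  assumes "invertible K"
  shows "lborel = density (distr lborel borel (\<lambda>z. m + K *v z)) (\<lambda>_. ennreal \<bar>det K\<bar>)"
proof (rule lborel_eqI)
  obtain L where L: "K ** L = mat 1" "L ** K = mat 1" using assms by (auto simp: invertible_def)
  have detKL: "det K * det L = 1" by (metis L(1) det_I det_mul)
  fix l u :: "real^'n::{finite,wellorder}" assume lu: "\<And>b. b \<in> Basis \<Longrightarrow> l \<bullet> b \<le> u \<bullet> b"
  have pre: "(\<lambda>z. m + K *v z) -` box l u = (*v) L ` ((+) (-m) ` box l u)" (is "?P = ?I")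
  proof
    show "?P \<subseteq> ?I"
    proof
      fix z assume z: "z \<in> ?P"
      have "z = L *v (- m + (m + K *v z))" by (simp add: matrix_vector_mul_assoc L)
      then show "z \<in> ?I" using z by blast
    qed
    show "?I \<subseteq> ?P" by (auto simp: matrix_vector_mul_assoc L)
  qed
  have lm: "(+) (-m) ` box l u \<in> lmeasurable" by (intro measurable_translation lmeasurable_box)
  have "emeasure lebesgue ?I = ennreal (measure lebesgue ?I)"
    using measurable_linear_image[OF matrix_vector_mul_linear lm] by (intro emeasure_eq_measure2) auto
  also have "measure lebesgue ?I = \<bar>det L\<bar> * measure lebesgue ((+) (-m) ` box l u)"
    by (subst measure_linear_image[OF _ lm]) simp_all
  also have "measure lebesgue ((+) (-m) ` box l u) = measure lborel (box l u)"
    unfolding measure_translation by simp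
  also have "measure lborel (box l u) = (\<Prod>b\<in>Basis. (u - l) \<bullet> b)" using lu by simp
  finally have e: "emeasure lebesgue ?I = ennreal (\<bar>det L\<bar> * (\<Prod>b\<in>Basis. (u - l) \<bullet> b))" .
  have "?P \<in> sets borel" by (rule measurable_sets_borel[where M=borel]) auto
  then have e': "emeasure lborel ?P = ennreal (\<bar>det L\<bar> * (\<Prod>b\<in>Basis. (u - l) \<bullet> b))"
    using e unfolding pre by simp
  have "emeasure (density (distr lborel borel (\<lambda>z. m + K *v z)) (\<lambda>_. ennreal \<bar>det K\<bar>)) (box l u)
      = ennreal \<bar>det K\<bar> * emeasure lborel ?P"
    by (simp add: emeasure_density_const emeasure_distr)
  also have "\<dots> = ennreal ((\<bar>det K\<bar> * \<bar>det L\<bar>) * (\<Prod>b\<in>Basis. (u - l) \<bullet> b))"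
    unfolding e' by (simp add: ennreal_mult'' mult.assoc flip: ennreal_mult')
  also have "\<bar>det K\<bar> * \<bar>det L\<bar> = 1" using detKL by (simp flip: abs_mult)
  finally show "emeasure (density (distr lborel borel (\<lambda>z. m + K *v z)) (\<lambda>_. ennreal \<bar>det K\<bar>)) (box l u)
    = ennreal (\<Prod>b\<in>Basis. (u - l) \<bullet> b)" by simp
qed simp

text \<open>The library computes the volume of a linear image only for well-ordered index types. The copy
  below of an arbitrary finite index type carries a well-order.\<close>

typedef 'n ordered = "UNIV :: 'n set" by auto

instance ordered :: (finite) finite
proof
  have "(UNIV :: 'a ordered set) = Abs_ordered ` UNIV" by (metis Abs_ordered_cases surjI UNIV_I)
  then show "finite (UNIV :: 'a ordered set)" by (metis finite finite_imageI)
qed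

text \<open>A chosen injection pulls the well-order of \<open>nat\<close> back to the copied index
  type.\<close>

definition ordered_rank :: "'n::finite ordered \<Rightarrow> nat" where
  "ordered_rank = (SOME f. inj f)"

lemma inj_ordered_rank: "inj (ordered_rank :: 'n::finite ordered \<Rightarrow> nat)"
proof -
  have "\<exists>f :: 'n ordered \<Rightarrow> nat. inj f" using finite_imp_inj_to_nat_seg[of "UNIV :: 'n ordered set"] by auto
  then show ?thesis unfolding ordered_rank_def by (rule someI_ex)
qed

instantiation ordered :: (finite) wellorder
begin

definition less_eq_ordered :: "'a ordered \<Rightarrow> 'a ordered \<Rightarrow> bool" where
  "x \<le> y \<longleftrightarrow> ordered_rank x \<le> ordered_rank y"

definition less_ordered :: "'a ordered \<Rightarrow> 'a ordered \<Rightarrow> bool" where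
  "x < y \<longleftrightarrow> ordered_rank x < ordered_rank y"

instance
proof
  fix x y :: "'a ordered"
  show "x \<le> y \<Longrightarrow> y \<le> x \<Longrightarrow> x = y"
    using inj_ordered_rank by (auto simp: less_eq_ordered_def inj_def)
next
  fix P :: "'a ordered \<Rightarrow> bool" and a :: "'a ordered"
  assume *: "\<And>x. (\<And>y. y < x \<Longrightarrow> P y) \<Longrightarrow> P x"
  show "P a"
    by (induction a rule: measure_induct_rule[of ordered_rank]) (use * in \<open>simp add: less_ordered_def\<close>)
qed (auto simp: less_eq_ordered_def less_ordered_def)

end

lemma bij_Rep_ordered: "bij (Rep_ordered :: 'n ordered \<Rightarrow> 'n)"
  by (metis Abs_ordered_inverse Rep_ordered_inject UNIV_I bijI injI surjI)

definition vec_unorder :: "real^('n::finite ordered) \<Rightarrow> real^'n" where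
  "vec_unorder x = (\<chi> i. x $ Abs_ordered i)"

definition matrix_order :: "real^'n^'n \<Rightarrow> real^('n::finite ordered)^('n ordered)" where
  "matrix_order K = (\<chi> i j. K $ Rep_ordered i $ Rep_ordered j)"

lemma sum_ordered: "(\<Sum>i\<in>UNIV. f (Rep_ordered i)) = (\<Sum>i\<in>(UNIV::'n::finite set). f i)"
  by (rule sum.reindex_bij_betw[OF bij_Rep_ordered])

lemma prod_ordered: "(\<Prod>i\<in>UNIV. f (Rep_ordered i)) = (\<Prod>i\<in>(UNIV::'n::finite set). f i)"
  by (rule prod.reindex_bij_betw[OF bij_Rep_ordered])

lemma vec_unorder_matrix: "vec_unorder (matrix_order K *v x) = K *v vec_unorder x"
proof -
  have "(\<Sum>j\<in>UNIV. K$i$Rep_ordered j * x $ j) = (\<Sum>j\<in>UNIV. K$i$j * x $ Abs_ordered j)" for i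
    using sum_ordered[of "\<lambda>j. K$i$j * x $ Abs_ordered j"] by (simp add: Rep_ordered_inverse)
  then show ?thesis
    by (simp add: vec_unorder_def matrix_order_def matrix_vector_mult_def vec_eq_iff Abs_ordered_inverse)
qed

lemma matrix_order_mult: "matrix_order (A ** B) = matrix_order A ** matrix_order B"
  by (simp add: matrix_order_def matrix_matrix_mult_def vec_eq_iff sum_ordered[where f="\<lambda>k. A$i$k * B$k$j" for i j])

lemma matrix_order_transpose: "matrix_order (transpose A) = transpose (matrix_order A)"
  by (simp add: matrix_order_def transpose_def)

lemma matrix_order_one: "matrix_order (mat 1) = mat 1"
  by (simp add: matrix_order_def mat_def Rep_ordered_inject)

lemma matrix_order_spec: "matrix_order (spec P d) = spec (matrix_order P) (\<lambda>i. d (Rep_ordered i))"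
proof -
  have "matrix_order (diag_mat d) = diag_mat (\<lambda>i. d (Rep_ordered i))"
    by (simp add: matrix_order_def diag_mat_def vec_eq_iff Rep_ordered_inject)
  then show ?thesis by (simp add: spec_def matrix_order_mult matrix_order_transpose)
qed

lemma matrix_order_orthogonal: "orthogonal_matrix P \<Longrightarrow> orthogonal_matrix (matrix_order P)"
  unfolding orthogonal_matrix_def
  by (metis matrix_order_mult matrix_order_one matrix_order_transpose)

text \<open>Determinants over two index types are compared through eigenvalues: relabelling takes a
  spectral decomposition of \<open>K ** transpose K\<close> to one with the same eigenvalues, and
  their product is the determinant. This fixes the square of \<open>det K\<close>, hence the
  absolute value that enters a change of variables.\<close>

lemma abs_det_matrix_order:
  assumes "invertible K"
  shows "\<bar>det (matrix_order K)\<bar> = \<bar>det K\<bar>"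
proof -
  obtain P d where P: "orthogonal_matrix P" "K ** transpose K = spec P d"
    using spd_diagonalization[OF spd_gram[OF assms]] by blast
  have "det (matrix_order K) * det (matrix_order K) = det (matrix_order (K ** transpose K))"
    by (simp add: matrix_order_mult matrix_order_transpose det_mul)
  also have "\<dots> = (\<Prod>i\<in>UNIV. d (Rep_ordered i))"
    unfolding P(2) matrix_order_spec by (rule det_spec[OF matrix_order_orthogonal[OF P(1)]])
  also have "\<dots> = det (K ** transpose K)" unfolding P(2) det_spec[OF P(1)] by (rule prod_ordered)
  also have "\<dots> = det K * det K" by (simp add: det_mul)
  finally show ?thesis by (metis power2_eq_square real_sqrt_abs)
qed

lemma prod_Basis_vec: "(\<Prod>b\<in>Basis. f ((v :: real^'n) \<bullet> b)) = (\<Prod>i\<in>UNIV. f (v $ i))"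
proof -
  have "Basis = range (\<lambda>i. axis i 1 :: real^'n)" by (auto simp: Basis_vec_def)
  moreover have "inj (\<lambda>i. axis i 1 :: real^'n)" by (auto simp: inj_def axis_eq_axis)
  ultimately have "(\<Prod>b\<in>Basis. f (v \<bullet> b)) = (\<Prod>i\<in>UNIV. f (v \<bullet> axis i 1))"
    using prod.reindex[of "\<lambda>i. axis i 1 :: real^'n" UNIV "\<lambda>b. f (v \<bullet> b)"] by (simp add: comp_def)
  then show ?thesis by (simp add: inner_axis)
qed

lemma vec_unorder_measurable [measurable]: "vec_unorder \<in> borel_measurable borel"
  unfolding vec_unorder_def by (intro borel_measurable_continuous_onI continuous_intros)

lemma distr_vec_unorder: "lborel = distr lborel borel (vec_unorder :: real^('n::finite ordered) \<Rightarrow> real^'n)"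
proof (rule lborel_eqI)
  fix l u :: "real^'n" assume lu: "\<And>b. b \<in> Basis \<Longrightarrow> l \<bullet> b \<le> u \<bullet> b"
  define l' u' :: "real^('n ordered)" where "l' = (\<chi> i. l $ Rep_ordered i)" and "u' = (\<chi> i. u $ Rep_ordered i)"
  have le: "l' \<bullet> b \<le> u' \<bullet> b" if b: "b \<in> Basis" for b
  proof -
    obtain i where "b = axis i 1" using b by (auto simp: Basis_vec_def)
    then show ?thesis using lu[of "axis (Rep_ordered i) 1"] by (simp add: inner_axis l'_def u'_def)
  qed
  have "vec_unorder -` box l u = box l' u'"
    unfolding box_def Basis_vec_def
    by (auto simp: inner_axis l'_def u'_def vec_unorder_def) (metis Rep_ordered_inverse Abs_ordered_inverse UNIV_I)+
  then have "emeasure (distr lborel borel vec_unorder) (box l u) = emeasure lborel (box l' u')"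
    by (simp add: emeasure_distr)
  also have "\<dots> = ennreal (\<Prod>b\<in>Basis. (u' - l') \<bullet> b)" by (rule emeasure_lborel_box[OF le])
  also have "(\<Prod>b\<in>Basis. (u' - l') \<bullet> b) = (\<Prod>b\<in>Basis. (u - l) \<bullet> b)"
    unfolding prod_Basis_vec[where f="\<lambda>x. x"]
    by (simp add: u'_def l'_def prod_ordered[where f="\<lambda>i. u$i - l$i"])
  finally show "emeasure (distr lborel borel vec_unorder) (box l u) = ennreal (\<Prod>b\<in>Basis. (u - l) \<bullet> b)" .
qed simp

text \<open>Relabelling the coordinates preserves Lebesgue measure and intertwines the affine map
  with its relabelled copy, so the formula over the ordered index type carries over.\<close>

lemma lborel_affine_matrix:
  fixes K :: "real^'n^'n"
  assumes "invertible K"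
  shows "lborel = density (distr lborel borel (\<lambda>z. m + K *v z)) (\<lambda>_. ennreal \<bar>det K\<bar>)"
proof -
  obtain L where L: "K ** L = mat 1" "L ** K = mat 1" using assms by (auto simp: invertible_def)
  have inv: "invertible (matrix_order K)"
    unfolding invertible_right_inverse using L(1) by (metis matrix_order_mult matrix_order_one)
  define m' :: "real^('n ordered)" where "m' = (\<chi> i. m $ Rep_ordered i)"
  let ?T' = "\<lambda>z. m' + matrix_order K *v z" and ?T = "\<lambda>z. m + K *v z"
  have T: "vec_unorder (?T' z) = ?T (vec_unorder z)" for z
  proof -
    have "vec_unorder (?T' z) = vec_unorder m' + vec_unorder (matrix_order K *v z)"
      by (simp add: vec_unorder_def vec_eq_iff)
    moreover have "vec_unorder m' = m" by (simp add: vec_unorder_def m'_def vec_eq_iff Abs_ordered_inverse)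
    ultimately show ?thesis by (simp add: vec_unorder_matrix)
  qed
  have "lborel = distr (density (distr lborel borel ?T') (\<lambda>_. ennreal \<bar>det (matrix_order K)\<bar>)) borel (vec_unorder :: _ \<Rightarrow> real^'n)"
    unfolding lborel_affine_matrix_wellorder[OF inv, symmetric] by (rule distr_vec_unorder)
  also have "\<dots> = density (distr (distr lborel borel ?T') borel vec_unorder) (\<lambda>_. ennreal \<bar>det (matrix_order K)\<bar>)"
    by (rule density_distr[symmetric]) auto
  also have "distr (distr lborel borel ?T') borel vec_unorder = distr (distr lborel borel vec_unorder) borel ?T"
    by (simp add: distr_distr comp_def T)
  finally show ?thesis unfolding distr_vec_unorder[symmetric] abs_det_matrix_order[OF assms] .
qed

section \<open>Gaussians as affine images of the standard Gaussian\<close>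

lemma gauss_dens_affine:
  fixes K :: "real^'n^'n"
  assumes "invertible K"
  shows "gauss_dens m (K ** transpose K) (m + K *v z) = exp (- (z \<bullet> z) / 2) / (sqrt (2 * pi) ^ CARD('n) * \<bar>det K\<bar>)"
proof -
  obtain L where L: "K ** L = mat 1" "L ** K = mat 1" using assms by (auto simp: invertible_def)
  have "K ** transpose K ** (transpose L ** L) = K ** transpose (L ** K) ** L"
    by (simp add: matrix_transpose_mul matrix_mul_assoc)
  then have inv: "matrix_inv (K ** transpose K) = transpose L ** L"
    by (intro matrix_inv_eqI) (simp add: L)
  have "(K *v z) \<bullet> ((transpose L ** L) *v (K *v z)) = (L *v (K *v z)) \<bullet> (L *v (K *v z))"
    by (metis inner_matrix_vector_transpose matrix_vector_mul_assoc)
  also have "L *v (K *v z) = z" by (simp add: matrix_vector_mul_assoc L)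
  finally have "(K *v z) \<bullet> ((transpose L ** L) *v (K *v z)) = z \<bullet> z" .
  then show ?thesis
    by (simp add: gauss_dens_def inv det_mul real_sqrt_mult real_sqrt_power power_mult_distrib)
qed

text \<open>\<open>K\<close> ranges over all invertible factors and not only over symmetric square
  roots: factors that arise from optimal transport, such as \<open>T ** M\<close>, are not symmetric
  in general, and different factors of one covariance give different couplings of the same
  laws.\<close>

lemma gauss_eq_distr:
  fixes K :: "real^'n^'n"
  assumes "invertible K"
  shows "gauss m (K ** transpose K) = distr std_gauss borel (\<lambda>z. m + K *v z)"
proof -
  let ?T = "\<lambda>z. m + K *v z" and ?d = "gauss_dens m (K ** transpose K)"
  have dK: "det K \<noteq> 0" using assms by (simp add: invertible_det_nz)
  have "gauss m (K ** transpose K) = density (density (distr lborel borel ?T) (\<lambda>_. ennreal \<bar>det K\<bar>)) (\<lambda>x. ennreal (?d x))"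
    unfolding gauss_def by (subst lborel_affine_matrix[OF assms, of m]) (rule refl)
  also have "\<dots> = density (distr lborel borel ?T) (\<lambda>x. ennreal \<bar>det K\<bar> * ennreal (?d x))"
    by (rule density_density_eq) auto
  also have "\<dots> = distr (density lborel (\<lambda>z. ennreal \<bar>det K\<bar> * ennreal (?d (?T z)))) borel ?T"
    by (rule density_distr) auto
  also have "(\<lambda>z. ennreal \<bar>det K\<bar> * ennreal (?d (?T z))) = (\<lambda>z. ennreal (gauss_dens 0 (mat 1) z))"
    using dK by (simp add: gauss_dens_affine[OF assms] std_gauss_dens flip: ennreal_mult')
  finally show ?thesis by (simp add: gauss_def)
qed

lemma gauss_exp_eq:
  fixes K :: "real^'n^'n" and f :: "real^'n \<Rightarrow> 'b::{banach,second_countable_topology}"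
  assumes "invertible K" and [measurable]: "f \<in> borel_measurable borel"
  shows "gauss_exp m (K ** transpose K) f = (LINT z|std_gauss. f (m + K *v z))"
proof -
  have "gauss_exp m (K ** transpose K) f = (LINT x|gauss m (K ** transpose K). f x)"
    unfolding gauss_exp_def gauss_def using spd_gram[OF assms(1)]
    by (subst integral_density) auto
  also have "\<dots> = (LINT z|std_gauss. f (m + K *v z))"
    unfolding gauss_eq_distr[OF assms(1)] by (subst integral_distr) auto
  finally show ?thesis .
qed

text \<open>In the coordinate \<open>z\<close> the logarithm of the density is
  \<open>- |z|\<^sup>2 / 2\<close> plus constants, and the expectation of \<open>|z|\<^sup>2\<close>
  is the dimension. Between Gaussians the entropy thus varies only through
  \<open>- ln |det K|\<close>.\<close>

lemma entropy_gauss_eq: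
  fixes K :: "real^'n^'n"
  assumes K: "invertible K"
  shows "entropy_gauss m (K ** transpose K) = - real CARD('n) / 2 - ln (sqrt (2 * pi) ^ CARD('n)) - ln \<bar>det K\<bar>"
proof -
  interpret prob_space "std_gauss :: (real^'n) measure" by (rule prob_space_std_gauss)
  have dK: "det K \<noteq> 0" using assms by (simp add: invertible_det_nz)
  have "entropy_gauss m (K ** transpose K) = gauss_exp m (K ** transpose K) (\<lambda>x. ln (gauss_dens m (K ** transpose K) x))"
    by (simp add: entropy_gauss_def gauss_exp_def)
  also have "\<dots> = (LINT z|std_gauss. ln (gauss_dens m (K ** transpose K) (m + K *v z)))"
    by (rule gauss_exp_eq[OF K]) simp
  also have "\<dots> = (LINT z|std_gauss. (- 1/2) * ((0 + (mat 1 :: real^'n^'n) *v z) \<bullet> (0 + mat 1 *v z)) + (- ln (sqrt (2 * pi) ^ CARD('n)) - ln \<bar>det K\<bar>))"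
    using dK by (intro Bochner_Integration.integral_cong refl)
      (simp add: gauss_dens_affine[OF K] ln_div ln_mult del: ln_realpow)
  also have "\<dots> = (- 1/2) * (0 \<bullet> (0::real^'n) + (mat 1 :: real^'n^'n) \<bullet> mat 1) + (- ln (sqrt (2 * pi) ^ CARD('n)) - ln \<bar>det K\<bar>)"
    using std_gauss_affine_inner[of 0 "mat 1 :: real^'n^'n" 0 "mat 1"] prob_space
    by (subst Bochner_Integration.integral_add) (auto intro!: integrable_mult_right simp del: ln_realpow)
  finally show ?thesis by (simp add: matrix_inner_one trace_I del: ln_realpow)
qed

section \<open>The Wasserstein distance of Gaussians\<close>

text \<open>The coupling drives both laws by the same standard normal. Each choice of factors gives
  an upper bound.\<close>

lemma W2sq_gauss_le:
  fixes M N :: "real^'n^'n"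
  assumes M: "invertible M" and N: "invertible N"
  shows "W2sq (gauss m (M ** transpose M)) (gauss n (N ** transpose N))
    \<le> ennreal ((m - n) \<bullet> (m - n) + (M - N) \<bullet> (M - N))"
proof -
  interpret prob_space "std_gauss :: (real^'n) measure" by (rule prob_space_std_gauss)
  define \<gamma> where "\<gamma> = distr std_gauss (borel \<Otimes>\<^sub>M borel) (\<lambda>z. (m + M *v z, n + N *v z))"
  have "\<gamma> \<in> couplings (gauss m (M ** transpose M)) (gauss n (N ** transpose N))"
    unfolding couplings_def
  proof (intro CollectI conjI)
    show "prob_space \<gamma>" unfolding \<gamma>_def by (rule prob_space_distr) measurable
    show "sets \<gamma> = sets (borel \<Otimes>\<^sub>M borel)" by (simp add: \<gamma>_def)
    show "distr \<gamma> borel fst = gauss m (M ** transpose M)"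
      unfolding \<gamma>_def gauss_eq_distr[OF M] by (subst distr_distr) (auto simp: comp_def)
    show "distr \<gamma> borel snd = gauss n (N ** transpose N)"
      unfolding \<gamma>_def gauss_eq_distr[OF N] by (subst distr_distr) (auto simp: comp_def)
  qed
  then have "W2sq (gauss m (M ** transpose M)) (gauss n (N ** transpose N))
      \<le> (\<integral>\<^sup>+ z. ennreal ((norm (fst z - snd z))\<^sup>2) \<partial>\<gamma>)"
    unfolding W2sq_def by (rule INF_lower)
  also have "\<dots> = (\<integral>\<^sup>+ z. ennreal ((norm ((m + M *v z) - (n + N *v z)))\<^sup>2) \<partial>std_gauss)"
    unfolding \<gamma>_def by (subst nn_integral_distr) auto
  also have "\<dots> = (\<integral>\<^sup>+ z. ennreal (((m - n) + (M - N) *v z) \<bullet> ((m - n) + (M - N) *v z)) \<partial>std_gauss)"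
    by (intro nn_integral_cong arg_cong[where f=ennreal])
      (simp add: power2_norm_eq_inner matrix_vector_mult_diff_rdistrib algebra_simps)
  also have "\<dots> = ennreal (LINT z|std_gauss. ((m - n) + (M - N) *v z) \<bullet> ((m - n) + (M - N) *v z))"
    by (rule nn_integral_eq_integral[OF std_gauss_affine_inner(1)]) simp
  finally show ?thesis unfolding std_gauss_affine_inner(2) .
qed

text \<open>The Fenchel-Young inequality for \<open>u \<bullet> T u / 2\<close>, whose convex
  conjugate is \<open>v \<bullet> R v / 2\<close>; it makes the dual potentials below
  admissible.\<close>

lemma young_vector_inner:
  fixes T R :: "real^'n^'n"
  assumes "spd_mat T" "T ** R = mat 1" "R ** T = mat 1"
  shows "2 * (u \<bullet> v) \<le> u \<bullet> (T *v u) + v \<bullet> (R *v v)"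
proof -
  have tT: "transpose T = T" using assms(1) by (simp add: spd_mat_def)
  have TR: "T *v (R *v v) = v" by (simp add: matrix_vector_mul_assoc assms)
  have "0 \<le> (u - R *v v) \<bullet> (T *v (u - R *v v))"
    using spd_imp_psd[OF assms(1)] by (simp add: psd_mat_def)
  also have "\<dots> = u \<bullet> (T *v u) - u \<bullet> v - (R *v v) \<bullet> (T *v u) + (R *v v) \<bullet> v"
    by (simp add: matrix_vector_mult_diff_distrib TR inner_diff_left inner_diff_right)
  also have "(R *v v) \<bullet> (T *v u) = u \<bullet> v"
    by (metis TR inner_commute inner_symmetric_matrix tT)
  finally show ?thesis by (simp add: inner_commute)
qed

text \<open>The minorant \<open>h\<close> may be negative, while \<open>ennreal\<close> cuts
  negative values off at 0; after passing to \<open>max 0 (h x)\<close> the Bochner integral and the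
  nonnegative integral agree.\<close>

lemma ennreal_integral_le_nn_integral:
  fixes h g :: "'a \<Rightarrow> real"
  assumes "integrable M h" "\<And>x. h x \<le> g x" "\<And>x. 0 \<le> g x"
  shows "ennreal (LINT x|M. h x) \<le> (\<integral>\<^sup>+x. ennreal (g x) \<partial>M)"
proof -
  have i: "integrable M (\<lambda>x. max 0 (h x))" using assms(1) by (intro integrable_max) auto
  have "ennreal (LINT x|M. h x) \<le> ennreal (LINT x|M. max 0 (h x))"
    using assms(1) i by (intro ennreal_leI integral_mono) auto
  also have "\<dots> = (\<integral>\<^sup>+x. ennreal (max 0 (h x)) \<partial>M)"
    using i by (subst nn_integral_eq_integral) auto
  also have "\<dots> \<le> (\<integral>\<^sup>+x. ennreal (g x) \<partial>M)"
    using assms by (intro nn_integral_mono ennreal_leI) auto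
  finally show ?thesis .
qed

text \<open>Kantorovich duality with the quadratic potentials that belong to the linear map \<open>T\<close>.\<close>

lemma W2sq_gauss_ge:
  fixes M T :: "real^'n^'n"
  assumes M: "invertible M" and T: "spd_mat T" and N: "N = T ** M"
  shows "ennreal ((m - n) \<bullet> (m - n) + (M - N) \<bullet> (M - N))
    \<le> W2sq (gauss m (M ** transpose M)) (gauss n (N ** transpose N))"
  unfolding W2sq_def
proof (rule INF_greatest)
  fix \<gamma> assume \<gamma>: "\<gamma> \<in> couplings (gauss m (M ** transpose M)) (gauss n (N ** transpose N))"
  obtain R where R: "T ** R = mat 1" "R ** T = mat 1" using spd_inverse[OF T] by metis
  have N_inv: "invertible N" unfolding N using invertible_mult spd_invertible[OF T] M by blast
  have RN: "R ** N = M" by (simp add: N matrix_mul_assoc R)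
  interpret prob_space \<gamma> using \<gamma> by (simp add: couplings_def)
  have s\<gamma> [measurable_cong]: "sets \<gamma> = sets (borel \<Otimes>\<^sub>M borel)"
    and d1: "distr \<gamma> borel fst = gauss m (M ** transpose M)"
    and d2: "distr \<gamma> borel snd = gauss n (N ** transpose N)"
    using \<gamma> by (auto simp: couplings_def)
  \<comment> \<open>In centred variables the quadratic parts are the potentials
    \<open>|u|\<^sup>2 - u \<bullet> T u\<close> and \<open>|v|\<^sup>2 - v \<bullet> R v\<close>;
    the linear parts account for the distance of the means and integrate to zero under the
    marginals.\<close>
  define f where "f x = (x - m) \<bullet> (2 *\<^sub>R (m - n) + (mat 1 - T) *v (x - m))" for x
  define g where "g y = (y - n) \<bullet> ((- 2) *\<^sub>R (m - n) + (mat 1 - R) *v (y - n))" for y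
  have [measurable]: "f \<in> borel_measurable borel" "g \<in> borel_measurable borel"
    unfolding f_def g_def by (intro borel_measurable_continuous_onI continuous_intros)+
  have fz: "(\<lambda>z. f (m + M *v z)) = (\<lambda>z. (0 + M *v z) \<bullet> (2 *\<^sub>R (m - n) + ((mat 1 - T) ** M) *v z))"
    by (simp add: f_def matrix_vector_mul_assoc)
  have gz: "(\<lambda>z. g (n + N *v z)) = (\<lambda>z. (0 + N *v z) \<bullet> ((- 2) *\<^sub>R (m - n) + ((mat 1 - R) ** N) *v z))"
    by (simp add: g_def matrix_vector_mul_assoc)
  have "integrable (distr \<gamma> borel fst) f \<and> integral\<^sup>L (distr \<gamma> borel fst) f = M \<bullet> ((mat 1 - T) ** M)"
    unfolding d1 gauss_eq_distr[OF M]
    by (simp add: integrable_distr_eq integral_distr) (simp only: fz std_gauss_affine_inner, simp)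
  then have f: "integrable \<gamma> (\<lambda>z. f (fst z))" "(LINT z|\<gamma>. f (fst z)) = M \<bullet> ((mat 1 - T) ** M)"
    by (simp_all add: integrable_distr_eq integral_distr)
  have "integrable (distr \<gamma> borel snd) g \<and> integral\<^sup>L (distr \<gamma> borel snd) g = N \<bullet> ((mat 1 - R) ** N)"
    unfolding d2 gauss_eq_distr[OF N_inv]
    by (simp add: integrable_distr_eq integral_distr) (simp only: gz std_gauss_affine_inner, simp)
  then have g: "integrable \<gamma> (\<lambda>z. g (snd z))" "(LINT z|\<gamma>. g (snd z)) = N \<bullet> ((mat 1 - R) ** N)"
    by (simp_all add: integrable_distr_eq integral_distr)
  \<comment> \<open>As a sum of functions of one marginal each, \<open>h\<close> has the same
    integral under every coupling; for \<open>N = T ** M\<close> that integral is the cost of the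
    linear coupling, so the bound is sharp.\<close>
  define h where "h z = (m - n) \<bullet> (m - n) + (f (fst z) + g (snd z))" for z
  have h_int: "integrable \<gamma> h" unfolding h_def using f g by simp
  have "(LINT z|\<gamma>. h z) = (m - n) \<bullet> (m - n) + (M \<bullet> ((mat 1 - T) ** M) + N \<bullet> ((mat 1 - R) ** N))"
    unfolding h_def using f g prob_space by simp
  also have "\<dots> = (m - n) \<bullet> (m - n) + (M - N) \<bullet> (M - N)"
    by (simp add: matrix_algebra RN inner_diff_left inner_diff_right inner_commute flip: N)
  finally have h: "(LINT z|\<gamma>. h z) = (m - n) \<bullet> (m - n) + (M - N) \<bullet> (M - N)" .
  have "h z \<le> (norm (fst z - snd z))\<^sup>2" for z
  proof -
    define u v where "u = fst z - m" and "v = snd z - n"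
    have "fst z - snd z = (m - n) + (u - v)" by (simp add: u_def v_def)
    then have "(norm (fst z - snd z))\<^sup>2 = (m - n) \<bullet> (m - n) + 2 * ((m - n) \<bullet> (u - v)) + u \<bullet> u + v \<bullet> v - 2 * (u \<bullet> v)"
      unfolding power2_norm_eq_inner
      by (simp only: inner_add_left inner_add_right) (simp add: inner_diff_left inner_diff_right inner_commute)
    moreover have "h z = (m - n) \<bullet> (m - n) + 2 * ((m - n) \<bullet> (u - v)) + (u \<bullet> u - u \<bullet> (T *v u)) + (v \<bullet> v - v \<bullet> (R *v v))"
      unfolding h_def f_def g_def u_def[symmetric] v_def[symmetric]
      by (simp add: matrix_vector_mult_diff_rdistrib inner_add_right inner_diff_left inner_diff_right inner_commute)
    ultimately show ?thesis using young_vector_inner[OF T R, of u v] by simp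
  qed
  from ennreal_integral_le_nn_integral[OF h_int this] h
  show "ennreal ((m - n) \<bullet> (m - n) + (M - N) \<bullet> (M - N)) \<le> (\<integral>\<^sup>+ z. ennreal ((norm (fst z - snd z))\<^sup>2) \<partial>\<gamma>)"
    by simp
qed

text \<open>For \<open>N = T ** M\<close>, with \<open>T\<close> the linear optimal map, the upper
  and the lower bound coincide. \<open>N\<close> is found relative to a given \<open>M\<close>, so
  that expansions at \<open>M\<close> can use the same standard normal.\<close>

lemma W2sq_gauss_attained:
  fixes M \<Omega> :: "real^'n^'n"
  assumes M: "spd_mat M" and \<Omega>: "spd_mat \<Omega>"
  obtains N where "invertible N" "N ** transpose N = \<Omega>"
    "W2sq (gauss m (M ** M)) (gauss n \<Omega>) = ennreal ((m - n) \<bullet> (m - n) + (M - N) \<bullet> (M - N))"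
proof -
  have tM: "transpose M = M" using M by (simp add: spd_mat_def)
  have MM: "spd_mat (M ** M)" using spd_gram[OF spd_invertible[OF M]] tM by simp
  obtain T where T: "spd_mat T" "T ** (M ** M) ** T = \<Omega>" using spd_transport_exists[OF MM \<Omega>] .
  define N where "N = T ** M"
  have N: "invertible N" unfolding N_def using invertible_mult spd_invertible T M by blast
  have NN: "N ** transpose N = \<Omega>"
    using T by (simp add: N_def matrix_transpose_mul tM spd_mat_def matrix_mul_assoc)
  show ?thesis
  proof (rule that[OF N NN])
    show "W2sq (gauss m (M ** M)) (gauss n \<Omega>) = ennreal ((m - n) \<bullet> (m - n) + (M - N) \<bullet> (M - N))"
      using W2sq_gauss_le[OF spd_invertible[OF M] N, of m n] W2sq_gauss_ge[OF spd_invertible[OF M] T(1) N_def, of m n]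
      unfolding NN tM by (rule antisym)
  qed
qed

section \<open>Smooth strongly convex potentials\<close>

text \<open>The mean value theorem, applied first in direction \<open>u\<close> and then in
  direction \<open>v\<close>. The second difference on the left is symmetric in \<open>u\<close> and
  \<open>v\<close>, which is the source of the symmetry of the Hessian.\<close>

lemma mixed_second_difference:
  fixes V :: "real^'n \<Rightarrow> real"
  assumes grad: "\<And>x. (V has_derivative (\<lambda>h. gV x \<bullet> h)) (at x)"
    and hess: "\<And>x. (gV has_derivative (\<lambda>h. HV x *v h)) (at x)"
    and t: "0 < t"
  shows "\<exists>p. norm (p - x) \<le> t * (norm u + norm v) \<and>
    V (x + t *\<^sub>R u + t *\<^sub>R v) - V (x + t *\<^sub>R u) - V (x + t *\<^sub>R v) + V x = t * t * (u \<bullet> (HV p *v v))"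
proof -
  have "((\<lambda>s. V ((x + t *\<^sub>R v) + s *\<^sub>R u) - V (x + s *\<^sub>R u)) has_real_derivative
      gV ((x + t *\<^sub>R v) + s *\<^sub>R u) \<bullet> u - gV (x + s *\<^sub>R u) \<bullet> u) (at s)" for s
    by (intro DERIV_diff has_derivative_along_line[OF grad])
  then obtain \<xi> where \<xi>: "0 < \<xi>" "\<xi> < t"
    "V ((x + t *\<^sub>R v) + t *\<^sub>R u) - V (x + t *\<^sub>R u) - (V ((x + t *\<^sub>R v) + 0 *\<^sub>R u) - V (x + 0 *\<^sub>R u))
     = (t - 0) * (gV ((x + t *\<^sub>R v) + \<xi> *\<^sub>R u) \<bullet> u - gV (x + \<xi> *\<^sub>R u) \<bullet> u)"
    using MVT2[OF t, of "\<lambda>s. V ((x + t *\<^sub>R v) + s *\<^sub>R u) - V (x + s *\<^sub>R u)"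
        "\<lambda>s. gV ((x + t *\<^sub>R v) + s *\<^sub>R u) \<bullet> u - gV (x + s *\<^sub>R u) \<bullet> u"] by blast
  have "\<And>y. ((\<lambda>y. gV y \<bullet> u) has_derivative (\<lambda>h. (HV y *v h) \<bullet> u)) (at y)"
    using hess by (rule has_derivative_inner_left)
  from has_derivative_along_line[OF this]
  have "((\<lambda>r. gV ((x + \<xi> *\<^sub>R u) + r *\<^sub>R v) \<bullet> u) has_real_derivative (HV ((x + \<xi> *\<^sub>R u) + r *\<^sub>R v) *v v) \<bullet> u) (at r)" for r .
  then obtain \<zeta> where \<zeta>: "0 < \<zeta>" "\<zeta> < t"
    "gV ((x + \<xi> *\<^sub>R u) + t *\<^sub>R v) \<bullet> u - gV ((x + \<xi> *\<^sub>R u) + 0 *\<^sub>R v) \<bullet> u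
      = (t - 0) * ((HV ((x + \<xi> *\<^sub>R u) + \<zeta> *\<^sub>R v) *v v) \<bullet> u)"
    using MVT2[OF t, of "\<lambda>r. gV ((x + \<xi> *\<^sub>R u) + r *\<^sub>R v) \<bullet> u"
        "\<lambda>r. (HV ((x + \<xi> *\<^sub>R u) + r *\<^sub>R v) *v v) \<bullet> u"] by blast
  let ?p = "(x + \<xi> *\<^sub>R u) + \<zeta> *\<^sub>R v"
  have "norm (?p - x) \<le> norm (\<xi> *\<^sub>R u) + norm (\<zeta> *\<^sub>R v)"
    using norm_triangle_ineq[of "\<xi> *\<^sub>R u" "\<zeta> *\<^sub>R v"] by simp
  also have "\<dots> \<le> t * (norm u + norm v)"
    using \<xi> \<zeta> by (simp add: distrib_left add_mono mult_right_mono)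
  finally have "norm (?p - x) \<le> t * (norm u + norm v)" .
  moreover have "V (x + t *\<^sub>R u + t *\<^sub>R v) - V (x + t *\<^sub>R u) - V (x + t *\<^sub>R v) + V x = t * t * (u \<bullet> (HV ?p *v v))"
    using \<xi>(3) \<zeta>(3) by (simp add: add_ac inner_commute)
  ultimately show ?thesis by blast
qed

text \<open>Schwarz's theorem: one second difference is a value of the Hessian form in either order
  of \<open>u\<close> and \<open>v\<close>, at points tending to \<open>x\<close>, where continuity
  applies. Symmetry must be proved because \<open>loewner_le\<close> compares quadratic forms only,
  while the spectral arguments need symmetric matrices.\<close>

lemma hessian_symmetric:
  fixes V :: "real^'n \<Rightarrow> real"
  assumes grad: "\<And>x. (V has_derivative (\<lambda>h. gV x \<bullet> h)) (at x)"
    and hess: "\<And>x. (gV has_derivative (\<lambda>h. HV x *v h)) (at x)"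
    and cont: "continuous_on UNIV HV"
  shows "transpose (HV x) = HV x"
proof -
  have sym: "u \<bullet> (HV x *v v) = v \<bullet> (HV x *v u)" for u v
  proof -
    define t where "t n = 1 / real (Suc n)" for n
    have t: "0 < t n" for n by (simp add: t_def)
    have t0: "(\<lambda>n. t n * (norm u + norm v)) \<longlonglongrightarrow> 0"
      using tendsto_mult_left_zero[OF LIMSEQ_inverse_real_of_nat] by (simp add: t_def inverse_eq_divide)
    have "\<forall>n. \<exists>p q. norm (p - x) \<le> t n * (norm u + norm v) \<and> norm (q - x) \<le> t n * (norm u + norm v)
        \<and> u \<bullet> (HV p *v v) = v \<bullet> (HV q *v u)"
    proof
      fix n
      obtain p where p: "norm (p - x) \<le> t n * (norm u + norm v)"
        "V (x + t n *\<^sub>R u + t n *\<^sub>R v) - V (x + t n *\<^sub>R u) - V (x + t n *\<^sub>R v) + V x = t n * t n * (u \<bullet> (HV p *v v))"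
        using mixed_second_difference[OF grad hess t[of n], of x u v] by blast
      obtain q where q: "norm (q - x) \<le> t n * (norm v + norm u)"
        "V (x + t n *\<^sub>R v + t n *\<^sub>R u) - V (x + t n *\<^sub>R v) - V (x + t n *\<^sub>R u) + V x = t n * t n * (v \<bullet> (HV q *v u))"
        using mixed_second_difference[OF grad hess t[of n], of x v u] by blast
      have "x + t n *\<^sub>R v + t n *\<^sub>R u = x + t n *\<^sub>R u + t n *\<^sub>R v" by simp
      then have "t n * t n * (u \<bullet> (HV p *v v)) = t n * t n * (v \<bullet> (HV q *v u))"
        using p(2) q(2) by (simp only:)
      then have "u \<bullet> (HV p *v v) = v \<bullet> (HV q *v u)" using t[of n] by simp
      then show "\<exists>p q. norm (p - x) \<le> t n * (norm u + norm v) \<and> norm (q - x) \<le> t n * (norm u + norm v)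
        \<and> u \<bullet> (HV p *v v) = v \<bullet> (HV q *v u)" using p(1) q(1) by (metis add.commute)
    qed
    then obtain p where "\<forall>n. \<exists>q. norm (p n - x) \<le> t n * (norm u + norm v) \<and> norm (q - x) \<le> t n * (norm u + norm v)
        \<and> u \<bullet> (HV (p n) *v v) = v \<bullet> (HV q *v u)"
      using choice[of "\<lambda>n p. \<exists>q. norm (p - x) \<le> t n * (norm u + norm v) \<and> norm (q - x) \<le> t n * (norm u + norm v)
        \<and> u \<bullet> (HV p *v v) = v \<bullet> (HV q *v u)"] by blast
    from choice[OF this] obtain q where pq: "\<And>n. norm (p n - x) \<le> t n * (norm u + norm v)"
        "\<And>n. norm (q n - x) \<le> t n * (norm u + norm v)"
        "\<And>n. u \<bullet> (HV (p n) *v v) = v \<bullet> (HV (q n) *v u)" by blast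
    have lim: "r \<longlonglongrightarrow> x" if "\<And>n. norm (r n - x) \<le> t n * (norm u + norm v)" for r
      using Lim_null_comparison[OF always_eventually[OF allI[OF that]] t0] by (simp add: LIM_zero_cancel)
    have contb: "continuous (at y) (\<lambda>y. a \<bullet> (HV y *v b))" for a b y
    proof -
      have "linear (\<lambda>X :: real^'n^'n. a \<bullet> (X *v b))"
        by (rule linearI) (simp_all add: matrix_vector_mult_add_rdistrib inner_add_right scaleR_matrix_vector_assoc[symmetric])
      then have "continuous_on UNIV (\<lambda>X :: real^'n^'n. a \<bullet> (X *v b))" by (simp add: linear_continuous_on linear_conv_bounded_linear)
      then have "continuous_on UNIV (\<lambda>y. a \<bullet> (HV y *v b))" by (rule continuous_on_compose2[OF _ cont]) auto
      then show ?thesis by (simp add: continuous_on_eq_continuous_at)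
    qed
    have "(\<lambda>n. u \<bullet> (HV (p n) *v v)) \<longlonglongrightarrow> u \<bullet> (HV x *v v)"
      using isCont_tendsto_compose[OF contb lim[OF pq(1)]] .
    moreover have "(\<lambda>n. v \<bullet> (HV (q n) *v u)) \<longlonglongrightarrow> v \<bullet> (HV x *v u)"
      using isCont_tendsto_compose[OF contb lim[OF pq(2)]] .
    ultimately show ?thesis unfolding pq(3) by (rule LIMSEQ_unique)
  qed
  have "HV x $ i $ j = HV x $ j $ i" for i j
    using sym[of "axis i 1" "axis j 1"]
    by (simp add: matrix_vector_mult_basis inner_axis' column_def)
  then show ?thesis by (simp add: transpose_def vec_eq_iff)
qed

lemma taylor_second_order:
  fixes V :: "real^'n \<Rightarrow> real"
  assumes grad: "\<And>x. (V has_derivative (\<lambda>h. gV x \<bullet> h)) (at x)"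
    and hess: "\<And>x. (gV has_derivative (\<lambda>h. HV x *v h)) (at x)"
  shows "\<exists>p. V (x + h) = V x + gV x \<bullet> h + (h \<bullet> (HV p *v h)) / 2"
proof -
  define diff where "diff k t = (if k = 0 then V (x + t *\<^sub>R h) else if k = 1 then gV (x + t *\<^sub>R h) \<bullet> h
    else (HV (x + t *\<^sub>R h) *v h) \<bullet> h)" for k :: nat and t
  have "\<And>y. ((\<lambda>y. gV y \<bullet> h) has_derivative (\<lambda>k. (HV y *v k) \<bullet> h)) (at y)"
    using hess by (rule has_derivative_inner_left)
  note d2 = has_derivative_along_line[OF this] and d1 = has_derivative_along_line[OF grad]
  have "\<forall>m t. m < 2 \<and> 0 \<le> t \<and> t \<le> 1 \<longrightarrow> DERIV (diff m) t :> diff (Suc m) t"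
    using d1 d2 by (auto simp: diff_def[abs_def] less_2_cases_iff)
  then obtain t where "diff 0 1 = (\<Sum>m<2. (diff m 0 / fact m) * (1 - 0)^m) + (diff 2 t / fact 2) * (1 - 0)^2"
    using Taylor_up[of 2 diff "diff 0" 0 1 0] by auto
  then have "V (x + h) = V x + gV x \<bullet> h + (h \<bullet> (HV (x + t *\<^sub>R h) *v h)) / 2"
    by (simp add: diff_def numeral_2_eq_2 inner_commute)
  then show ?thesis by blast
qed

text \<open>The eigenvalues lie between 0 and \<open>b\<close>, and the squared Frobenius norm is
  the sum of their squares. For the Hessian this is the uniform bound behind the linear growth of
  the gradient.\<close>

lemma norm_psd_le:
  fixes H :: "real^'n^'n"
  assumes "psd_mat H" "\<And>v. v \<bullet> (H *v v) \<le> b * (v \<bullet> v)" "0 \<le> b"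
  shows "norm H \<le> sqrt (real CARD('n) * b\<^sup>2)"
proof -
  obtain P d where P: "orthogonal_matrix P" "H = spec P d" "\<And>i. 0 \<le> d i"
    using psd_diagonalization[OF assms(1)] by blast
  have d: "d i \<le> b" for i
  proof -
    let ?u = "P *v axis i 1"
    have "?u \<bullet> ?u = 1" using inner_spec_column(1)[OF P(1), of i "\<lambda>_. 1"] by (simp add: spec_one[OF P(1)])
    then show ?thesis using assms(2)[of ?u] inner_spec_column(1)[OF P(1), of i d] P(2) by simp
  qed
  have "H \<bullet> H = trace (spec P d ** spec P d)" unfolding P(2) matrix_inner_eq_trace by simp
  also have "\<dots> = (\<Sum>i\<in>UNIV. d i * d i)" by (simp add: spec_mult[OF P(1)] trace_spec[OF P(1)])
  also have "\<dots> \<le> (\<Sum>i\<in>(UNIV::'n set). b * b)" using d P(3) assms(3) by (intro sum_mono mult_mono) auto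
  finally show ?thesis unfolding norm_eq_sqrt_inner by (simp add: power2_eq_square)
qed

lemma norm_matrix_vector_le:
  fixes A :: "real^'n^'m"
  shows "norm (A *v x) \<le> norm A * norm x"
proof -
  have "(A *v x) \<bullet> (A *v x) = (\<Sum>i\<in>UNIV. (A$i \<bullet> x)\<^sup>2)"
    by (simp add: inner_vec_def[of "A *v x"] matrix_vector_mul_component power2_eq_square)
  also have "\<dots> \<le> (\<Sum>i\<in>UNIV. (A$i \<bullet> A$i) * (x \<bullet> x))" by (intro sum_mono Cauchy_Schwarz_ineq)
  also have "\<dots> = (A \<bullet> A) * (x \<bullet> x)" by (simp add: inner_vec_def[of A] sum_distrib_right)
  finally have "(norm (A *v x))\<^sup>2 \<le> (norm A * norm x)\<^sup>2"
    by (simp add: power_mult_distrib power2_norm_eq_inner)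
  then show ?thesis by (rule power2_le_imp_le) simp
qed

lemma norm_affine_le:
  fixes K :: "real^'n^'m"
  shows "norm (m + K *v z) \<le> (norm m + norm K) * (1 + norm z)"
proof -
  have "norm (m + K *v z) \<le> norm m + norm K * norm z"
    using norm_triangle_ineq[of m "K *v z"] norm_matrix_vector_le[of K z] by linarith
  also have "\<dots> \<le> (norm m + norm K) * (1 + norm z)" by (simp add: algebra_simps)
  finally show ?thesis .
qed

lemma one_plus_square_le: "0 \<le> (r::real) \<Longrightarrow> (1 + r)\<^sup>2 \<le> 2 * (1 + r\<^sup>2)"
  using zero_le_power2[of "1 - r"] by (simp add: power2_eq_square algebra_simps)

section \<open>Averages of a smooth strongly convex potential over Gaussians\<close>

locale smooth_potential =
  fixes V :: "real^'n \<Rightarrow> real" and gV :: "real^'n \<Rightarrow> real^'n" and HV :: "real^'n \<Rightarrow> real^'n^'n"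
    and \<alpha> \<beta> :: real
  assumes grad: "\<And>x. (V has_derivative (\<lambda>h. gV x \<bullet> h)) (at x)"
    and hess: "\<And>x. (gV has_derivative (\<lambda>h. HV x *v h)) (at x)"
    and hess_cont: "continuous_on UNIV HV"
    and alpha_pos: "0 < \<alpha>" and alpha_le_beta: "\<alpha> \<le> \<beta>"
    and hess_lower: "\<And>x h. \<alpha> * (h \<bullet> h) \<le> h \<bullet> (HV x *v h)"
    and hess_upper: "\<And>x h. h \<bullet> (HV x *v h) \<le> \<beta> * (h \<bullet> h)"
begin

lemma beta_pos: "0 < \<beta>" using alpha_pos alpha_le_beta by simp

lemma hess_psd: "psd_mat (HV x)"
  unfolding psd_mat_def using hessian_symmetric[OF grad hess hess_cont] hess_lower alpha_pos
  by (meson inner_ge_zero less_imp_le mult_nonneg_nonneg order_trans)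

definition hess_bound where "hess_bound = sqrt (real CARD('n) * \<beta>\<^sup>2)"

lemma hess_bound: "norm (HV x) \<le> hess_bound"
  unfolding hess_bound_def using norm_psd_le[OF hess_psd hess_upper] beta_pos by simp

lemma hess_bound_nonneg: "0 \<le> hess_bound"
  by (simp add: hess_bound_def)

lemma continuous_V: "continuous_on UNIV V" and continuous_gV: "continuous_on UNIV gV"
  by (intro continuous_at_imp_continuous_on ballI has_derivative_continuous[OF grad] has_derivative_continuous[OF hess])+

lemma measurable_potential [measurable]:
  "V \<in> borel_measurable borel" "gV \<in> borel_measurable borel" "HV \<in> borel_measurable borel"
  using continuous_V continuous_gV hess_cont by (auto intro: borel_measurable_continuous_onI)

lemma grad_growth: "norm (gV x) \<le> (norm (gV 0) + hess_bound) * (1 + norm x)"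
proof -
  have "norm (gV x - gV 0) \<le> hess_bound * norm (x - 0)"
  proof (rule differentiable_bound[of UNIV gV "\<lambda>x h. HV x *v h"])
    show "\<And>x. x \<in> UNIV \<Longrightarrow> (gV has_derivative (*v) (HV x)) (at x within UNIV)" using hess by simp
    show "\<And>x. x \<in> UNIV \<Longrightarrow> onorm ((*v) (HV x)) \<le> hess_bound"
      by (intro onorm_bound hess_bound_nonneg)
        (metis hess_bound mult_right_mono norm_ge_zero norm_matrix_vector_le order_trans)
  qed auto
  then have "norm (gV x) \<le> norm (gV 0) + hess_bound * norm x"
    using norm_triangle_ineq2[of "gV x" "gV 0"] by simp
  also have "\<dots> \<le> (norm (gV 0) + hess_bound) * (1 + norm x)"
    using hess_bound_nonneg by (simp add: algebra_simps)
  finally show ?thesis .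
qed

lemma V_lower: "V x + gV x \<bullet> h + \<alpha> / 2 * (h \<bullet> h) \<le> V (x + h)"
  and V_upper: "V (x + h) \<le> V x + gV x \<bullet> h + \<beta> / 2 * (h \<bullet> h)"
  using taylor_second_order[OF grad hess, of x h] hess_lower[of h] hess_upper[of h]
  by (auto simp: field_simps)

lemma V_growth: "\<bar>V x\<bar> \<le> (\<bar>V 0\<bar> + norm (gV 0) + \<beta>) * (1 + norm x)\<^sup>2"
proof -
  have "\<bar>gV 0 \<bullet> x\<bar> \<le> norm (gV 0) * norm x" by (rule Cauchy_Schwarz_ineq2)
  moreover have "0 \<le> \<alpha> / 2 * (x \<bullet> x)" using alpha_pos by simp
  moreover have "\<beta> / 2 * (x \<bullet> x) \<le> \<beta> * (norm x)\<^sup>2" using beta_pos by (simp add: power2_norm_eq_inner)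
  ultimately have "\<bar>V x\<bar> \<le> \<bar>V 0\<bar> + norm (gV 0) * norm x + \<beta> * (norm x)\<^sup>2"
    using V_lower[of 0 x] V_upper[of 0 x] by simp
  also have "\<dots> \<le> \<bar>V 0\<bar> * (1 + norm x)\<^sup>2 + norm (gV 0) * (1 + norm x)\<^sup>2 + \<beta> * (1 + norm x)\<^sup>2"
  proof (intro add_mono mult_left_mono)
    have "1 \<le> (1 + norm x)\<^sup>2" by (rule one_le_power) simp
    then show "\<bar>V 0\<bar> \<le> \<bar>V 0\<bar> * (1 + norm x)\<^sup>2" using mult_left_mono[of 1 "(1 + norm x)\<^sup>2" "\<bar>V 0\<bar>"] by simp
    have "norm x * 1 \<le> (1 + norm x) * (1 + norm x)" by (intro mult_mono) auto
    then show "norm x \<le> (1 + norm x)\<^sup>2" by (simp add: power2_eq_square)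
    show "(norm x)\<^sup>2 \<le> (1 + norm x)\<^sup>2" by (rule power_mono) auto
  qed (use beta_pos in auto)
  finally show ?thesis by (simp add: algebra_simps)
qed

lemma integrable_V_affine:
  fixes K :: "real^'n^'n"
  shows "integrable std_gauss (\<lambda>z. V (m + K *v z))"
proof -
  define c where "c = \<bar>V 0\<bar> + norm (gV 0) + \<beta>"
  define B where "B = 1 + norm m + norm K"
  have c: "0 \<le> c" using beta_pos by (simp add: c_def)
  show ?thesis
  proof (rule integrable_std_gauss[where C="c * B\<^sup>2 * 2"])
    fix z
    have "1 + norm (m + K *v z) \<le> B * (1 + norm z)"
    proof -
      have "B * (1 + norm z) = (1 + norm z) + (norm m + norm K) * (1 + norm z)"
        by (simp add: B_def algebra_simps)
      then show ?thesis using norm_affine_le[of m K z] norm_ge_zero[of z] by linarith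
    qed
    then have "(1 + norm (m + K *v z))\<^sup>2 \<le> (B * (1 + norm z))\<^sup>2" by (intro power_mono) auto
    also have "\<dots> \<le> B\<^sup>2 * (2 * (1 + (norm z)\<^sup>2))"
      unfolding power_mult_distrib by (intro mult_left_mono one_plus_square_le) auto
    finally have "c * (1 + norm (m + K *v z))\<^sup>2 \<le> c * (B\<^sup>2 * (2 * (1 + (norm z)\<^sup>2)))"
      using c by (rule mult_left_mono)
    also have "c * (B\<^sup>2 * (2 * (1 + (norm z)\<^sup>2))) = c * B\<^sup>2 * 2 * (1 + z \<bullet> z)"
      by (simp only: power2_norm_eq_inner mult.assoc)
    finally show "norm (V (m + K *v z)) \<le> c * B\<^sup>2 * 2 * (1 + z \<bullet> z)"
      using V_growth[of "m + K *v z", folded c_def] unfolding real_norm_def by (rule order_trans[rotated])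
  qed simp
qed

lemma grad_affine_growth:
  obtains C where "0 \<le> C" "\<And>z. norm (gV (m + M *v z)) \<le> C * (1 + norm z)"
proof -
  define B where "B = 1 + norm m + norm M"
  define c where "c = norm (gV 0) + hess_bound"
  have c: "0 \<le> c" using hess_bound_nonneg by (simp add: c_def)
  have "norm (gV (m + M *v z)) \<le> (c * B) * (1 + norm z)" for z
  proof -
    have "1 + norm (m + M *v z) \<le> B * (1 + norm z)"
    proof -
      have "B * (1 + norm z) = (1 + norm z) + (norm m + norm M) * (1 + norm z)"
        by (simp add: B_def algebra_simps)
      then show ?thesis using norm_affine_le[of m M z] norm_ge_zero[of z] by linarith
    qed
    then have "c * (1 + norm (m + M *v z)) \<le> c * (B * (1 + norm z))" using c by (rule mult_left_mono)
    then show ?thesis using grad_growth[of "m + M *v z"] by (simp add: c_def mult.assoc)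
  qed
  moreover have "0 \<le> c * B" using c by (simp add: B_def)
  ultimately show ?thesis using that by blast
qed

lemma integrable_grad_affine:
  fixes M :: "real^'n^'n"
  shows "integrable std_gauss (\<lambda>z. gV (m + M *v z))"
proof -
  obtain C where C: "0 \<le> C" "\<And>z. norm (gV (m + M *v z)) \<le> C * (1 + norm z)"
    using grad_affine_growth by blast
  show ?thesis
  proof (rule integrable_std_gauss[where C="2 * C"])
    fix z :: "real^'n"
    have "1 + norm z \<le> 2 * (1 + z \<bullet> z)" by (rule one_plus_norm_le)
    from order_trans[OF C(2) mult_left_mono[OF this C(1)]]
    show "norm (gV (m + M *v z)) \<le> 2 * C * (1 + z \<bullet> z)" by (simp add: mult_ac)
  qed simp
qed

lemma integrable_hess_affine:
  fixes M :: "real^'n^'n"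
  shows "integrable std_gauss (\<lambda>z. HV (m + M *v z))"
proof (rule integrable_std_gauss[where C=hess_bound])
  fix z :: "real^'n"
  have "hess_bound * 1 \<le> hess_bound * (1 + z \<bullet> z)" by (intro mult_left_mono hess_bound_nonneg) auto
  then show "norm (HV (m + M *v z)) \<le> hess_bound * (1 + z \<bullet> z)" using hess_bound order_trans by fastforce
qed simp

text \<open>Stein's identity for \<open>\<lambda>z. gV (m + M *v z) \<bullet> a\<close>: by the
  chain rule its derivative in direction \<open>e\<close> is the Hessian applied to
  \<open>M *v e\<close>, and averaging leaves the mean Hessian \<open>S\<close>. Linear growth of
  the gradient keeps the product with \<open>z \<bullet> e\<close> within quadratic growth.\<close>

lemma stein_gradient_inner:
  fixes M :: "real^'n^'n" and m :: "real^'n"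
  defines "S \<equiv> LINT z|std_gauss. HV (m + M *v z)"
  shows "integrable std_gauss (\<lambda>z. (gV (m + M *v z) \<bullet> a) * (z \<bullet> e))"
    and "(LINT z|std_gauss. (gV (m + M *v z) \<bullet> a) * (z \<bullet> e)) = ((S ** M) *v e) \<bullet> a"
proof -
  obtain C where C: "0 \<le> C" "\<And>z. norm (gV (m + M *v z)) \<le> C * (1 + norm z)"
    using grad_affine_growth by blast
  \<comment> \<open>One summand for each of the three growth conditions of
    \<open>stein_identity\<close>.\<close>
  define C' where "C' = 2 * C * norm a + 2 * C * norm a * norm e + hess_bound * norm (M *v e) * norm a"
  have nn: "0 \<le> 2 * C * norm a" "0 \<le> 2 * C * norm a * norm e" "0 \<le> hess_bound * norm (M *v e) * norm a"
    using C(1) hess_bound_nonneg by auto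
  have g: "\<bar>gV (m + M *v z) \<bullet> a\<bar> \<le> C * norm a * (1 + norm z)" for z
  proof -
    have "\<bar>gV (m + M *v z) \<bullet> a\<bar> \<le> norm (gV (m + M *v z)) * norm a" by (rule Cauchy_Schwarz_ineq2)
    also have "\<dots> \<le> C * (1 + norm z) * norm a" by (intro mult_right_mono C) simp
    finally show ?thesis by (simp add: mult_ac)
  qed
  have b1: "\<bar>gV (m + M *v z) \<bullet> a\<bar> \<le> C' * (1 + z \<bullet> z)" for z :: "real^'n"
  proof -
    have "1 + norm z \<le> 2 * (1 + z \<bullet> z)" by (rule one_plus_norm_le)
    then have "C * norm a * (1 + norm z) \<le> C * norm a * (2 * (1 + z \<bullet> z))"
      using C(1) by (intro mult_left_mono) auto
    also have "\<dots> = 2 * C * norm a * (1 + z \<bullet> z)" by simp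
    also have "\<dots> \<le> C' * (1 + z \<bullet> z)" using nn unfolding C'_def by (intro mult_right_mono) auto
    finally show ?thesis using g[of z] by simp
  qed
  have b2: "\<bar>(gV (m + M *v z) \<bullet> a) * (z \<bullet> e)\<bar> \<le> C' * (1 + z \<bullet> z)" for z
  proof -
    have "\<bar>(gV (m + M *v z) \<bullet> a) * (z \<bullet> e)\<bar> \<le> (C * norm a * (1 + norm z)) * (norm z * norm e)"
      unfolding abs_mult using C(1) by (intro mult_mono g Cauchy_Schwarz_ineq2) auto
    also have "\<dots> = C * norm a * norm e * ((1 + norm z) * norm z)" by simp
    also have "\<dots> \<le> C * norm a * norm e * (2 * (1 + z \<bullet> z))"
    proof (rule mult_left_mono)
      have "(1 + norm z) * norm z \<le> (1 + norm z)\<^sup>2" by (simp add: power2_eq_square mult_left_mono)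
      then show "(1 + norm z) * norm z \<le> 2 * (1 + z \<bullet> z)"
        using one_plus_square_le[of "norm z"] by (simp add: power2_norm_eq_inner)
    qed (use C(1) in auto)
    also have "\<dots> = 2 * C * norm a * norm e * (1 + z \<bullet> z)" by simp
    also have "\<dots> \<le> C' * (1 + z \<bullet> z)" using nn unfolding C'_def by (intro mult_right_mono) auto
    finally show ?thesis .
  qed
  have b3: "\<bar>(HV (m + M *v z) *v (M *v e)) \<bullet> a\<bar> \<le> C' * (1 + z \<bullet> z)" for z
  proof -
    have "\<bar>(HV (m + M *v z) *v (M *v e)) \<bullet> a\<bar> \<le> norm (HV (m + M *v z) *v (M *v e)) * norm a"
      by (rule Cauchy_Schwarz_ineq2)
    also have "\<dots> \<le> (norm (HV (m + M *v z)) * norm (M *v e)) * norm a"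
      by (intro mult_right_mono norm_matrix_vector_le) auto
    also have "\<dots> \<le> (hess_bound * norm (M *v e)) * norm a" by (intro mult_right_mono hess_bound) auto
    also have "\<dots> \<le> C' * 1" using nn unfolding C'_def by simp
    also have "\<dots> \<le> C' * (1 + z \<bullet> z)" using nn unfolding C'_def by (intro mult_left_mono) auto
    finally show ?thesis .
  qed
  have der: "((\<lambda>z. gV (m + M *v z) \<bullet> a) has_derivative (\<lambda>h. (HV (m + M *v z) *v (M *v h)) \<bullet> a)) (at z)" for z
  proof (rule has_derivative_inner_left)
    have "((\<lambda>z. m + M *v z) has_derivative (\<lambda>h. M *v h)) (at z)"
      by (auto intro!: derivative_eq_intros bounded_linear_imp_has_derivative simp: linear_conv_bounded_linear[symmetric])
    from has_derivative_compose[OF this hess]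
    show "((\<lambda>z. gV (m + M *v z)) has_derivative (\<lambda>h. HV (m + M *v z) *v (M *v h))) (at z)" .
  qed
  show "integrable std_gauss (\<lambda>z. (gV (m + M *v z) \<bullet> a) * (z \<bullet> e))"
    by (rule integrable_std_gauss[where C=C']) (use b2 in \<open>auto simp: real_norm_def\<close>)
  have "(LINT z|std_gauss. (gV (m + M *v z) \<bullet> a) * (z \<bullet> e)) = (LINT z|std_gauss. (HV (m + M *v z) *v (M *v e)) \<bullet> a)"
    by (rule stein_identity[where C=C', OF der b1 b3 b2])
  also have "\<dots> = (S *v (M *v e)) \<bullet> a"
  proof -
    have "linear (\<lambda>X :: real^'n^'n. (X *v (M *v e)) \<bullet> a)"
      by (rule linearI) (simp_all add: matrix_vector_mult_add_rdistrib inner_add_left scaleR_matrix_vector_assoc[symmetric])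
    from integral_bounded_linear[OF this[unfolded linear_conv_bounded_linear] integrable_hess_affine[of m M]]
    show ?thesis unfolding S_def .
  qed
  finally show "(LINT z|std_gauss. (gV (m + M *v z) \<bullet> a) * (z \<bullet> e)) = ((S ** M) *v e) \<bullet> a"
    by (simp add: matrix_vector_mul_assoc)
qed

text \<open>\<open>D *v z\<close> is the combination of the columns of \<open>D\<close> with
  coefficients \<open>z \<bullet> axis j 1\<close>; each column is a case of
  \<open>stein_gradient_inner\<close>.\<close>

lemma stein_gradient:
  fixes M D :: "real^'n^'n" and m :: "real^'n"
  defines "S \<equiv> LINT z|std_gauss. HV (m + M *v z)"
  shows "integrable std_gauss (\<lambda>z. gV (m + M *v z) \<bullet> (D *v z))"
    and "(LINT z|std_gauss. gV (m + M *v z) \<bullet> (D *v z)) = D \<bullet> (S ** M)"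
proof -
  have *: "g \<bullet> (D *v z) = (\<Sum>j\<in>UNIV. (g \<bullet> column j D) * (z \<bullet> axis j 1))" for g z :: "real^'n"
    unfolding matrix_mult_sum by (simp add: inner_sum_right inner_axis scalar_mult_eq_scaleR mult.commute)
  show "integrable std_gauss (\<lambda>z. gV (m + M *v z) \<bullet> (D *v z))"
    unfolding * by (intro Bochner_Integration.integrable_sum stein_gradient_inner(1))
  have "(LINT z|std_gauss. gV (m + M *v z) \<bullet> (D *v z)) = (\<Sum>j\<in>UNIV. ((S ** M) *v axis j 1) \<bullet> column j D)"
    unfolding * S_def by (subst Bochner_Integration.integral_sum) (auto simp: stein_gradient_inner)
  also have "\<dots> = (\<Sum>j\<in>UNIV. \<Sum>i\<in>UNIV. (S ** M)$i$j * D$i$j)"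
    by (simp add: matrix_vector_mult_basis inner_vec_def column_def)
  also have "\<dots> = (S ** M) \<bullet> D" unfolding matrix_inner_sum by (rule sum.swap)
  finally show "(LINT z|std_gauss. gV (m + M *v z) \<bullet> (D *v z)) = D \<bullet> (S ** M)" by (simp add: inner_commute)
qed

lemma potential_en_eq:
  fixes K :: "real^'n^'n"
  shows "invertible K \<Longrightarrow> potential_en V m (K ** transpose K) = (LINT z|std_gauss. V (m + K *v z))"
  using gauss_exp_eq[of K V m] by (simp add: potential_en_def gauss_exp_def)

text \<open>Integrate the two Taylor bounds of \<open>V\<close> between the coupled points
  \<open>m + M z\<close> and \<open>c + K z\<close>; Stein's identity turns the first-order term
  into \<open>(K - M) \<bullet> (S ** M)\<close>. The lower bound is used with an exactly optimal
  factor in place of \<open>K\<close>, the upper bound with a nearly optimal one.\<close>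

lemma potential_expansion:
  fixes K M :: "real^'n^'n" and c m :: "real^'n"
  assumes K: "invertible K" and M: "invertible M"
  defines "b \<equiv> gauss_exp m (M ** transpose M) gV" and "S \<equiv> gauss_exp m (M ** transpose M) HV"
  defines "R \<equiv> potential_en V c (K ** transpose K) - potential_en V m (M ** transpose M)
    - (c - m) \<bullet> b - (K - M) \<bullet> (S ** M)"
  defines "q \<equiv> (c - m) \<bullet> (c - m) + (K - M) \<bullet> (K - M)"
  shows "\<alpha> / 2 * q \<le> R" "R \<le> \<beta> / 2 * q"
proof -
  have b: "b = (LINT z|std_gauss. gV (m + M *v z))" and S: "S = (LINT z|std_gauss. HV (m + M *v z))"
    unfolding b_def S_def by (simp_all add: gauss_exp_eq[OF M])
  let ?h = "\<lambda>z. (c - m) + (K - M) *v z"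
  define r where "r z = V (c + K *v z) - V (m + M *v z) - gV (m + M *v z) \<bullet> (c - m) - gV (m + M *v z) \<bullet> ((K - M) *v z)" for z
  have int: "integrable std_gauss (\<lambda>z. gV (m + M *v z) \<bullet> (c - m))"
    "(LINT z|std_gauss. gV (m + M *v z) \<bullet> (c - m)) = b \<bullet> (c - m)"
    using integrable_grad_affine[of m M] unfolding b by simp_all
  note ints = integrable_V_affine int stein_gradient[of m M "K - M"]
  have ri: "integrable std_gauss r" unfolding r_def by (intro Bochner_Integration.integrable_diff ints)
  have rR: "(LINT z|std_gauss. r z) = R"
    unfolding r_def R_def potential_en_eq[OF K] potential_en_eq[OF M] S
    by (simp add: ints inner_commute[of "c - m" b])
  note q = std_gauss_affine_inner[of "c - m" "K - M" "c - m" "K - M", folded q_def]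
  have split: "c + K *v z = (m + M *v z) + ?h z" for z
    by (simp add: matrix_vector_mult_diff_rdistrib)
  have lo: "\<alpha> / 2 * (?h z \<bullet> ?h z) \<le> r z" and hi: "r z \<le> \<beta> / 2 * (?h z \<bullet> ?h z)" for z
    using V_lower[of "m + M *v z" "?h z"] V_upper[of "m + M *v z" "?h z"]
    unfolding r_def split[of z] by (simp_all add: inner_add_right)
  have "\<alpha> / 2 * q = (LINT z|std_gauss. \<alpha> / 2 * (?h z \<bullet> ?h z))" using q by simp
  also have "\<dots> \<le> R" unfolding rR[symmetric] using q ri lo by (intro integral_mono integrable_mult_right) auto
  finally show "\<alpha> / 2 * q \<le> R" .
  have "R \<le> (LINT z|std_gauss. \<beta> / 2 * (?h z \<bullet> ?h z))"
    unfolding rR[symmetric] using q ri hi by (intro integral_mono integrable_mult_right) auto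
  also have "\<dots> = \<beta> / 2 * q" using q by simp
  finally show "R \<le> \<beta> / 2 * q" .
qed

text \<open>Symmetry and the upper bound are linear conditions on the matrix and survive averaging.
  They make \<open>I - \<eta> S\<close> symmetric and positive semidefinite for
  \<open>\<eta> \<le> 1 / \<beta>\<close>.\<close>

lemma mean_hessian:
  fixes M :: "real^'n^'n" and m :: "real^'n"
  assumes M: "invertible M"
  defines "S \<equiv> gauss_exp m (M ** transpose M) HV"
  shows "transpose S = S" "h \<bullet> (S *v h) \<le> \<beta> * (h \<bullet> h)"
proof -
  interpret prob_space "std_gauss :: (real^'n) measure" by (rule prob_space_std_gauss)
  have S: "S = (LINT z|std_gauss. HV (m + M *v z))"
    unfolding S_def by (simp add: gauss_exp_eq[OF M])
  note int = integrable_hess_affine[of m M]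
  have "linear (transpose :: real^'n^'n \<Rightarrow> _)" by (rule linearI) (simp_all add: transpose_add transpose_scalar)
  from integral_bounded_linear[OF this[unfolded linear_conv_bounded_linear] int]
  show "transpose S = S" unfolding S using hess_psd by (simp add: psd_mat_def)
  have "linear (\<lambda>X :: real^'n^'n. h \<bullet> (X *v h))"
    by (rule linearI) (simp_all add: matrix_vector_mult_add_rdistrib inner_add_right scaleR_matrix_vector_assoc[symmetric])
  then have bl: "bounded_linear (\<lambda>X :: real^'n^'n. h \<bullet> (X *v h))" by (simp add: linear_conv_bounded_linear)
  have "h \<bullet> (S *v h) = (LINT z|std_gauss. h \<bullet> (HV (m + M *v z) *v h))"
    unfolding S using integral_bounded_linear[OF bl int] by simp
  also have "\<dots> \<le> (LINT z|(std_gauss :: (real^'n) measure). \<beta> * (h \<bullet> h))"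
    using integrable_bounded_linear[OF bl int] hess_upper by (intro integral_mono) auto
  finally show "h \<bullet> (S *v h) \<le> \<beta> * (h \<bullet> h)" using prob_space by simp
qed

end

section \<open>Contraction of the iteration\<close>

text \<open>\<open>enn2real\<close> sends infinity to 0, so real inequalities speak about
  \<open>W2sq\<close> only once it is known to be finite; the coupling through symmetric square
  roots shows that it is.\<close>

lemma W2sq_gauss_finite:
  fixes \<Sigma> \<Omega> :: "real^'n^'n"
  assumes "spd_mat \<Sigma>" "spd_mat \<Omega>"
  shows "W2sq (gauss m \<Sigma>) (gauss n \<Omega>) = ennreal (enn2real (W2sq (gauss m \<Sigma>) (gauss n \<Omega>)))"
proof -
  obtain M where M: "spd_mat M" "M ** M = \<Sigma>" using spd_sqrt_exists[OF assms(1)] .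
  obtain N where N: "spd_mat N" "N ** N = \<Omega>" using spd_sqrt_exists[OF assms(2)] .
  have "transpose M = M" "transpose N = N" using M N by (simp_all add: spd_mat_def)
  then have "W2sq (gauss m \<Sigma>) (gauss n \<Omega>) \<le> ennreal ((m - n) \<bullet> (m - n) + (M - N) \<bullet> (M - N))"
    using W2sq_gauss_le[OF spd_invertible[OF M(1)] spd_invertible[OF N(1)], of m n] M(2) N(2) by simp
  then have "W2sq (gauss m \<Sigma>) (gauss n \<Omega>) < top" using ennreal_less_top le_less_trans by blast
  then show ?thesis by simp
qed

lemma W2sq_gauss_self:
  fixes \<Sigma> :: "real^'n^'n"
  assumes "spd_mat \<Sigma>"
  shows "W2sq (gauss m \<Sigma>) (gauss m \<Sigma>) = 0"
proof -
  obtain M where M: "spd_mat M" "M ** M = \<Sigma>" using spd_sqrt_exists[OF assms] .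
  have "transpose M = M" using M by (simp add: spd_mat_def)
  then show ?thesis
    using W2sq_gauss_le[OF spd_invertible[OF M(1)] spd_invertible[OF M(1)], of m m] M(2) by simp
qed

text \<open>\<open>Q ** B\<close> carries \<open>M\<close> to \<open>J\<close>, and the entropy
  difference is the logarithm of its determinant, linearised by \<open>ln_det_le_trace\<close>. In
  the application, up to \<delta>, \<open>B\<close> leads back to the half step and \<open>Q\<close>
  on to the comparison Gaussian: this is convexity of the entropy along a generalised geodesic based
  at the half step.\<close>

lemma entropy_difference_le:
  fixes M Q B J :: "real^'n^'n"
  assumes M: "spd_mat M" and Q: "spd_mat Q" and B: "spd_mat B" and J: "J = Q ** B ** M"
  shows "entropy_gauss m (M ** M) - entropy_gauss n (J ** transpose J) \<le> trace (Q ** B) - CARD('n)"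
proof -
  have tM: "transpose M = M" using M by (simp add: spd_mat_def)
  have invJ: "invertible J" unfolding J by (intro invertible_mult spd_invertible assms)
  have pos: "0 < det (Q ** B)" "0 < det M"
    using spd_det_pos[OF M] spd_det_pos[OF Q] spd_det_pos[OF B] by (simp_all add: det_mul)
  have "entropy_gauss m (M ** M) - entropy_gauss n (J ** transpose J) = ln \<bar>det J\<bar> - ln \<bar>det M\<bar>"
    using entropy_gauss_eq[OF spd_invertible[OF M], of m] entropy_gauss_eq[OF invJ, of n] tM by simp
  also have "\<dots> = ln (det (Q ** B))"
    using pos by (simp add: J det_mul[of "Q ** B"] abs_mult ln_mult)
  also have "\<dots> \<le> trace (Q ** B) - CARD('n)" by (rule ln_det_le_trace[OF Q B])
  finally show ?thesis .
qed

context smooth_potential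
begin

text \<open>Means and covariances separate. The means perform a gradient descent step. For the
  covariances, the near-optimality of \<open>K\<close> and \<open>J\<close> supplies the two
  comparisons after which all mixed terms cancel, up to an error of order \<delta>.\<close>

lemma fb_step_contraction:
  fixes \<Sigma> \<Omega> :: "real^'n^'n" and m n :: "real^'n"
  assumes \<Sigma>: "spd_mat \<Sigma>" and \<Omega>: "spd_mat \<Omega>" and \<eta>: "0 < \<eta>" "\<eta> \<le> 1 / \<beta>"
    and step: "fb_step gV HV \<eta> (m, \<Sigma>) = (m', \<Sigma>')"
  shows "spd_mat \<Sigma>'"
    and "enn2real (W2sq (gauss m' \<Sigma>') (gauss n \<Omega>)) + 2 * \<eta> * (free_en V m' \<Sigma>' - free_en V n \<Omega>)
      \<le> (1 - \<alpha> * \<eta>) * enn2real (W2sq (gauss m \<Sigma>) (gauss n \<Omega>))"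
proof -
  have \<eta>\<beta>: "\<eta> * \<beta> \<le> 1" using \<eta> beta_pos by (simp add: field_simps)
  obtain M where M: "spd_mat M" "M ** M = \<Sigma>" using spd_sqrt_exists[OF \<Sigma>] .
  have tM: "transpose M = M" using M by (simp add: spd_mat_def)
  note Minv = spd_invertible[OF M(1)]
  define b where "b = gauss_exp m \<Sigma> gV"
  define S where "S = gauss_exp m \<Sigma> HV"
  define A where "A = mat 1 - \<eta> *\<^sub>R S"
  define Sh where "Sh = A ** \<Sigma> ** A"
  have m': "m' = m - \<eta> *\<^sub>R b"
    and \<Sigma>'_eq: "\<Sigma>' = (1/2) *\<^sub>R (Sh + (2 * \<eta>) *\<^sub>R mat 1 + mat_sqrt (Sh ** (Sh + (4 * \<eta>) *\<^sub>R mat 1)))"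
    using step by (simp_all add: fb_step_def Let_def b_def S_def A_def Sh_def)
  note S = mean_hessian[OF Minv, where m=m, unfolded tM M(2), folded S_def]
  have tA: "transpose A = A" using S(1) by (simp add: A_def transpose_diff transpose_scalar)
  \<comment> \<open>The step size restriction makes the forward map the gradient of a convex
    function, which is the hypothesis of \<open>near_optimal_transport\<close>.\<close>
  have A_psd: "psd_mat A"
  proof -
    have "0 \<le> v \<bullet> (A *v v)" for v
    proof -
      have "\<eta> * (v \<bullet> (S *v v)) \<le> \<eta> * (\<beta> * (v \<bullet> v))" using S(2)[of v] \<eta>(1) by (intro mult_left_mono) auto
      also have "\<dots> \<le> 1 * (v \<bullet> v)" unfolding mult.assoc[symmetric] using \<eta>\<beta> by (intro mult_right_mono) auto
      finally show ?thesis
        by (simp add: A_def matrix_vector_mult_diff_rdistrib scaleR_matrix_vector_assoc[symmetric] inner_diff_right)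
    qed
    then show ?thesis using tA by (simp add: psd_mat_def)
  qed
  have Sh_psd: "psd_mat Sh" unfolding Sh_def using psd_congruence[OF spd_imp_psd[OF \<Sigma>], of A] tA by simp
  show \<Sigma>': "spd_mat \<Sigma>'" by (rule backward_step_covariance(1)[OF Sh_psd \<eta>(1) \<Sigma>'_eq])
  obtain B L where L: "L ** \<Sigma>' = mat 1" and B: "B = mat 1 - \<eta> *\<^sub>R L" "psd_mat B" "B ** \<Sigma>' ** B = Sh"
    using backward_step_covariance(2)[OF Sh_psd \<eta>(1) \<Sigma>'_eq] by blast
  have tB: "transpose B = B" using B(2) by (simp add: psd_mat_def)
  obtain M' where M': "spd_mat M'" "M' ** M' = \<Sigma>'" using spd_sqrt_exists[OF \<Sigma>'] .
  have tM': "transpose M' = M'" using M' by (simp add: spd_mat_def)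
  note M'inv = spd_invertible[OF M'(1)]
  obtain N where N: "invertible N" "N ** transpose N = \<Omega>"
    "W2sq (gauss m \<Sigma>) (gauss n \<Omega>) = ennreal ((m - n) \<bullet> (m - n) + (M - N) \<bullet> (M - N))"
    using W2sq_gauss_attained[OF M(1) \<Omega>, of m n, unfolded M(2)] by blast
  have cov: "A ** M ** M ** A = B ** M' ** M' ** B"
    using B(3) unfolding Sh_def M(2)[symmetric] M'(2)[symmetric] by (simp add: matrix_mul_assoc)
  \<comment> \<open>Both constants are fixed before \<delta>, since the errors have to vanish as
    \<delta> tends to 0.\<close>
  obtain C1 where C1: "\<forall>\<delta>>0.
    \<exists>Q K. spd_mat Q \<and> K = Q ** (A + \<delta> *\<^sub>R mat 1) ** M \<and> K ** transpose K = \<Sigma>'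
      \<and> (\<forall>X Y :: real^'n^'n. X ** transpose X = A ** M ** M ** A \<longrightarrow> Y ** transpose Y = \<Sigma>' \<longrightarrow>
            X \<bullet> Y \<le> (A ** M) \<bullet> K + C1 * \<delta>)"
    using near_optimal_transport[OF A_psd M(1) \<Sigma>'] by (rule exE)
  obtain C2 where C2: "\<forall>\<delta>>0.
    \<exists>Q J. spd_mat Q \<and> J = Q ** (B + \<delta> *\<^sub>R mat 1) ** M' \<and> J ** transpose J = \<Omega>
      \<and> (\<forall>X Y :: real^'n^'n. X ** transpose X = B ** M' ** M' ** B \<longrightarrow> Y ** transpose Y = \<Omega> \<longrightarrow>
            X \<bullet> Y \<le> (B ** M') \<bullet> J + C2 * \<delta>)"
    using near_optimal_transport[OF B(2) M'(1) \<Omega>] by (rule exE)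
  define lhs where "lhs = enn2real (W2sq (gauss m' \<Sigma>') (gauss n \<Omega>)) + 2 * \<eta> * (free_en V m' \<Sigma>' - free_en V n \<Omega>)"
  define rhs where "rhs = (1 - \<alpha> * \<eta>) * ((m - n) \<bullet> (m - n) + (M - N) \<bullet> (M - N))"
  have approx: "lhs \<le> rhs + \<delta> * (2 * C1 + 2 * C2)" if \<delta>: "0 < \<delta>" for \<delta>
  proof -
    obtain Q1 K where K: "spd_mat Q1" "K = Q1 ** (A + \<delta> *\<^sub>R mat 1) ** M" "K ** transpose K = \<Sigma>'"
      and Kopt: "\<And>X Y :: real^'n^'n. X ** transpose X = A ** M ** M ** A \<Longrightarrow> Y ** transpose Y = \<Sigma>' \<Longrightarrow>
            X \<bullet> Y \<le> (A ** M) \<bullet> K + C1 * \<delta>"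
      using C1[rule_format, OF \<delta>] by blast
    obtain Q2 J where J: "spd_mat Q2" "J = Q2 ** (B + \<delta> *\<^sub>R mat 1) ** M'" "J ** transpose J = \<Omega>"
      and Jopt: "\<And>X Y :: real^'n^'n. X ** transpose X = B ** M' ** M' ** B \<Longrightarrow> Y ** transpose Y = \<Omega> \<Longrightarrow>
            X \<bullet> Y \<le> (B ** M') \<bullet> J + C2 * \<delta>"
      using C2[rule_format, OF \<delta>] by blast
    have A\<delta>: "spd_mat (A + \<delta> *\<^sub>R mat 1)" and B\<delta>: "spd_mat (B + \<delta> *\<^sub>R mat 1)"
      using spd_add_scaleR_mat A_psd B(2) \<delta> by blast+
    have Kinv: "invertible K" and Jinv: "invertible J"
      unfolding K(2) J(2) by (intro invertible_mult spd_invertible K(1) J(1) A\<delta> B\<delta> M M')+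
    \<comment> \<open>\<open>B ** M'\<close> and \<open>M'\<close> compete for the pair of half step
      and \<open>\<Sigma>'\<close>, \<open>A ** M\<close> and \<open>N\<close> for the pair of half
      step and \<open>\<Omega>\<close>. With all norms fixed by the covariances, a nearly maximal
      inner product is a nearly minimal transport cost.\<close>
    have opt1: "(B ** M') \<bullet> M' \<le> (A ** M) \<bullet> K + C1 * \<delta>"
      by (rule Kopt) (simp_all add: cov matrix_transpose_mul tB tM' M'(2) matrix_mul_assoc)
    have opt2: "(A ** M) \<bullet> N \<le> (B ** M') \<bullet> J + C2 * \<delta>"
      by (rule Jopt) (simp_all add: cov[symmetric] matrix_transpose_mul tA tM N(2) matrix_mul_assoc)
    have trace_gram: "X \<bullet> X = trace (X ** transpose X)" for X :: "real^'n^'n"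
      by (metis matrix_inner_eq_trace matrix_inner_transpose transpose_transpose)
    have KK: "K \<bullet> K = M' \<bullet> M'" and JJ: "J \<bullet> J = N \<bullet> N"
      by (simp_all add: trace_gram K(3) J(3) N(2) tM' M'(2))
    have W': "enn2real (W2sq (gauss m' \<Sigma>') (gauss n \<Omega>)) \<le> (m' - n) \<bullet> (m' - n) + (M' - J) \<bullet> (M' - J)"
    proof (rule enn2real_leI)
      show "W2sq (gauss m' \<Sigma>') (gauss n \<Omega>) \<le> ennreal ((m' - n) \<bullet> (m' - n) + (M' - J) \<bullet> (M' - J))"
        using W2sq_gauss_le[OF M'inv Jinv, of m' n] by (simp add: tM' M'(2) J(3))
    qed simp
    let ?G = "Q2 ** (B + \<delta> *\<^sub>R mat 1)"
    \<comment> \<open>The optimality condition of the proximal step: \<open>L\<close> is the inverse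
      of \<open>\<Sigma>'\<close>, so the left-hand side is minus \<eta> times the entropy gradient
      at \<open>M'\<close>, and the right-hand side is the displacement of the backward
      step.\<close>
    have LM: "\<eta> *\<^sub>R (L ** M') = M' - B ** M'" by (simp add: B(1) matrix_algebra)
    have "(L ** M') \<bullet> J = trace ?G"
    proof -
      have "(L ** M') \<bullet> J = ?G \<bullet> (L ** M' ** transpose M')"
        unfolding J(2) by (metis inner_commute matrix_inner_mult_right)
      also have "L ** M' ** transpose M' = mat 1" using L M'(2) tM' by (simp flip: matrix_mul_assoc)
      finally show ?thesis by (simp add: inner_commute[of ?G] matrix_inner_one)
    qed
    moreover have "(L ** M') \<bullet> M' = CARD('n)"
    proof -
      have "(L ** M') \<bullet> M' = M' \<bullet> (L ** M')" by (rule inner_commute)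
      also have "\<dots> = mat 1 \<bullet> (L ** M' ** transpose M')"
        using matrix_inner_mult_right[of "mat 1" M' "L ** M'"] by simp
      also have "L ** M' ** transpose M' = mat 1" using L M'(2) tM' by (simp flip: matrix_mul_assoc)
      finally show ?thesis by (simp add: matrix_inner_one trace_I)
    qed
    ultimately have "\<eta> * (trace ?G - CARD('n)) = (M' - B ** M') \<bullet> (J - M')"
      unfolding LM[symmetric] by (simp add: inner_diff_right right_diff_distrib)
    moreover have "\<eta> * (entropy_gauss m' \<Sigma>' - entropy_gauss n \<Omega>) \<le> \<eta> * (trace ?G - CARD('n))"
      using entropy_difference_le[OF M'(1) J(1) B\<delta> J(2), of m' n] \<eta>(1) by (simp add: M'(2) J(3))
    ultimately have ent: "\<eta> * (entropy_gauss m' \<Sigma>' - entropy_gauss n \<Omega>) \<le> (M' - B ** M') \<bullet> (J - M')"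
      by simp
    have SM: "\<eta> *\<^sub>R (S ** M) = M - A ** M" by (simp add: A_def matrix_algebra)
    have distr: "\<eta> * (x + y + c / 2 * q) = \<eta> * x + \<eta> * y + (\<eta> * c) / 2 * q" for x y c q :: real
      by (simp add: algebra_simps)
    \<comment> \<open>Smoothness is applied along the coupling of \<open>\<Sigma>\<close> and
      \<open>\<Sigma>'\<close> by \<open>M\<close> and \<open>K\<close>, because the forward
      displacement \<open>M - A ** M\<close> lives on the side of \<open>M\<close>; strong convexity
      below uses \<open>M\<close> and \<open>N\<close>.\<close>
    have upper: "\<eta> * (potential_en V m' \<Sigma>' - potential_en V m \<Sigma>) \<le> \<eta> * ((m' - m) \<bullet> b) + (K - M) \<bullet> (M - A ** M)
      + (\<eta> * \<beta>) / 2 * ((m' - m) \<bullet> (m' - m) + (K - M) \<bullet> (K - M))"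
    proof -
      have "potential_en V m' \<Sigma>' - potential_en V m \<Sigma> \<le> (m' - m) \<bullet> b + (K - M) \<bullet> (S ** M)
        + \<beta> / 2 * ((m' - m) \<bullet> (m' - m) + (K - M) \<bullet> (K - M))"
        using potential_expansion(2)[OF Kinv Minv, of m' m] by (simp add: K(3) tM M(2) b_def S_def)
      from mult_left_mono[OF this less_imp_le[OF \<eta>(1)]] show ?thesis
        unfolding SM[symmetric] distr inner_scaleR_right .
    qed
    have lower: "\<eta> * ((n - m) \<bullet> b) + (N - M) \<bullet> (M - A ** M) + (\<eta> * \<alpha>) / 2 * ((n - m) \<bullet> (n - m) + (N - M) \<bullet> (N - M))
      \<le> \<eta> * (potential_en V n \<Omega> - potential_en V m \<Sigma>)"
    proof -
      have "(n - m) \<bullet> b + (N - M) \<bullet> (S ** M) + \<alpha> / 2 * ((n - m) \<bullet> (n - m) + (N - M) \<bullet> (N - M))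
        \<le> potential_en V n \<Omega> - potential_en V m \<Sigma>"
        using potential_expansion(1)[OF N(1) Minv, of n m] by (simp add: N(2) tM M(2) b_def S_def)
      from mult_left_mono[OF this less_imp_le[OF \<eta>(1)]] show ?thesis
        unfolding SM[symmetric] distr inner_scaleR_right .
    qed
    have "lhs \<le> (m' - n) \<bullet> (m' - n) + (M' - J) \<bullet> (M' - J) + 2 * ((M' - B ** M') \<bullet> (J - M'))
      + 2 * (\<eta> * ((m' - m) \<bullet> b) + (K - M) \<bullet> (M - A ** M) + (\<eta> * \<beta>) / 2 * ((m' - m) \<bullet> (m' - m) + (K - M) \<bullet> (K - M)))
      - 2 * (\<eta> * ((n - m) \<bullet> b) + (N - M) \<bullet> (M - A ** M) + (\<eta> * \<alpha>) / 2 * ((n - m) \<bullet> (n - m) + (N - M) \<bullet> (N - M)))"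
    proof -
      have "lhs = enn2real (W2sq (gauss m' \<Sigma>') (gauss n \<Omega>))
        + 2 * (\<eta> * (entropy_gauss m' \<Sigma>' - entropy_gauss n \<Omega>))
        + 2 * (\<eta> * (potential_en V m' \<Sigma>' - potential_en V m \<Sigma>))
        - 2 * (\<eta> * (potential_en V n \<Omega> - potential_en V m \<Sigma>))"
        by (simp add: lhs_def free_en_def algebra_simps)
      moreover have "x + 2 * e + 2 * u - 2 * v \<le> x' + 2 * e' + 2 * u' - 2 * v'"
        if "x \<le> x'" "e \<le> e'" "u \<le> u'" "v' \<le> v" for x x' e e' u u' v v' :: real
        using that by linarith
      note this[OF W' ent upper lower]
      ultimately show ?thesis by (simp only:)
    qed
    also have "\<dots> \<le> rhs + \<delta> * (2 * C1 + 2 * C2)"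
    proof -
      \<comment> \<open>In terms of \<open>d = m - n\<close> the terms linear in \<open>b\<close>
        cancel, and the excess is
        \<open>(\<eta> \<beta> - 1) \<eta>\<^sup>2 |b|\<^sup>2 \<le> 0\<close>.\<close>
      have mean: "(m' - n) \<bullet> (m' - n) + 2 * (\<eta> * ((m' - m) \<bullet> b)) + (\<eta> * \<beta>) * ((m' - m) \<bullet> (m' - m))
        - 2 * (\<eta> * ((n - m) \<bullet> b)) - \<eta> * \<alpha> * ((n - m) \<bullet> (n - m)) \<le> (1 - \<alpha> * \<eta>) * ((m - n) \<bullet> (m - n))"
      proof -
        define d where "d = m - n"
        have eqs: "m' - n = d - \<eta> *\<^sub>R b" "m' - m = - (\<eta> *\<^sub>R b)" "n - m = - d" by (simp_all add: d_def m')
        have "(\<eta> * \<beta>) * (\<eta> * \<eta> * (b \<bullet> b)) \<le> 1 * (\<eta> * \<eta> * (b \<bullet> b))"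
          using \<eta>\<beta> by (intro mult_right_mono) auto
        then show ?thesis unfolding eqs d_def[symmetric]
          by (simp add: inner_diff_left inner_diff_right inner_commute algebra_simps)
      qed
      have "(\<eta> * \<beta>) * ((K - M) \<bullet> (K - M)) \<le> 1 * ((K - M) \<bullet> (K - M))"
        using \<eta>\<beta> by (intro mult_right_mono) auto
      \<comment> \<open>After expansion with \<open>KK\<close> and \<open>JJ\<close>, all that
        exceeds \<open>|M - N|\<^sup>2\<close>, apart from a nonpositive multiple of
        \<open>|K - M|\<^sup>2\<close>, is twice each of the gaps bounded by \<open>opt1\<close> and
        \<open>opt2\<close>; hence the constant \<open>2 * C1 + 2 * C2\<close>.\<close>
      then have "(M' - J) \<bullet> (M' - J) + 2 * ((M' - B ** M') \<bullet> (J - M')) + 2 * ((K - M) \<bullet> (M - A ** M))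
        + (\<eta> * \<beta>) * ((K - M) \<bullet> (K - M)) - 2 * ((N - M) \<bullet> (M - A ** M))
        \<le> (M - N) \<bullet> (M - N) + \<delta> * (2 * C1 + 2 * C2)"
        using opt1 opt2 KK JJ
        by (simp add: inner_diff_left inner_diff_right inner_commute algebra_simps)
      moreover have "(N - M) \<bullet> (N - M) = (M - N) \<bullet> (M - N)"
        by (simp add: inner_diff_left inner_diff_right)
      moreover have "x + y + 2 * z + 2 * (t + k + (\<eta> * \<beta>) / 2 * (p + q)) - 2 * (t' + k' + (\<eta> * \<alpha>) / 2 * (r + s))
          \<le> (1 - \<alpha> * \<eta>) * (D + s) + e"
        if "x + 2 * t + (\<eta> * \<beta>) * p - 2 * t' - \<eta> * \<alpha> * r \<le> (1 - \<alpha> * \<eta>) * D"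
          "y + 2 * z + 2 * k + (\<eta> * \<beta>) * q - 2 * k' \<le> s + e" for x y z t k p q t' k' r s D e :: real
        using that by (simp add: field_simps)
      note this[OF mean]
      ultimately show ?thesis unfolding rhs_def by (simp only:)
    qed
    finally show ?thesis .
  qed
  \<comment> \<open>Neither \<open>lhs\<close> nor \<open>rhs\<close> involves \<delta>, so the
    regularisation disappears in the limit.\<close>
  have "lhs \<le> rhs"
  proof (rule tendsto_lowerbound)
    have "((\<lambda>\<delta>. rhs + \<delta> * (2 * C1 + 2 * C2)) \<longlongrightarrow> rhs + 0 * (2 * C1 + 2 * C2)) (at_right 0)"
      by (intro tendsto_intros)
    then show "((\<lambda>\<delta>. rhs + \<delta> * (2 * C1 + 2 * C2)) \<longlongrightarrow> rhs) (at_right 0)" by simp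
    show "\<forall>\<^sub>F \<delta> in at_right 0. lhs \<le> rhs + \<delta> * (2 * C1 + 2 * C2)"
      using approx by (auto simp: eventually_at_right_field intro!: exI[of _ 1])
  qed simp
  then show "enn2real (W2sq (gauss m' \<Sigma>') (gauss n \<Omega>)) + 2 * \<eta> * (free_en V m' \<Sigma>' - free_en V n \<Omega>)
      \<le> (1 - \<alpha> * \<eta>) * enn2real (W2sq (gauss m \<Sigma>) (gauss n \<Omega>))"
    unfolding lhs_def rhs_def N(3)
    by (subst enn2real_ennreal) (simp_all only: add_nonneg_nonneg inner_ge_zero)
qed

section \<open>From one step to the iterates\<close>

lemma fb_iter_spd:
  assumes "spd_mat \<Sigma>0" "0 < \<eta>" "\<eta> \<le> 1 / \<beta>"
  shows "spd_mat (snd (fb_iter gV HV \<eta> m0 \<Sigma>0 k))"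
proof (induction k)
  case (Suc k)
  obtain m \<Sigma> m' \<Sigma>' where "fb_iter gV HV \<eta> m0 \<Sigma>0 k = (m, \<Sigma>)" "fb_step gV HV \<eta> (m, \<Sigma>) = (m', \<Sigma>')"
    by (metis prod.exhaust)
  then show ?case using fb_step_contraction(1)[of \<Sigma> \<Sigma> \<eta> m m' \<Sigma>'] Suc assms by simp
qed (simp add: assms)

lemma fb_iter_contraction:
  fixes m0 n :: "real^'n" and \<Sigma>0 \<Omega> :: "real^'n^'n" and \<eta> :: real
  assumes init: "spd_mat \<Sigma>0" and \<eta>: "0 < \<eta>" "\<eta> \<le> 1 / \<beta>" and \<Omega>: "spd_mat \<Omega>"
  defines "p \<equiv> fb_iter gV HV \<eta> m0 \<Sigma>0"
  defines "w \<equiv> \<lambda>k. enn2real (W2sq (case_prod gauss (p k)) (gauss n \<Omega>))"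
  shows "w (Suc k) + 2 * \<eta> * (case_prod (free_en V) (p (Suc k)) - free_en V n \<Omega>) \<le> (1 - \<alpha> * \<eta>) * w k"
    and "case_prod (free_en V) (p (Suc k)) \<le> case_prod (free_en V) (p k)"
    and "W2sq (case_prod gauss (p k)) (gauss n \<Omega>) = ennreal (w k)"
proof -
  obtain m \<Sigma> where p: "p k = (m, \<Sigma>)" by (metis prod.exhaust)
  obtain m' \<Sigma>' where step: "fb_step gV HV \<eta> (m, \<Sigma>) = (m', \<Sigma>')" by (metis prod.exhaust)
  have p': "p (Suc k) = (m', \<Sigma>')" using p step by (simp add: p_def)
  have \<Sigma>: "spd_mat \<Sigma>" using fb_iter_spd[OF init \<eta>, of m0 k] p by (simp add: p_def)
  show "w (Suc k) + 2 * \<eta> * (case_prod (free_en V) (p (Suc k)) - free_en V n \<Omega>) \<le> (1 - \<alpha> * \<eta>) * w k"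
    using fb_step_contraction(2)[OF \<Sigma> \<Omega> \<eta> step, of n] by (simp add: w_def p p')
  have "enn2real (W2sq (gauss m' \<Sigma>') (gauss m \<Sigma>)) + 2 * \<eta> * (free_en V m' \<Sigma>' - free_en V m \<Sigma>) \<le> 0"
    using fb_step_contraction(2)[OF \<Sigma> \<Sigma> \<eta> step, of m] by (simp add: W2sq_gauss_self[OF \<Sigma>])
  then have "2 * \<eta> * (free_en V m' \<Sigma>' - free_en V m \<Sigma>) \<le> 0"
    using enn2real_nonneg[of "W2sq (gauss m' \<Sigma>') (gauss m \<Sigma>)"] by linarith
  then show "case_prod (free_en V) (p (Suc k)) \<le> case_prod (free_en V) (p k)"
    using \<eta>(1) by (simp add: p p' mult_le_0_iff)
  show "W2sq (case_prod gauss (p k)) (gauss n \<Omega>) = ennreal (w k)"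
    unfolding w_def p using W2sq_gauss_finite[OF \<Sigma> \<Omega>] by simp
qed

end

theorem mainTheorem3:
  fixes V :: "real^'n \<Rightarrow> real"
    and gV :: "real^'n \<Rightarrow> real^'n"
    and HV :: "real^'n \<Rightarrow> real^'n^'n"
    and \<alpha> \<beta> \<eta> :: real
    and m0 mstar :: "real^'n" and \<Sigma>0 \<Sigma>star :: "real^'n^'n"
  assumes grad: "\<And>x. (V has_derivative (\<lambda>h. gV x \<bullet> h)) (at x)"
    and hess: "\<And>x. (gV has_derivative (\<lambda>h. HV x *v h)) (at x)"
    and hess_cont: "continuous_on UNIV HV"
    and alpha_pos: "0 < \<alpha>" and alpha_le_beta: "\<alpha> \<le> \<beta>"
    and strongly_convex: "\<And>x. loewner_le (\<alpha> *\<^sub>R mat 1) (HV x)"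
    and smooth: "\<And>x. loewner_le (- (\<beta> *\<^sub>R mat 1)) (HV x) \<and> loewner_le (HV x) (\<beta> *\<^sub>R mat 1)"
    and eta_pos: "0 < \<eta>" and eta_le: "\<eta> \<le> 1 / \<beta>"
    and init: "spd_mat \<Sigma>0"
    and minimizer: "spd_mat \<Sigma>star"
      "\<And>m \<Sigma>. spd_mat \<Sigma> \<Longrightarrow> free_en V mstar \<Sigma>star \<le> free_en V m \<Sigma>"
  shows "(\<forall>N::nat.
            W2sq (case_prod gauss (fb_iter gV HV \<eta> m0 \<Sigma>0 N)) (gauss mstar \<Sigma>star)
              \<le> ennreal (exp (- \<alpha> * real N * \<eta>)) * W2sq (gauss m0 \<Sigma>0) (gauss mstar \<Sigma>star))
       \<and> (\<eta> = 1 / \<beta> \<longrightarrow>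
            (\<forall>\<epsilon>>0. \<forall>N::nat.
               real N \<ge> \<beta> / \<alpha> * max 1 (ln (\<alpha> * enn2real (W2sq (gauss m0 \<Sigma>0) (gauss mstar \<Sigma>star)) / \<epsilon>\<^sup>2))
               \<longrightarrow> ennreal \<alpha> * W2sq (case_prod gauss (fb_iter gV HV \<eta> m0 \<Sigma>0 N)) (gauss mstar \<Sigma>star)
                     \<le> ennreal (\<epsilon>\<^sup>2)
                 \<and> case_prod (free_en V) (fb_iter gV HV \<eta> m0 \<Sigma>0 (2 * N)) - free_en V mstar \<Sigma>star
                     \<le> \<epsilon>\<^sup>2))"
proof -
  interpret smooth_potential V gV HV \<alpha> \<beta>
  proof
    show "(V has_derivative (\<lambda>h. gV x \<bullet> h)) (at x)" "(gV has_derivative (\<lambda>h. HV x *v h)) (at x)" for x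
      by (rule grad hess)+
    show "continuous_on UNIV HV" "0 < \<alpha>" "\<alpha> \<le> \<beta>" by (rule hess_cont alpha_pos alpha_le_beta)+
    fix x h :: "real^'n"
    have "(c *\<^sub>R (mat 1 :: real^'n^'n)) *v h = c *\<^sub>R h" for c :: real
      by (simp flip: scaleR_matrix_vector_assoc)
    then show "\<alpha> * (h \<bullet> h) \<le> h \<bullet> (HV x *v h)" "h \<bullet> (HV x *v h) \<le> \<beta> * (h \<bullet> h)"
      using strongly_convex[of x] smooth[of x] unfolding loewner_le_def by (metis inner_scaleR_right)+
  qed
  define p where "p = fb_iter gV HV \<eta> m0 \<Sigma>0"
  define w where "w k = enn2real (W2sq (case_prod gauss (p k)) (gauss mstar \<Sigma>star))" for k
  define F where "F k = case_prod (free_en V) (p k) - free_en V mstar \<Sigma>star" for k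
  note contr = fb_iter_contraction(1,3)[OF init eta_pos eta_le minimizer(1), where ?m0.0 = m0 and n = mstar, folded p_def]
    and descent = fb_iter_contraction(2)[OF init eta_pos eta_le minimizer(1), where ?m0.0 = m0, folded p_def]
  have W: "W2sq (case_prod gauss (p k)) (gauss mstar \<Sigma>star) = ennreal (w k)" for k
    using contr(2)[of k] by (simp add: w_def)
  have w0: "0 \<le> w k" for k by (simp add: w_def)
  have F0: "0 \<le> F k" for k
    using minimizer(2)[OF fb_iter_spd[OF init eta_pos eta_le, of m0 k]] by (simp add: F_def p_def split_beta)
  have step: "w (Suc k) + 2 * \<eta> * F (Suc k) \<le> (1 - \<alpha> * \<eta>) * w k" for k
    using contr(1)[of k] by (simp add: w_def F_def)
  have F_dec: "F (Suc k) \<le> F k" for k using descent[of k] by (simp add: F_def)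
  have step': "w (Suc k) \<le> exp (- \<alpha> * \<eta>) * w k" for k
  proof -
    have "0 \<le> 2 * \<eta> * F (Suc k)" using eta_pos F0 by simp
    then have "w (Suc k) \<le> (1 - \<alpha> * \<eta>) * w k" using step[of k] by linarith
    also have "\<dots> \<le> exp (- \<alpha> * \<eta>) * w k"
      using exp_ge_add_one_self[of "- \<alpha> * \<eta>"] by (intro mult_right_mono w0) simp
    finally show ?thesis .
  qed
  have rate: "w N \<le> exp (- \<alpha> * real N * \<eta>) * w 0" for N
  proof (induction N)
    case (Suc N)
    have "w (Suc N) \<le> exp (- \<alpha> * \<eta>) * (exp (- \<alpha> * real N * \<eta>) * w 0)"
      using order_trans[OF step'[of N] mult_left_mono[OF Suc exp_ge_zero]] .
    also have "\<dots> = exp (- \<alpha> * real (Suc N) * \<eta>) * w 0"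
      unfolding mult.assoc[symmetric] exp_add[symmetric] by (simp add: algebra_simps)
    finally show ?case .
  qed simp
  have W0: "W2sq (gauss m0 \<Sigma>0) (gauss mstar \<Sigma>star) = ennreal (w 0)"
    using W[of 0] by (simp add: p_def)
  \<comment> \<open>The contraction factor is replaced by 1 so that the distances telescope; since
    \<open>F\<close> decreases, each of the \<open>j\<close> energy gaps may be replaced by the last
    one.\<close>
  have telescope: "w (N + j) + 2 * \<eta> * real j * F (N + j) \<le> w N" for N j
  proof (induction j)
    case (Suc j)
    have "(1 - \<alpha> * \<eta>) * w (N + j) \<le> 1 * w (N + j)"
      using alpha_pos eta_pos by (intro mult_right_mono w0) simp
    then have 1: "w (N + Suc j) + 2 * \<eta> * F (N + Suc j) \<le> w (N + j)"
      using step[of "N + j"] by simp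
    have "2 * \<eta> * real j * F (N + Suc j) \<le> 2 * \<eta> * real j * F (N + j)"
      using F_dec[of "N + j"] eta_pos by (intro mult_left_mono) auto
    then show ?case using 1 Suc by (simp add: algebra_simps)
  qed simp
  have "\<alpha> * w N \<le> \<epsilon>\<^sup>2 \<and> F (2 * N) \<le> \<epsilon>\<^sup>2"
    if \<eta>: "\<eta> = 1 / \<beta>" and \<epsilon>: "0 < \<epsilon>" and N: "\<beta> / \<alpha> * max 1 (ln (\<alpha> * w 0 / \<epsilon>\<^sup>2)) \<le> real N" for \<epsilon> N
  proof -
    \<comment> \<open>For \<open>\<eta> = 1 / \<beta>\<close> the condition on \<open>N\<close>
      bounds \<open>\<alpha> * real N * \<eta>\<close> below by both entries of the maximum: the
      logarithm serves the distance, the 1 serves the energy.\<close>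
    have "x \<le> \<alpha> * real N * \<eta>" if "\<beta> / \<alpha> * x \<le> real N" for x
      using that alpha_pos beta_pos by (simp add: \<eta> field_simps)
    from this[OF N] have N1: "1 \<le> \<alpha> * real N * \<eta>" and Nln: "ln (\<alpha> * w 0 / \<epsilon>\<^sup>2) \<le> \<alpha> * real N * \<eta>" by auto
    have a: "\<alpha> * w N \<le> \<epsilon>\<^sup>2"
    proof -
      have "\<alpha> * w 0 / \<epsilon>\<^sup>2 \<le> exp (\<alpha> * real N * \<eta>)"
      \<comment> \<open>For \<open>w 0 = 0\<close> the logarithm takes the default value
        \<open>ln 0 = 0\<close> and carries no information, but the bound is then trivial.\<close>
      proof (cases "w 0 = 0")
        case False
        then have "0 < \<alpha> * w 0 / \<epsilon>\<^sup>2" using alpha_pos \<epsilon> w0[of 0] by simp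
        then show ?thesis using Nln by (metis exp_le_cancel_iff exp_ln)
      qed simp
      then have "\<alpha> * w 0 \<le> exp (\<alpha> * real N * \<eta>) * \<epsilon>\<^sup>2" using \<epsilon> by (simp add: divide_le_eq)
      then have "exp (- (\<alpha> * real N * \<eta>)) * (\<alpha> * w 0) \<le> exp (- (\<alpha> * real N * \<eta>)) * (exp (\<alpha> * real N * \<eta>) * \<epsilon>\<^sup>2)"
        by (intro mult_left_mono) auto
      also have "\<dots> = \<epsilon>\<^sup>2" by (simp add: exp_minus)
      finally have "exp (- (\<alpha> * real N * \<eta>)) * (\<alpha> * w 0) \<le> \<epsilon>\<^sup>2" .
      moreover have "\<alpha> * w N \<le> \<alpha> * (exp (- \<alpha> * real N * \<eta>) * w 0)"
        using rate[of N] alpha_pos by (intro mult_left_mono) auto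
      ultimately show ?thesis by (simp add: mult_ac)
    qed
    \<comment> \<open>The first \<open>N\<close> steps have made the distance small; the next
      \<open>N\<close> convert it into an energy bound, since \<open>2 \<alpha> N \<eta>\<close> is
      at least 1.\<close>
    have "2 * \<eta> * real N * F (2 * N) \<le> w N"
      using telescope[of N N, folded mult_2[of N]] w0[of "2 * N"] by linarith
    then have "\<alpha> * (2 * \<eta> * real N * F (2 * N)) \<le> \<epsilon>\<^sup>2"
      using a mult_left_mono[of "2 * \<eta> * real N * F (2 * N)" "w N" \<alpha>] alpha_pos by linarith
    moreover have "1 * F (2 * N) \<le> (2 * (\<alpha> * real N * \<eta>)) * F (2 * N)"
      using N1 F0 by (intro mult_right_mono) auto
    ultimately have "F (2 * N) \<le> \<epsilon>\<^sup>2" by (simp add: mult_ac)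
    with a show ?thesis by blast
  qed
  then show ?thesis
    unfolding p_def[symmetric] W W0 F_def[symmetric] enn2real_ennreal[OF w0]
    using rate alpha_pos w0 by (auto simp: ennreal_mult'[symmetric] intro!: ennreal_leI)
qed

end
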